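(* Let $\Bbbk$ be a field of characteristic zero, let $U(3)$ be the universal associative conformal envelope of the Virasoro Lie conformal algebra relative to the locality bound $N=3$, and let $\Bbbk$ also denote the trivial one-dimensional conformal $U(3)$-bimodule. Then the third conformal Hochschild cohomology group satisfies $$\dim_{\Bbbk}\mathrm{H}^3(U(3),\Bbbk)=1 .$$
   Context: A conformal algebra over $\Bbbk$ is a $\Bbbk[\partial]$-module $C$ with a bilinear $\lambda$-product $(\cdot{}_{(\lambda)}\cdot):C\otimes C\to C[\lambda]$ satisfying $(\partial a{}_{(\lambda)}b)=-\lambda(a{}_{(\lambda)}b)$ and $(a{}_{(\lambda)}\partial b)=(\partial+\lambda)(a{}_{(\lambda)}b)$. Write $(a{}_{(\lambda)}b)=\sum_{n\ge0}\frac{\lambda^n}{n!}(a{}_{(n)}b)$. It is associative if $(a{}_{(\lambda)}(b{}_{(\mu)}c))=((a{}_{(\lambda)}b){}_{(\lambda+\mu)}c)$. $U(3)$ is the associative conformal algebra generated by one element $v$ with defining relations $v{}_{(n)}v=0$ for $n\ge3$ and $2\,v{}_{(1)}v-\partial(v{}_{(2)}v)=2v$ (the latter is equivalent to $[v{}_{(\lambda)}v]=(\partial+2\lambda)v$, where $[a{}_{(\lambda)}b]=(a{}_{(\lambda)}b)-(b{}_{(-\partial-\lambda)}a)$). Thus it is universal: for every associative conformal algebra $C$ and $c\in C$ satisfying these relations there is a unique homomorphism $U(3)\to C$ of conformal algebras with $v\mapsto c$. The trivial bimodule $\Bbbk$ is one-dimensional, with $\partial$ acting by $0$ and zero left and right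 $\lambda$-actions. The (reduced) Hochschild complex $\mathrm{C}^\bullet(C,\Bbbk)$ has, for $n\ge1$, $\mathrm{C}^n(C,\Bbbk)$ equal to the space of linear maps $\varphi_{\lambda_1,\dots,\lambda_{n-1}}:C^{\otimes n}\to\Bbbk[\lambda_1,\dots,\lambda_{n-1}]$ such that $\varphi(a_1,\dots,\partial a_i,\dots,a_n)=-\lambda_i\varphi(a_1,\dots,a_n)$ for $1\le i\le n-1$ and $\varphi(a_1,\dots,\partial a_n)=(\lambda_1+\dots+\lambda_{n-1})\varphi(a_1,\dots,a_n)$. The differential $\mathrm{C}^n\to\mathrm{C}^{n+1}$ is $$(\mathrm d\varphi)_{\lambda_1,\dots,\lambda_n}(a_1,\dots,a_{n+1})=\sum_{i=1}^{n}(-1)^i\varphi_{\bar\lambda_i}(a_1,\dots,a_i{}_{(\lambda_i)}a_{i+1},\dots,a_{n+1}),$$ where $\bar\lambda_i=(\lambda_1,\dots,\lambda_i+\lambda_{i+1},\dots,\lambda_n)$ for $i<n$ and $\bar\lambda_n=(\lambda_1,\dots,\lambda_{n-1})$ (the two outer terms of the Hochschild differential vanish since the bimodule is trivial). Also $\mathrm{C}^0(C,\Bbbk)=\Bbbk$ with zero differential into $\mathrm{C}^1$. $\mathrm{H}^n(C,\Bbbk)$ is the $n$-th cohomology of this complex. *)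

theory Defs
  imports
    "Jordan_Normal_Form.VS_Connect"
    "HOL-Library.Poly_Mapping"
    "HOL-Library.Function_Algebras"
    "HOL-Library.Set_Algebras"
begin

section \<open>Associative conformal algebras\<close>

text \<open>An element of \<open>C[\<lambda>]\<close> is a value of type \<^typ>\<open>'a poly\<close>; multiplication by
  \<open>\<lambda>\<close> is \<^term>\<open>pCons 0\<close>.  The map \<open>lprod a b\<close> is the \<open>\<lambda>\<close>-product
  \<open>(a\<^sub>(\<^sub>\<lambda>\<^sub>)b)\<close>, and \<open>der\<close> is the action of \<open>\<partial>\<close>.\<close>

locale conformal_algebra = vector_space scale
  for scale :: "'k::field_char_0 \<Rightarrow> 'a::ab_group_add \<Rightarrow> 'a" +
  fixes der :: "'a \<Rightarrow> 'a"
    and lprod :: "'a \<Rightarrow> 'a \<Rightarrow> 'a poly"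
  assumes der_add: "der (a + b) = der a + der b"
    and der_scale: "der (scale r a) = scale r (der a)"
    and lprod_add_left: "lprod (a + b) c = lprod a c + lprod b c"
    and lprod_add_right: "lprod a (b + c) = lprod a b + lprod a c"
    and lprod_scale_left: "lprod (scale r a) b = map_poly (scale r) (lprod a b)"
    and lprod_scale_right: "lprod a (scale r b) = map_poly (scale r) (lprod a b)"
    and lprod_der_left: "lprod (der a) b = - pCons 0 (lprod a b)"
    and lprod_der_right: "lprod a (der b) = map_poly der (lprod a b) + pCons 0 (lprod a b)"
begin

definition nprod :: "nat \<Rightarrow> 'a \<Rightarrow> 'a \<Rightarrow> 'a" where
  "nprod n a b = scale (fact n) (coeff (lprod a b) n)"

end

text \<open>The axiom below equates the coefficients of \<open>\<lambda>\<^sup>m \<mu>\<^sup>n\<close> on the two sides of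
  \<open>(a\<^sub>(\<^sub>\<lambda>\<^sub>)(b\<^sub>(\<^sub>\<mu>\<^sub>)c)) = ((a\<^sub>(\<^sub>\<lambda>\<^sub>)b)\<^sub>(\<^sub>\<lambda>\<^sub>+\<^sub>\<mu>\<^sub>)c)\<close>; on the right, the
  coefficient of \<open>\<lambda>\<^sup>j\<close> in \<open>(a\<^sub>(\<^sub>\<lambda>\<^sub>)b)\<close> meets the part of
  \<open>(\<lambda> + \<mu>)\<^sup>m\<^sup>-\<^sup>j\<^sup>+\<^sup>n\<close> of degree \<open>n\<close> in \<open>\<mu>\<close>.\<close>

locale assoc_conformal_algebra = conformal_algebra scale der lprod
  for scale :: "'k::field_char_0 \<Rightarrow> 'a::ab_group_add \<Rightarrow> 'a" and der lprod +
  assumes lprod_assoc: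
    "coeff (lprod a (coeff (lprod b c) n)) m =
      (\<Sum>j\<le>m. scale (of_nat ((m - j + n) choose n))
                (coeff (lprod (coeff (lprod a b) j) c) (m - j + n)))"

definition conformal_hom ::
  "('k \<Rightarrow> 'a::ab_group_add \<Rightarrow> 'a) \<Rightarrow> ('a \<Rightarrow> 'a) \<Rightarrow> ('a \<Rightarrow> 'a \<Rightarrow> 'a poly) \<Rightarrow>
   ('k \<Rightarrow> 'b::ab_group_add \<Rightarrow> 'b) \<Rightarrow> ('b \<Rightarrow> 'b) \<Rightarrow> ('b \<Rightarrow> 'b \<Rightarrow> 'b poly) \<Rightarrow> ('a \<Rightarrow> 'b) \<Rightarrow> bool" where
  "conformal_hom scale der lprod scale' der' lprod' f \<longleftrightarrow>
    (\<forall>a b. f (a + b) = f a + f b) \<and>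
    (\<forall>r a. f (scale r a) = scale' r (f a)) \<and>
    (\<forall>a. f (der a) = der' (f a)) \<and>
    (\<forall>a b. lprod' (f a) (f b) = map_poly f (lprod a b))"


section \<open>Quotients of vector spaces\<close>

text \<open>The space \<open>Z / B\<close> of cosets \<open>z + B\<close>.  Sums of cosets are Minkowski sums; adding \<open>B\<close> in
  the scalar multiplication only matters for the scalar \<open>0\<close>.  The ring multiplication and unit of
  the record play no role in a module.\<close>

definition quotient_space ::
  "('k \<Rightarrow> 'v::ab_group_add \<Rightarrow> 'v) \<Rightarrow> 'v set \<Rightarrow> 'v set \<Rightarrow> ('k, 'v set) module" where
  "quotient_space scale Z B =
    \<lparr> carrier = (\<lambda>z. z +o B) ` Z, mult = undefined, one = undefined,
      zero = B, add = (+), smult = (\<lambda>r X. scale r ` X + B) \<rparr>"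


section \<open>The reduced Hochschild complex with trivial coefficients\<close>

text \<open>Polynomials in \<open>\<lambda>\<^sub>1, \<lambda>\<^sub>2, \<dots>\<close>.  Indices start at \<open>0\<close>: \<open>lam i\<close> is \<open>\<lambda>\<^sub>i\<^sub>+\<^sub>1\<close>, and position
  \<open>i\<close> of an argument list holds \<open>a\<^sub>i\<^sub>+\<^sub>1\<close>.\<close>

type_synonym 'k mpoly = "(nat \<Rightarrow>\<^sub>0 nat) \<Rightarrow>\<^sub>0 'k"

definition const :: "'k::comm_ring_1 \<Rightarrow> 'k mpoly" where
  "const c = Poly_Mapping.single 0 c"

definition lam :: "nat \<Rightarrow> 'k::comm_ring_1 mpoly" where
  "lam i = Poly_Mapping.single (Poly_Mapping.single i 1) 1"

definition mpoly_vars :: "'k::comm_ring_1 mpoly \<Rightarrow> nat set" where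
  "mpoly_vars p = (\<Union>m\<in>Poly_Mapping.keys p. Poly_Mapping.keys m)"

definition mpoly_subst :: "(nat \<Rightarrow> 'k mpoly) \<Rightarrow> 'k::comm_ring_1 mpoly \<Rightarrow> 'k mpoly" where
  "mpoly_subst \<sigma> p =
    (\<Sum>m\<in>Poly_Mapping.keys p. const (Poly_Mapping.lookup p m) *
       (\<Prod>i\<in>Poly_Mapping.keys m. \<sigma> i ^ Poly_Mapping.lookup m i))"

definition cochain_scale :: "'k::comm_ring_1 \<Rightarrow> ('a list \<Rightarrow> 'k mpoly) \<Rightarrow> 'a list \<Rightarrow> 'k mpoly" where
  "cochain_scale r \<phi> = (\<lambda>as. const r * \<phi> as)"

text \<open>The substitution \<open>(\<lambda>\<^sub>1, \<lambda>\<^sub>2, \<dots>) \<mapsto> (\<lambda>\<^sub>1, \<dots>, \<lambda>\<^sub>i + \<lambda>\<^sub>i\<^sub>+\<^sub>1, \<lambda>\<^sub>i\<^sub>+\<^sub>2, \<dots>)\<close>, with \<open>i\<close> shifted by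
  one.  It also covers the last summand of the differential of an \<open>n\<close>-cochain: there \<open>i = n - 1\<close>,
  while only \<open>lam j\<close> with \<open>j < n - 1\<close> occur.\<close>

definition lam_merge :: "nat \<Rightarrow> nat \<Rightarrow> 'k::comm_ring_1 mpoly" where
  "lam_merge i j = (if j < i then lam j else if j = i then lam i + lam (Suc i) else lam (Suc j))"

context conformal_algebra
begin

text \<open>A linear map on \<open>C\<^sup>\<otimes>\<^sup>n\<close> is a multilinear function on lists of length \<open>n\<close>, set to \<open>0\<close> on
  lists of any other length.  For \<open>n = 0\<close> this gives the constants.\<close>

definition cochains :: "nat \<Rightarrow> ('a list \<Rightarrow> 'k mpoly) set" where
  "cochains n = {\<phi>.
     (\<forall>as. length as \<noteq> n \<longrightarrow> \<phi> as = 0) \<and>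
     (\<forall>as. length as = n \<longrightarrow> mpoly_vars (\<phi> as) \<subseteq> {..<n - 1}) \<and>
     (\<forall>as i x y. length as = n \<and> i < n \<longrightarrow>
        \<phi> (as[i := x + y]) = \<phi> (as[i := x]) + \<phi> (as[i := y])) \<and>
     (\<forall>as i r x. length as = n \<and> i < n \<longrightarrow>
        \<phi> (as[i := scale r x]) = const r * \<phi> (as[i := x])) \<and>
     (\<forall>as i. length as = n \<and> i < n - 1 \<longrightarrow>
        \<phi> (as[i := der (as ! i)]) = - lam i * \<phi> as) \<and>
     (\<forall>as. length as = n \<and> 0 < n \<longrightarrow>
        \<phi> (as[n - 1 := der (as ! (n - 1))]) = (\<Sum>i<n - 1. lam i) * \<phi> as)}"

text \<open>The coefficients of \<open>(a\<^sub>i \<^sub>(\<^sub>\<lambda>\<^sub>i\<^sub>) a\<^sub>i\<^sub>+\<^sub>1)\<close> are inserted one at a time, each with its power of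
  \<open>\<lambda>\<^sub>i\<close>.\<close>

definition hochschild_d :: "nat \<Rightarrow> ('a list \<Rightarrow> 'k mpoly) \<Rightarrow> 'a list \<Rightarrow> 'k mpoly" where
  "hochschild_d n \<phi> = (\<lambda>as. if length as = Suc n then
     (\<Sum>i<n. (- 1) ^ Suc i *
        (\<Sum>k\<le>degree (lprod (as ! i) (as ! Suc i)). lam i ^ k *
           mpoly_subst (lam_merge i)
             (\<phi> (take i as @ coeff (lprod (as ! i) (as ! Suc i)) k # drop (i + 2) as))))
     else 0)"

definition cocycles :: "nat \<Rightarrow> ('a list \<Rightarrow> 'k mpoly) set" where
  "cocycles n = {\<phi> \<in> cochains n. hochschild_d n \<phi> = 0}"

definition coboundaries :: "nat \<Rightarrow> ('a list \<Rightarrow> 'k mpoly) set" where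
  "coboundaries n = (case n of 0 \<Rightarrow> {0} | Suc m \<Rightarrow> hochschild_d m ` cochains m)"

definition cohomology :: "nat \<Rightarrow> ('k, ('a list \<Rightarrow> 'k mpoly) set) module" where
  "cohomology n = quotient_space cochain_scale (cocycles n) (coboundaries n)"

end


section \<open>The algebra \<open>U(3)\<close>\<close>

text \<open>Terms in one generator, modulo the congruence generated by the axioms of an associative
  conformal algebra in terms of \<open>n\<close>-products and by the defining relations.  Locality, which is not
  an equation, follows from locality of the generator.\<close>

datatype 'k U3_term =
    Gen
  | Zero
  | Add "'k U3_term" "'k U3_term"
  | Scale 'k "'k U3_term"
  | Der "'k U3_term"
  | NProd nat "'k U3_term" "'k U3_term"

inductive U3_eq :: "'k::field_char_0 U3_term \<Rightarrow> 'k U3_term \<Rightarrow> bool" (infix "\<approx>" 50) where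
  eq_refl: "s \<approx> s"
| eq_sym: "s \<approx> t \<Longrightarrow> t \<approx> s"
| eq_trans: "s \<approx> t \<Longrightarrow> t \<approx> u \<Longrightarrow> s \<approx> u"
| cong_Add: "s \<approx> s' \<Longrightarrow> t \<approx> t' \<Longrightarrow> Add s t \<approx> Add s' t'"
| cong_Scale: "s \<approx> s' \<Longrightarrow> Scale r s \<approx> Scale r s'"
| cong_Der: "s \<approx> s' \<Longrightarrow> Der s \<approx> Der s'"
| cong_NProd: "s \<approx> s' \<Longrightarrow> t \<approx> t' \<Longrightarrow> NProd n s t \<approx> NProd n s' t'"
| Add_assoc: "Add (Add s t) u \<approx> Add s (Add t u)"
| Add_comm: "Add s t \<approx> Add t s"
| Add_Zero: "Add Zero s \<approx> s"
| Add_neg: "Add (Scale (- 1) s) s \<approx> Zero"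
| Scale_Add: "Scale r (Add s t) \<approx> Add (Scale r s) (Scale r t)"
| Scale_plus: "Scale (r + q) s \<approx> Add (Scale r s) (Scale q s)"
| Scale_Scale: "Scale r (Scale q s) \<approx> Scale (r * q) s"
| Scale_one: "Scale 1 s \<approx> s"
| Der_Add: "Der (Add s t) \<approx> Add (Der s) (Der t)"
| Der_Scale: "Der (Scale r s) \<approx> Scale r (Der s)"
| NProd_Add_left: "NProd n (Add s t) u \<approx> Add (NProd n s u) (NProd n t u)"
| NProd_Add_right: "NProd n s (Add t u) \<approx> Add (NProd n s t) (NProd n s u)"
| NProd_Scale_left: "NProd n (Scale r s) t \<approx> Scale r (NProd n s t)"
| NProd_Scale_right: "NProd n s (Scale r t) \<approx> Scale r (NProd n s t)"
| NProd_Der_left: "NProd n (Der s) t \<approx> Scale (- of_nat n) (NProd (n - 1) s t)"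
| NProd_Der_right:
    "NProd n s (Der t) \<approx> Add (Der (NProd n s t)) (Scale (of_nat n) (NProd (n - 1) s t))"
| NProd_NProd:
    "NProd m s (NProd n t u) \<approx>
       foldr Add (map (\<lambda>j. Scale (of_nat (m choose j)) (NProd (n + j) (NProd (m - j) s t) u))
                    [0..<Suc m]) Zero"
| Gen_locality: "3 \<le> n \<Longrightarrow> NProd n Gen Gen \<approx> Zero"
| Gen_Virasoro:
    "Add (Scale 2 (NProd 1 Gen Gen)) (Scale (- 1) (Der (NProd 2 Gen Gen))) \<approx> Scale 2 Gen"

quotient_type (overloaded) 'k U3 = "'k::field_char_0 U3_term" / U3_eq
proof (rule equivpI)
  show "reflp (U3_eq :: 'k U3_term \<Rightarrow> _)" by (rule reflpI) (rule eq_refl)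
  show "symp (U3_eq :: 'k U3_term \<Rightarrow> _)" by (rule sympI) (rule eq_sym)
  show "transp (U3_eq :: 'k U3_term \<Rightarrow> _)" by (rule transpI) (rule eq_trans)
qed

instantiation U3 :: (field_char_0) ab_group_add
begin

lift_definition zero_U3 :: "'a U3" is Zero .
lift_definition plus_U3 :: "'a U3 \<Rightarrow> 'a U3 \<Rightarrow> 'a U3" is Add by (rule cong_Add)
lift_definition uminus_U3 :: "'a U3 \<Rightarrow> 'a U3" is "Scale (- 1)" by (rule cong_Scale)
definition minus_U3 :: "'a U3 \<Rightarrow> 'a U3 \<Rightarrow> 'a U3" where "minus_U3 a b = a + - b"

instance
proof
  fix a b c :: "'a U3"
  show "a + b + c = a + (b + c)" by transfer (rule Add_assoc)
  show "a + b = b + a" by transfer (rule Add_comm)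
  show "0 + a = a" by transfer (rule Add_Zero)
  show "- a + a = 0" by transfer (rule Add_neg)
  show "a - b = a + - b" by (rule minus_U3_def)
qed

end

lift_definition U3_gen :: "'k::field_char_0 U3" is Gen .
lift_definition U3_scale :: "'k::field_char_0 \<Rightarrow> 'k U3 \<Rightarrow> 'k U3" is Scale by (rule cong_Scale)
lift_definition U3_der :: "'k::field_char_0 U3 \<Rightarrow> 'k U3" is Der by (rule cong_Der)
lift_definition U3_nprod :: "nat \<Rightarrow> 'k::field_char_0 U3 \<Rightarrow> 'k U3 \<Rightarrow> 'k U3" is NProd
  by (rule cong_NProd)

definition U3_lprod :: "'k::field_char_0 U3 \<Rightarrow> 'k U3 \<Rightarrow> 'k U3 poly" where
  "U3_lprod a b = Abs_poly (\<lambda>n. U3_scale (inverse (fact n)) (U3_nprod n a b))"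

interpretation U3: vector_space "U3_scale :: 'k::field_char_0 \<Rightarrow> _"
proof
  fix r q :: 'k and a b :: "'k U3"
  show "U3_scale r (a + b) = U3_scale r a + U3_scale r b" by transfer (rule Scale_Add)
  show "U3_scale (r + q) a = U3_scale r a + U3_scale q a" by transfer (rule Scale_plus)
  show "U3_scale r (U3_scale q a) = U3_scale (r * q) a" by transfer (rule Scale_Scale)
  show "U3_scale 1 a = a" by transfer (rule Scale_one)
qed

lemma U3_der_add: "U3_der (a + b) = U3_der a + U3_der b"
  by transfer (rule Der_Add)

lemma U3_der_scale: "U3_der (U3_scale r a) = U3_scale r (U3_der a)"
  by transfer (rule Der_Scale)

lemma U3_der_0 [simp]: "U3_der 0 = 0"
  using U3_der_add[of 0 0] by simp

lemma U3_nprod_add_left: "U3_nprod n (a + b) c = U3_nprod n a c + U3_nprod n b c"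
  by transfer (rule NProd_Add_left)

lemma U3_nprod_add_right: "U3_nprod n a (b + c) = U3_nprod n a b + U3_nprod n a c"
  by transfer (rule NProd_Add_right)

lemma U3_nprod_scale_left: "U3_nprod n (U3_scale r a) b = U3_scale r (U3_nprod n a b)"
  by transfer (rule NProd_Scale_left)

lemma U3_nprod_scale_right: "U3_nprod n a (U3_scale r b) = U3_scale r (U3_nprod n a b)"
  by transfer (rule NProd_Scale_right)

lemma U3_nprod_der_left: "U3_nprod n (U3_der a) b = U3_scale (- of_nat n) (U3_nprod (n - 1) a b)"
  by transfer (rule NProd_Der_left)

lemma U3_nprod_der_right:
  "U3_nprod n a (U3_der b) = U3_der (U3_nprod n a b) + U3_scale (of_nat n) (U3_nprod (n - 1) a b)"
  by transfer (rule NProd_Der_right)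

lemma abs_U3_surj: obtains t where "a = abs_U3 t"
  by (induct a rule: U3.abs_induct) blast

lemma abs_U3_foldr_Add: "abs_U3 (foldr Add ts Zero) = sum_list (map abs_U3 ts)"
proof (induction ts)
  case Nil
  show ?case by (simp add: zero_U3_def)
next
  case (Cons t ts)
  then show ?case by (simp add: plus_U3.abs_eq[symmetric])
qed

lemma U3_nprod_nprod:
  "U3_nprod m a (U3_nprod n b c) =
    (\<Sum>j\<le>m. U3_scale (of_nat (m choose j)) (U3_nprod (n + j) (U3_nprod (m - j) a b) c))"
proof -
  obtain s where s: "a = abs_U3 s" by (rule abs_U3_surj)
  obtain t where t: "b = abs_U3 t" by (rule abs_U3_surj)
  obtain u where u: "c = abs_U3 u" by (rule abs_U3_surj)
  let ?T = "\<lambda>j. Scale (of_nat (m choose j)) (NProd (n + j) (NProd (m - j) s t) u)"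
  let ?V = "\<lambda>j. U3_scale (of_nat (m choose j)) (U3_nprod (n + j) (U3_nprod (m - j) a b) c)"
  have T: "abs_U3 (?T j) = ?V j" for j
    unfolding s t u U3_nprod.abs_eq U3_scale.abs_eq ..
  have "U3_nprod m a (U3_nprod n b c) = abs_U3 (NProd m s (NProd n t u))"
    unfolding s t u U3_nprod.abs_eq ..
  also have "\<dots> = abs_U3 (foldr Add (map ?T [0..<Suc m]) Zero)"
    unfolding U3.abs_eq_iff by (rule NProd_NProd)
  also have "\<dots> = sum_list (map ?V [0..<Suc m])"
    unfolding abs_U3_foldr_Add map_map o_def T ..
  also have "\<dots> = sum ?V (set [0..<Suc m])"
    by (rule interv_sum_list_conv_sum_set_nat)
  also have "set [0..<Suc m] = {..m}"
    by auto
  finally show ?thesis .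
qed

lemma U3_gen_locality: "3 \<le> n \<Longrightarrow> U3_nprod n U3_gen U3_gen = 0"
  by transfer (rule Gen_locality)

lemma U3_gen_Virasoro:
  "U3_scale 2 (U3_nprod 1 U3_gen U3_gen) - U3_der (U3_nprod 2 U3_gen U3_gen) = U3_scale 2 U3_gen"
  unfolding minus_U3_def by transfer (rule Gen_Virasoro)

lemma U3_induct [case_names gen zero add scale der nprod]:
  assumes "P U3_gen" "P 0" "\<And>a b. P a \<Longrightarrow> P b \<Longrightarrow> P (a + b)" "\<And>r a. P a \<Longrightarrow> P (U3_scale r a)"
    "\<And>a. P a \<Longrightarrow> P (U3_der a)" "\<And>n a b. P a \<Longrightarrow> P b \<Longrightarrow> P (U3_nprod n a b)"
  shows "P a"
proof -
  have "P (abs_U3 t)" for t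
  proof (induction t)
    case Gen
    show ?case using assms(1) by (simp only: U3_gen_def)
  next
    case Zero
    show ?case using assms(2) by (simp only: zero_U3_def)
  next
    case (Add s t)
    from assms(3)[OF this] show ?case by (simp only: plus_U3.abs_eq)
  next
    case (Scale r t)
    from assms(4)[OF this] show ?case by (simp only: U3_scale.abs_eq)
  next
    case (Der t)
    from assms(5)[OF this] show ?case by (simp only: U3_der.abs_eq)
  next
    case (NProd n s t)
    from assms(6)[OF this] show ?case by (simp only: U3_nprod.abs_eq)
  qed
  moreover obtain t where "a = abs_U3 t" by (rule abs_U3_surj)
  ultimately show ?thesis by simp
qed

lemma U3_nprod_0_left [simp]: "U3_nprod n 0 b = 0"
  using U3_nprod_add_left[of n 0 0 b] by simp

lemma U3_nprod_0_right [simp]: "U3_nprod n a 0 = 0"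
  using U3_nprod_add_right[of n a 0 0] by simp

lemma U3_nprod_vanish_left:
  assumes "\<And>n. N \<le> n \<Longrightarrow> U3_nprod n b c = 0" and "N \<le> n"
  shows "U3_nprod n (U3_nprod k a b) c = 0"
  using assms(2)
proof (induction k arbitrary: n rule: less_induct)
  case (less k)
  let ?V = "\<lambda>j. U3_scale (of_nat (k choose j)) (U3_nprod (n + j) (U3_nprod (k - j) a b) c)"
  have "0 = sum ?V {..k}"
    using U3_nprod_nprod[of k a n b c] assms(1)[OF less.prems] by simp
  also have "\<dots> = sum ?V {0}"
    using less by (intro sum.mono_neutral_right) auto
  finally show ?case by simp
qed

lemma U3_nprod_vanish_right:
  assumes "\<And>n. N \<le> n \<Longrightarrow> U3_nprod n a b = 0" and "\<And>n. M \<le> n \<Longrightarrow> U3_nprod n b c = 0"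
    and "N + M \<le> m"
  shows "U3_nprod m a (U3_nprod n b c) = 0"
proof -
  have "U3_nprod (n + j) (U3_nprod (m - j) a b) c = 0" for j
  proof (cases "M \<le> j")
    case True
    then show ?thesis using U3_nprod_vanish_left[of M b c "n + j" "m - j" a] assms(2) by simp
  next
    case False
    then have "N \<le> m - j" using assms(3) by simp
    then show ?thesis using assms(1) by simp
  qed
  then show ?thesis by (simp add: U3_nprod_nprod)
qed

lemma U3_locality: "\<exists>N. \<forall>n\<ge>N. U3_nprod n a b = 0"
proof -
  have sum: "\<exists>N. \<forall>n\<ge>N. P n \<and> Q n" if "\<exists>N. \<forall>n\<ge>N. P n" "\<exists>N. \<forall>n\<ge>N. Q n" for P Q :: "nat \<Rightarrow> bool"
    using that by (meson max.bounded_iff)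
  have shift: "\<exists>N. \<forall>n\<ge>N. P n \<and> P (n - 1)" if "\<exists>N. \<forall>n\<ge>N. P n" for P :: "nat \<Rightarrow> bool"
  proof -
    from that obtain N where "\<forall>n\<ge>N. P n" by blast
    then have "\<forall>n\<ge>Suc N. P n \<and> P (n - 1)" by auto
    then show ?thesis by blast
  qed
  show ?thesis
  proof (induction b arbitrary: a rule: U3_induct)
    case gen
    show ?case
    proof (induction a rule: U3_induct)
      case gen
      show ?case using U3_gen_locality by blast
    next
      case zero
      show ?case by simp
    next
      case (add a b)
      from sum[OF this] obtain N
        where "\<forall>n\<ge>N. U3_nprod n a U3_gen = 0 \<and> U3_nprod n b U3_gen = 0" by blast
      then show ?case by (intro exI[of _ N]) (simp add: U3_nprod_add_left)
    next
      case (scale r a)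
      then show ?case by (auto simp: U3_nprod_scale_left)
    next
      case (der a)
      from shift[OF this] show ?case by (auto simp: U3_nprod_der_left)
    next
      case (nprod k a b)
      then show ?case using U3_nprod_vanish_left[of _ b U3_gen _ k a] by meson
    qed
  next
    case zero
    show ?case by simp
  next
    case (add b c)
    from sum[OF add(1)[of a] add(2)[of a]] obtain N
      where "\<forall>n\<ge>N. U3_nprod n a b = 0 \<and> U3_nprod n a c = 0" by blast
    then show ?case by (intro exI[of _ N]) (simp add: U3_nprod_add_right)
  next
    case (scale r b)
    from scale[of a] show ?case by (auto simp: U3_nprod_scale_right)
  next
    case (der b)
    from shift[OF der[of a]] obtain N
      where "\<forall>n\<ge>N. U3_nprod n a b = 0 \<and> U3_nprod (n - 1) a b = 0" by blast
    then show ?case by (intro exI[of _ N]) (simp add: U3_nprod_der_right)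
  next
    case (nprod k b c)
    from nprod(1)[of a] nprod(2)[of b] show ?case
      using U3_nprod_vanish_right[of _ a b _ c _ k] by meson
  qed
qed

lemma coeff_U3_lprod:
  "coeff (U3_lprod a b) n = U3_scale (inverse (fact n)) (U3_nprod n a b)"
proof -
  obtain N where "\<forall>n\<ge>N. U3_nprod n a b = 0" using U3_locality by blast
  then have "\<forall>n>N. U3_scale (inverse (fact n)) (U3_nprod n a b) = 0" by simp
  then have "\<forall>\<^sub>\<infinity>n. U3_scale (inverse (fact n)) (U3_nprod n a b) = 0"
    unfolding MOST_nat by blast
  then show ?thesis
    unfolding U3_lprod_def by (simp add: Abs_poly_inverse)
qed

interpretation U3: assoc_conformal_algebra
  "U3_scale :: 'k::field_char_0 \<Rightarrow> 'k U3 \<Rightarrow> 'k U3" U3_der U3_lprod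
proof
  fix a b c :: "'k U3" and r :: 'k and m n :: nat
  show "U3_der (a + b) = U3_der a + U3_der b" by (rule U3_der_add)
  show "U3_der (U3_scale r a) = U3_scale r (U3_der a)" by (rule U3_der_scale)
  show "U3_lprod (a + b) c = U3_lprod a c + U3_lprod b c"
    by (rule poly_eqI) (simp add: coeff_U3_lprod U3_nprod_add_left U3.scale_right_distrib)
  show "U3_lprod a (b + c) = U3_lprod a b + U3_lprod a c"
    by (rule poly_eqI) (simp add: coeff_U3_lprod U3_nprod_add_right U3.scale_right_distrib)
  show "U3_lprod (U3_scale r a) b = map_poly (U3_scale r) (U3_lprod a b)"
    by (rule poly_eqI)
      (simp add: coeff_U3_lprod coeff_map_poly U3_nprod_scale_left mult.commute)
  show "U3_lprod a (U3_scale r b) = map_poly (U3_scale r) (U3_lprod a b)"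
    by (rule poly_eqI)
      (simp add: coeff_U3_lprod coeff_map_poly U3_nprod_scale_right mult.commute)
  have fact_Suc: "inverse (fact (Suc n)) * of_nat (Suc n) = (inverse (fact n) :: 'k)" for n
    by (simp add: field_simps del: of_nat_Suc)
  have coeff_pCons_0: "coeff (pCons 0 (U3_lprod a b)) n =
      U3_scale (inverse (fact n) * of_nat n) (U3_nprod (n - 1) a b)" for n
    using fact_Suc by (cases n) (simp_all add: coeff_U3_lprod del: of_nat_Suc fact_Suc)
  show "U3_lprod (U3_der a) b = - pCons 0 (U3_lprod a b)"
    by (rule poly_eqI)
      (simp add: coeff_pCons_0 coeff_U3_lprod U3_nprod_der_left del: minus_pCons)
  show "U3_lprod a (U3_der b) = map_poly U3_der (U3_lprod a b) + pCons 0 (U3_lprod a b)"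
    by (rule poly_eqI) (simp add: coeff_pCons_0 coeff_U3_lprod coeff_map_poly U3_nprod_der_right
        U3.scale_right_distrib U3_der_scale)
  let ?V = "\<lambda>j. U3_scale (inverse (fact m) * inverse (fact n) * of_nat (m choose j))
         (U3_nprod (n + j) (U3_nprod (m - j) a b) c)"
  have "coeff (U3_lprod a (coeff (U3_lprod b c) n)) m =
      U3_scale (inverse (fact m) * inverse (fact n)) (U3_nprod m a (U3_nprod n b c))"
    by (simp add: coeff_U3_lprod U3_nprod_scale_right)
  also have "\<dots> = sum ?V {..m}"
    unfolding U3_nprod_nprod U3.scale_sum_right U3.scale_scale ..
  also have "\<dots> = (\<Sum>j\<le>m. ?V (m - j))"
    by (rule sum.reindex_bij_witness[of _ "\<lambda>j. m - j" "\<lambda>j. m - j"]) auto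
  also have "\<dots> = (\<Sum>j\<le>m. U3_scale (of_nat ((m - j + n) choose n))
         (coeff (U3_lprod (coeff (U3_lprod a b) j) c) (m - j + n)))"
  proof (rule sum.cong[OF refl])
    fix j assume "j \<in> {..m}"
    then have j: "j \<le> m" by simp
    have "inverse (fact m) * inverse (fact n) * of_nat (m choose (m - j)) =
        (of_nat ((m - j + n) choose n) * (inverse (fact (m - j + n)) * inverse (fact j)) :: 'k)"
      using j by (simp add: binomial_fact field_simps)
    then show "?V (m - j) = U3_scale (of_nat ((m - j + n) choose n))
         (coeff (U3_lprod (coeff (U3_lprod a b) j) c) (m - j + n))"
      using j by (simp add: coeff_U3_lprod U3_nprod_scale_left add.commute)
  qed
  finally show "coeff (U3_lprod a (coeff (U3_lprod b c) n)) m =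
      (\<Sum>j\<le>m. U3_scale (of_nat ((m - j + n) choose n))
                (coeff (U3_lprod (coeff (U3_lprod a b) j) c) (m - j + n)))" .
qed

lemma U3_nprod_eq: "U3.nprod n a b = U3_nprod n a b"
  by (simp add: U3.nprod_def coeff_U3_lprod)


context conformal_algebra
begin

lemma nprod_add_left: "nprod n (a + b) c = nprod n a c + nprod n b c"
  by (simp add: nprod_def lprod_add_left scale_right_distrib)

lemma nprod_add_right: "nprod n a (b + c) = nprod n a b + nprod n a c"
  by (simp add: nprod_def lprod_add_right scale_right_distrib)

lemma nprod_scale_left: "nprod n (scale r a) b = scale r (nprod n a b)"
  by (simp add: nprod_def lprod_scale_left coeff_map_poly mult.commute)

lemma nprod_scale_right: "nprod n a (scale r b) = scale r (nprod n a b)"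
  by (simp add: nprod_def lprod_scale_right coeff_map_poly mult.commute)

lemma nprod_0_left [simp]: "nprod n 0 a = 0"
  using nprod_add_left[of n 0 0 a] by simp

lemma coeff_lprod: "coeff (lprod a b) n = scale (inverse (fact n)) (nprod n a b)"
  by (simp add: nprod_def)

lemma der_0: "der 0 = 0"
  using der_add[of 0 0] by simp

lemma scale_fact_coeff_pCons:
  "scale (fact n) (coeff (pCons 0 (lprod a b)) n) = scale (of_nat n) (nprod (n - 1) a b)"
  by (cases n) (simp_all add: nprod_def)

lemma nprod_der_left: "nprod n (der a) b = scale (- of_nat n) (nprod (n - 1) a b)"
  unfolding nprod_def[of n] lprod_der_left coeff_minus scale_minus_right
    scale_fact_coeff_pCons scale_minus_left ..

lemma nprod_der_right:
  "nprod n a (der b) = der (nprod n a b) + scale (of_nat n) (nprod (n - 1) a b)"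
  unfolding nprod_def[of n] lprod_der_right coeff_add scale_right_distrib
    scale_fact_coeff_pCons coeff_map_poly[of der, OF der_0] der_scale ..

primrec U3_eval :: "'a \<Rightarrow> 'k U3_term \<Rightarrow> 'a" where
  "U3_eval c Gen = c"
| "U3_eval c Zero = 0"
| "U3_eval c (Add s t) = U3_eval c s + U3_eval c t"
| "U3_eval c (Scale r s) = scale r (U3_eval c s)"
| "U3_eval c (Der s) = der (U3_eval c s)"
| "U3_eval c (NProd n s t) = nprod n (U3_eval c s) (U3_eval c t)"

lemma U3_eval_foldr_Add:
  "U3_eval c (foldr Add ts Zero) = sum_list (map (U3_eval c) ts)"
  by (induction ts) simp_all

end

context assoc_conformal_algebra
begin

lemma nprod_nprod:
  "nprod m a (nprod n b c) =
    (\<Sum>j\<le>m. scale (of_nat (m choose j)) (nprod (n + j) (nprod (m - j) a b) c))"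
proof -
  have fact_cancel: "fact m * fact n * (inverse (fact m) * inverse (fact n)) = (1 :: 'k)"
    by (simp add: field_simps)
  have "nprod m a (nprod n b c) =
      scale (fact m * fact n) (coeff (lprod a (coeff (lprod b c) n)) m)"
    using fact_cancel by (simp add: coeff_lprod nprod_scale_right)
  also have "\<dots> = (\<Sum>j\<le>m. scale (fact m * fact n * of_nat ((m - j + n) choose n))
                (coeff (lprod (coeff (lprod a b) j) c) (m - j + n)))"
    by (simp add: lprod_assoc scale_sum_right mult.assoc)
  also have "\<dots> = (\<Sum>j\<le>m. scale (of_nat (m choose (m - j)))
      (nprod (n + (m - j)) (nprod (m - (m - j)) a b) c))"
  proof (rule sum.cong[OF refl])
    fix j assume "j \<in> {..m}"
    then have j: "j \<le> m" by simp
    have "fact m * fact n * of_nat ((m - j + n) choose n) *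
        (inverse (fact (m - j + n)) * inverse (fact j)) = (of_nat (m choose (m - j)) :: 'k)"
      using j by (simp add: binomial_fact field_simps)
    then show "scale (fact m * fact n * of_nat ((m - j + n) choose n))
         (coeff (lprod (coeff (lprod a b) j) c) (m - j + n)) =
       scale (of_nat (m choose (m - j))) (nprod (n + (m - j)) (nprod (m - (m - j)) a b) c)"
      using j by (simp add: coeff_lprod nprod_scale_left add.commute)
  qed
  also have "\<dots> = (\<Sum>j\<le>m. scale (of_nat (m choose j)) (nprod (n + j) (nprod (m - j) a b) c))"
    by (rule sum.reindex_bij_witness[of _ "\<lambda>j. m - j" "\<lambda>j. m - j"]) auto
  finally show ?thesis .
qed

lemma U3_eval_cong:
  assumes "s \<approx> t"
    and "\<And>n. 3 \<le> n \<Longrightarrow> nprod n c c = 0"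
    and "scale 2 (nprod 1 c c) - der (nprod 2 c c) = scale 2 c"
  shows "U3_eval c s = U3_eval c t"
  using assms(1)
proof induction
  case (NProd_NProd m s n t u)
  let ?T = "\<lambda>j. Scale (of_nat (m choose j)) (NProd (n + j) (NProd (m - j) s t) u)"
  have "U3_eval c (foldr Add (map ?T [0..<Suc m]) Zero) = (\<Sum>j\<leftarrow>[0..<Suc m]. U3_eval c (?T j))"
    unfolding U3_eval_foldr_Add map_map o_def ..
  also have "\<dots> = (\<Sum>j\<in>set [0..<Suc m]. U3_eval c (?T j))"
    by (rule interv_sum_list_conv_sum_set_nat)
  also have "set [0..<Suc m] = {..m}"
    by auto
  finally show ?case by (simp add: nprod_nprod)
next
  case Gen_Virasoro
  show ?case using assms(3) by simp
qed (simp_all add: assms(2) algebra_simps scale_right_distrib scale_left_distrib der_add der_scale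
      nprod_add_left nprod_add_right nprod_scale_left nprod_scale_right nprod_der_left
      nprod_der_right)

theorem U3_universal:
  assumes "\<And>n. 3 \<le> n \<Longrightarrow> nprod n c c = 0"
    and "scale 2 (nprod 1 c c) - der (nprod 2 c c) = scale 2 c"
  shows "\<exists>!f. conformal_hom U3_scale U3_der U3_lprod scale der lprod f \<and> f U3_gen = c"
proof (rule ex1I, intro conjI)
  define f where "f a = U3_eval c (rep_U3 a)" for a
  have f: "f (abs_U3 t) = U3_eval c t" for t
    unfolding f_def
    by (rule U3_eval_cong[OF _ assms]) (simp_all add: U3.abs_eq_iff[symmetric] Quotient3_abs_rep[OF Quotient3_U3])
  have 0: "f 0 = 0"
    by (simp add: zero_U3_def f)
  have gen: "f U3_gen = c"
    by (simp add: U3_gen_def f)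
  have add: "f (a + b) = f a + f b" for a b
    by (rule abs_U3_surj[of a], rule abs_U3_surj[of b]) (simp add: plus_U3.abs_eq f)
  have scale: "f (U3_scale r a) = scale r (f a)" for r a
    by (rule abs_U3_surj[of a]) (simp add: U3_scale.abs_eq f)
  have der: "f (U3_der a) = der (f a)" for a
    by (rule abs_U3_surj[of a]) (simp add: U3_der.abs_eq f)
  have nprod: "f (U3_nprod n a b) = nprod n (f a) (f b)" for n a b
    by (rule abs_U3_surj[of a], rule abs_U3_surj[of b]) (simp add: U3_nprod.abs_eq f)
  have "lprod (f a) (f b) = map_poly f (U3_lprod a b)" for a b
    by (rule poly_eqI) (simp add: coeff_map_poly 0 coeff_U3_lprod coeff_lprod scale nprod)
  with add scale der show "conformal_hom U3_scale U3_der U3_lprod scale der lprod f"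
    by (simp add: conformal_hom_def)
  show "f U3_gen = c" by (rule gen)
  fix g assume "conformal_hom U3_scale U3_der U3_lprod scale der lprod g \<and> g U3_gen = c"
  then have g: "g (a + b) = g a + g b" "g (U3_scale r a) = scale r (g a)"
    "g (U3_der a) = der (g a)" "lprod (g a) (g b) = map_poly g (U3_lprod a b)" "g U3_gen = c"
    for a b r by (simp_all add: conformal_hom_def)
  have g0: "g 0 = 0" using g(1)[of 0 0] by simp
  have gn: "g (U3_nprod n a b) = nprod n (g a) (g b)" for n a b
    by (simp add: nprod_def g(4) coeff_map_poly g0 coeff_U3_lprod flip: g(2))
  show "g = f"
  proof
    fix a show "g a = f a"
      by (induction a rule: U3_induct)
        (simp_all add: g(1-3,5) g0 gn 0 gen add scale der nprod)
  qed
qed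

end

end

theory Submission
  imports Defs
begin

text \<open>Write \<open>v\<close> for the generator, \<open>L = v\<^sub>(\<^sub>0\<^sub>)\<close>, \<open>e = v\<^sub>(\<^sub>2\<^sub>)v / 2\<close>, and \<open>a\<^sub>xb\<close> for the value of the
  \<open>\<lambda>\<close>-product at a scalar \<open>\<lambda> = x\<close>.  The defining relations say that
  \<open>v\<^sub>yv = Lv + y v + y(\<partial> + y)e\<close>.  With associativity they imply that, for the elements
  \<open>e\<^sub>0 = e\<close> and \<open>e\<^sub>j\<^sub>+\<^sub>1 = v\<^sub>(\<^sub>1\<^sub>)e\<^sub>j\<close>, the products \<open>v\<^sub>xe\<^sub>j\<close> and \<open>(e\<^sub>j)\<^sub>xv\<close> are affine in
  \<open>x\<close> (\<open>lprod_at_gen_quad\<close>, \<open>lprod_at_quad_gen\<close>), and that \<open>U(3)\<close> is spanned over \<open>k[\<partial>]\<close> by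
  \<open>L\<^sup>kv\<close> and \<open>L\<^sup>ke\<^sub>j\<close> (\<open>U3_basis_induct\<close>).  These elements are a basis (\<open>U3_free\<close>):
  \<open>U(3)\<close> acts on \<open>k[t][x]\<close>, \<open>v\<close> acting as the Virasoro algebra does on densities of indeterminate
  weight \<open>t\<close>, and the operator of \<open>a\<close> is determined by its symbol, a polynomial in \<open>x\<close> and \<open>t\<close>;
  the symbols of \<open>v\<close> and \<open>e\<^sub>j\<close> are \<open>x + \<lambda>t\<close> and \<open>t(1 - t)t\<^sup>j\<close>, and \<open>L\<close> multiplies by \<open>x\<close>.

  The field is infinite, so a cochain may be treated as a function of scalars \<open>x, y, \<dots>\<close> that is
  polynomial in them.  For a 3-cocycle \<open>\<phi>\<close> let the obstruction be the coefficient of \<open>x\<^sup>2y\<close> minus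
  that of \<open>xy\<^sup>2\<close> in \<open>\<phi>\<^sub>x\<^sub>,\<^sub>y(v, v, v)\<close>.  The theorem says that the obstruction induces an
  isomorphism of the third cohomology with \<open>k\<close>.

  The obstruction of a coboundary is zero by inspection (\<open>obstruction_diff2\<close>).  Conversely let
  \<open>\<phi>\<close> be a cocycle without obstruction, normalised so that \<open>\<phi>(La, b, c) = 0\<close>
  (\<open>left_normalize\<close>).  If \<open>\<phi> = d\<psi>\<close> and \<open>\<alpha>\<^sub>x(a) = \<psi>\<^sub>x(a, v)\<close>, then
  \<open>\<phi>\<^sub>x\<^sub>,\<^sub>y(a, v, v) + \<alpha>\<^sub>x\<^sub>+\<^sub>y(a\<^sub>xv) = \<psi>\<^sub>x(a, v\<^sub>yv)\<close>, which by the formula for \<open>v\<^sub>yv\<close> has the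
  form \<open>t + y \<alpha>\<^sub>x(a) + y(x + y)q\<close> with \<open>t\<close> and \<open>q\<close> independent of \<open>y\<close>.  These conditions on
  \<open>\<alpha>\<close> can be tested on the basis.  The cocycle identity at \<open>(e\<^sub>j, v, v, v)\<close> and at \<open>(v, v, v, v)\<close>
  shows that they have a solution, except for one scalar equation, the vanishing of the obstruction
  (\<open>square_form_quad_Suc\<close>, \<open>square_form_gen\<close>, \<open>left_normal_potential\<close>).  Any solution \<open>\<alpha>\<close>
  extends to a 2-cochain \<open>\<psi>\<close>: the products \<open>v\<^sub>yc\<close> prescribe the values of \<open>\<psi>(a, \<cdot>)\<close> on the basis
  (\<open>potential_extends\<close>).  The difference \<open>\<phi> - d\<psi>\<close> is then a cocycle which vanishes on enough
  arguments to be zero (\<open>cocycle3_vanishes\<close>).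

  A cocycle with obstruction 1 is built from symbols.  Restricting densities to the weights 0 and 1
  gives two modules, and near these weights the derivative with respect to \<open>t\<close> of the symbol is a
  derivation along the symbols at \<open>t = 0\<close> and \<open>t = 1\<close>.  Multiplication by \<open>x\<close>, the dual of
  the exterior derivative of functions, intertwines the two weights (\<open>kernel_ends\<close>).  It glues the
  derivatives at \<open>t = 0\<close> and \<open>t = 1\<close> together with a linear form on symbols to the cocycle
  \<open>slope_cocycle\<close>.\<close>

section \<open>Products evaluated at a scalar\<close>

text \<open>Locality makes the sequence of \<open>n\<close>-products of two elements end in zeros.  The sum below is the
  value at \<open>\<lambda> = x\<close> of the generating polynomial \<open>\<Sum>\<^sub>n \<lambda>\<^sup>n/n! f n\<close> of such a sequence.  It is
  formed for an arbitrary vector space because it serves for the algebra and for its module.\<close>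

definition eventually_zero :: "(nat \<Rightarrow> 'm::zero) \<Rightarrow> bool" where
  "eventually_zero f \<longleftrightarrow> (\<exists>N. \<forall>n\<ge>N. f n = 0)"

definition exp_sum :: "('k::field_char_0 \<Rightarrow> 'm::ab_group_add \<Rightarrow> 'm) \<Rightarrow> 'k \<Rightarrow> (nat \<Rightarrow> 'm) \<Rightarrow> 'm" where
  "exp_sum s x f = (\<Sum>n | f n \<noteq> 0. s (x ^ n / fact n) (f n))"

lemma eventually_zero_add:
  fixes f g :: "nat \<Rightarrow> 'm::comm_monoid_add"
  assumes "eventually_zero f" "eventually_zero g"
  obtains N where "\<forall>n\<ge>N. f n = 0" "\<forall>n\<ge>N. g n = 0"
proof -
  from assms obtain N1 N2 where "\<forall>n\<ge>N1. f n = 0" "\<forall>n\<ge>N2. g n = 0"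
    unfolding eventually_zero_def by blast
  then show ?thesis by (intro that[of "max N1 N2"]) auto
qed

context
  fixes s :: "'k::field_char_0 \<Rightarrow> 'm::ab_group_add \<Rightarrow> 'm"
  assumes s: "vector_space s"
begin

interpretation vector_space s by (rule s)

lemma exp_sum_eq:
  assumes "\<forall>n\<ge>N. f n = 0"
  shows "exp_sum s x f = (\<Sum>n<N. s (x ^ n / fact n) (f n))"
  unfolding exp_sum_def
proof (rule sum.mono_neutral_left)
  show "{n. f n \<noteq> 0} \<subseteq> {..<N}" using assms by (auto simp: not_le[symmetric])
qed auto

lemma exp_sum_add:
  assumes "eventually_zero f" "eventually_zero g"
  shows "exp_sum s x (\<lambda>n. f n + g n) = exp_sum s x f + exp_sum s x g"
proof -
  obtain N where N: "\<forall>n\<ge>N. f n = 0" "\<forall>n\<ge>N. g n = 0" using eventually_zero_add[OF assms] .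
  then show ?thesis
    by (simp add: exp_sum_eq[of N] sum.distrib[symmetric] scale_right_distrib)
qed

lemma exp_sum_linear:
  assumes "eventually_zero f" "\<And>a b. h (a + b) = h a + h b" "\<And>r a. h (s r a) = s' r (h a)"
    and s': "vector_space s'"
  shows "h (exp_sum s x f) = exp_sum s' x (\<lambda>n. h (f n))"
proof -
  obtain N where N: "\<forall>n\<ge>N. f n = 0" using assms(1) unfolding eventually_zero_def by blast
  interpret s': vector_space s' by (rule s')
  have h0: "h 0 = 0" using assms(2)[of 0 0] by simp
  have "exp_sum s' x (\<lambda>n. h (f n)) = (\<Sum>n<N. s' (x ^ n / fact n) (h (f n)))"
    unfolding exp_sum_def
    by (rule sum.mono_neutral_left) (use N h0 in \<open>auto simp: not_le[symmetric]\<close>)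
  also have "\<dots> = h (\<Sum>n<N. s (x ^ n / fact n) (f n))"
    by (induction N) (simp_all add: h0 assms(2,3))
  finally show ?thesis by (simp add: exp_sum_eq[OF N])
qed

lemma exp_sum_scale:
  assumes "eventually_zero f"
  shows "exp_sum s x (\<lambda>n. s r (f n)) = s r (exp_sum s x f)"
  using exp_sum_linear[of f "s r" s, OF assms _ _ s] by (simp add: scale_right_distrib mult.commute)

text \<open>The factor \<open>n\<close> turns \<open>x\<^sup>n/n!\<close> into \<open>x \<cdot> x\<^sup>n\<^sup>-\<^sup>1/(n - 1)!\<close>; this is how \<open>\<partial>\<close> becomes multiplication by
  \<open>\<lambda>\<close>.\<close>

lemma exp_sum_shift:
  assumes "eventually_zero f"
  shows "exp_sum s x (\<lambda>n. s (of_nat n) (f (n - 1))) = s x (exp_sum s x f)"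
proof -
  obtain N where N: "\<forall>n\<ge>N. f n = 0" using assms unfolding eventually_zero_def by blast
  then have "\<forall>n\<ge>Suc N. s (of_nat n) (f (n - 1)) = 0" by auto
  then have "exp_sum s x (\<lambda>n. s (of_nat n) (f (n - 1))) =
      (\<Sum>n<Suc N. s (x ^ n / fact n) (s (of_nat n) (f (n - 1))))" by (rule exp_sum_eq)
  also have "\<dots> = (\<Sum>n<N. s (x ^ Suc n / fact n) (f n))"
  proof -
    have "x ^ Suc n / fact (Suc n) * of_nat (Suc n) = x ^ Suc n / fact n" for n
      by (simp add: field_simps del: of_nat_Suc)
    then show ?thesis unfolding sum.lessThan_Suc_shift by (simp del: of_nat_Suc)
  qed
  also have "\<dots> = s x (exp_sum s x f)"
    by (simp add: exp_sum_eq[OF N] scale_sum_right)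
  finally show ?thesis .
qed

lemma exp_sum_0:
  assumes "eventually_zero f"
  shows "exp_sum s 0 f = f 0"
proof -
  obtain N where N: "\<forall>n\<ge>N. f n = 0" using assms unfolding eventually_zero_def by blast
  then have "exp_sum s 0 f = (\<Sum>n<Suc N. s (0 ^ n / fact n) (f n))" by (intro exp_sum_eq) auto
  also have "\<dots> = f 0" unfolding sum.lessThan_Suc_shift by simp
  finally show ?thesis .
qed

text \<open>The identity \<open>a\<^sub>x(b\<^sub>yc) = (a\<^sub>xb)\<^sub>x\<^sub>+\<^sub>yc\<close> in terms of coefficients is the binomial relation between
  \<open>f\<close> and \<open>h\<close>; it is shared by associativity and by module actions.\<close>

lemma exp_sum_binomial:
  assumes f: "\<And>m n. f m n = (\<Sum>j\<le>m. s (of_nat (m choose j)) (h (m - j) (n + j)))"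
    and h: "\<And>i k. M \<le> i \<or> M \<le> k \<Longrightarrow> h i k = 0"
  shows "exp_sum s x (\<lambda>m. exp_sum s y (f m)) = exp_sum s (x + y) (\<lambda>k. exp_sum s x (\<lambda>i. h i k))"
proof -
  have f0: "f m n = 0" if "2 * M \<le> m + n" for m n
    unfolding f
  proof (rule sum.neutral, rule ballI)
    fix j assume "j \<in> {..m}"
    then have "M \<le> m - j \<or> M \<le> n + j" using that by auto
    then show "s (of_nat (m choose j)) (h (m - j) (n + j)) = 0" using h by simp
  qed
  let ?t = "\<lambda>i j n. s (x ^ i / fact i * (x ^ j / fact j) * (y ^ n / fact n)) (h i (j + n))"
  let ?L = "2 * M"
  have "exp_sum s x (\<lambda>m. exp_sum s y (f m)) = (\<Sum>m<?L. s (x ^ m / fact m) (\<Sum>n<?L. s (y ^ n / fact n) (f m n)))"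
  proof -
    have e: "exp_sum s y (f m) = (\<Sum>n<?L. s (y ^ n / fact n) (f m n))" for m
      using f0 by (intro exp_sum_eq) auto
    have "\<forall>m\<ge>?L. exp_sum s y (f m) = 0" using f0 by (simp add: e)
    then show ?thesis using exp_sum_eq[of ?L "\<lambda>m. exp_sum s y (f m)" x] e by simp
  qed
  also have "\<dots> = (\<Sum>m<?L. \<Sum>n<?L. \<Sum>j\<le>m. ?t (m - j) j n)"
  proof (intro sum.cong refl)
    fix m
    have c: "x ^ m / fact m * (y ^ n / fact n * of_nat (m choose j)) =
        x ^ (m - j) / fact (m - j) * (x ^ j / fact j) * (y ^ n / fact n)" if "j \<le> m" for j n
    proof -
      have "x ^ m = x ^ (m - j) * x ^ j" using that by (simp flip: power_add)
      then show ?thesis using that by (simp add: binomial_fact field_simps)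
    qed
    show "s (x ^ m / fact m) (\<Sum>n<?L. s (y ^ n / fact n) (f m n)) = (\<Sum>n<?L. \<Sum>j\<le>m. ?t (m - j) j n)"
      unfolding f scale_sum_right scale_scale
    proof (intro sum.cong refl)
      fix n j assume "j \<in> {..m}"
      then show "s (x ^ m / fact m * (y ^ n / fact n * of_nat (m choose j))) (h (m - j) (n + j)) = ?t (m - j) j n"
        using c[of j n] by (simp only: add.commute[of n] atMost_iff)
    qed
  qed
  also have "\<dots> = (\<Sum>m<?L. \<Sum>(n, j)\<in>{..<?L} \<times> {..m}. ?t (m - j) j n)"
    by (simp add: sum.cartesian_product)
  also have "\<dots> = (\<Sum>(m, n, j)\<in>(SIGMA m:{..<?L}. {..<?L} \<times> {..m}). ?t (m - j) j n)"
    by (simp add: sum.Sigma split_def)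
  \<comment> \<open>Substitute i = m - j and k = n + j; terms with i or k at least M vanish.\<close>
  also have "\<dots> = (\<Sum>(i, k, j)\<in>(SIGMA i:{..<M}. SIGMA k:{..<M}. {..k}). ?t i j (k - j))"
    by (rule sum.reindex_bij_witness_not_neutral[where
        S' = "(SIGMA m:{..<?L}. {..<?L} \<times> {..m}) \<inter> {(m, n, j). \<not> (m - j < M \<and> n + j < M)}" and
        T' = "{}" and
        i = "\<lambda>(i, k, j). (i + j, k - j, j)" and j = "\<lambda>(m, n, j). (m - j, n + j, j)"])
      (auto simp: h add.commute not_less intro!: finite_SigmaI finite_Int)
  also have "\<dots> = (\<Sum>i<M. \<Sum>(k, j)\<in>(SIGMA k:{..<M}. {..k}). ?t i j (k - j))"
    by (subst sum.Sigma) (auto simp: split_def)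
  also have "\<dots> = (\<Sum>i<M. \<Sum>k<M. \<Sum>j\<le>k. ?t i j (k - j))"
    by (intro sum.cong refl, subst sum.Sigma) (auto simp: split_def)
  also have "\<dots> = (\<Sum>i<M. \<Sum>k<M. s ((x + y) ^ k / fact k) (s (x ^ i / fact i) (h i k)))"
  proof (intro sum.cong refl)
    fix i k
    have "(\<Sum>j\<le>k. x ^ i / fact i * (x ^ j / fact j) * (y ^ (k - j) / fact (k - j))) =
        (x + y) ^ k / fact k * (x ^ i / fact i)"
      unfolding binomial_ring sum_divide_distrib sum_distrib_right
    proof (intro sum.cong refl)
      fix j assume "j \<in> {..k}"
      then show "x ^ i / fact i * (x ^ j / fact j) * (y ^ (k - j) / fact (k - j)) =
         of_nat (k choose j) * x ^ j * y ^ (k - j) / fact k * (x ^ i / fact i)"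
        by (simp add: binomial_fact field_simps)
    qed
    then show "(\<Sum>j\<le>k. ?t i j (k - j)) = s ((x + y) ^ k / fact k) (s (x ^ i / fact i) (h i k))"
      by (simp flip: scale_sum_left)
  qed
  also have "\<dots> = exp_sum s (x + y) (\<lambda>k. exp_sum s x (\<lambda>i. h i k))"
  proof -
    have e: "exp_sum s x (\<lambda>i. h i k) = (\<Sum>i<M. s (x ^ i / fact i) (h i k))" for k
      using h by (intro exp_sum_eq) auto
    have "\<forall>k\<ge>M. exp_sum s x (\<lambda>i. h i k) = 0" using h by (simp add: exp_sum_def)
    then show ?thesis
      using exp_sum_eq[of M "\<lambda>k. exp_sum s x (\<lambda>i. h i k)" "x + y"]
      by (simp add: e scale_sum_right del: scale_scale) (rule sum.swap)
  qed
  finally show ?thesis .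
qed

text \<open>Vandermonde: the coefficients are recovered from the values by means of the operators
  \<open>F(x) \<mapsto> F(2x) - 2\<^sup>N F(x)\<close>, each of which removes one power of \<open>x\<close>.\<close>

lemma coeffs_in_subspace:
  assumes "subspace S" "\<And>x. (\<Sum>n<N. s (x ^ n) (f n)) \<in> S" "n < N"
  shows "f n \<in> S"
  using assms(2,3)
proof (induction N arbitrary: f n)
  case 0
  then show ?case by simp
next
  case (Suc N f n)
  let ?F = "\<lambda>x. \<Sum>n<Suc N. s (x ^ n) (f n)"
  have lower: "f n \<in> S" if "n < N" for n
  proof -
    \<comment> \<open>The induction hypothesis applies to the values of F(2x) - 2^N F(x), where the N-th power is gone.\<close>
    have "s (2 ^ n - 2 ^ N) (f n) \<in> S"
    proof (rule Suc.IH[OF _ that])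
      fix x :: 'k
      have "?F (2 * x) - s (2 ^ N) (?F x) \<in> S"
        using assms(1) Suc.prems(1) by (intro subspace_diff subspace_scale)
      also have "?F (2 * x) - s (2 ^ N) (?F x) = (\<Sum>n<Suc N. s (x ^ n) (s (2 ^ n - 2 ^ N) (f n)))"
        unfolding scale_sum_right sum_subtractf[symmetric]
        by (intro sum.cong refl) (simp add: power_mult_distrib algebra_simps scale_left_diff_distrib)
      finally show "(\<Sum>n<N. s (x ^ n) (s (2 ^ n - 2 ^ N) (f n))) \<in> S" by simp
    qed
    then have "s (inverse (2 ^ n - 2 ^ N)) (s (2 ^ n - 2 ^ N) (f n)) \<in> S"
      by (rule subspace_scale[OF assms(1)])
    moreover have "(2::'k) ^ n - 2 ^ N \<noteq> 0"
    proof -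
      have "(2::nat) ^ n \<noteq> 2 ^ N" using that by simp
      then have "of_nat (2 ^ n) \<noteq> (of_nat (2 ^ N) :: 'k)" unfolding of_nat_eq_iff .
      then show ?thesis by simp
    qed
    ultimately show ?thesis by simp
  qed
  have "?F 1 - (\<Sum>n<N. f n) \<in> S"
    by (rule subspace_diff[OF assms(1) Suc.prems(1)], rule subspace_sum[OF assms(1)]) (use lower in simp)
  then have "f N \<in> S" by simp
  with lower Suc.prems(2) show ?case by (cases "n = N") (auto simp: less_Suc_eq)
qed

lemma exp_coeffs_in_subspace:
  assumes "subspace S" "\<And>x. exp_sum s x f \<in> S" "eventually_zero f"
  shows "f n \<in> S"
proof -
  obtain N where N: "\<forall>n\<ge>N. f n = 0" using assms(3) unfolding eventually_zero_def by blast
  show ?thesis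
  proof (cases "n < N")
    case True
    have "s (1 / fact n) (f n) \<in> S"
      using assms(2) by (intro coeffs_in_subspace[OF assms(1) _ True, of "\<lambda>n. s (1 / fact n) (f n)"])
        (simp add: exp_sum_eq[OF N])
    then have "s (fact n) (s (1 / fact n) (f n)) \<in> S" by (rule subspace_scale[OF assms(1)])
    then show ?thesis by simp
  next
    case False
    then show ?thesis using N subspace_0[OF assms(1)] by simp
  qed
qed

end

text \<open>The value of the \<open>\<lambda>\<close>-product at \<open>\<lambda> = x\<close>.  It replaces a polynomial with coefficients in the
  algebra by an element of the algebra, and since the field is infinite no information is lost.\<close>

definition lprod_at :: "'k::field_char_0 \<Rightarrow> 'k U3 \<Rightarrow> 'k U3 \<Rightarrow> 'k U3" where
  "lprod_at x a b = exp_sum U3_scale x (\<lambda>n. U3_nprod n a b)"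

lemma U3_vector_space: "vector_space U3_scale" by (rule U3.vector_space_axioms)

lemma eventually_zero_nprod: "eventually_zero (\<lambda>n. U3_nprod n a b)"
  using U3_locality[of a b] unfolding eventually_zero_def .

lemma lprod_at_add_left: "lprod_at x (a + b) c = lprod_at x a c + lprod_at x b c"
  unfolding lprod_at_def U3_nprod_add_left
  by (rule exp_sum_add[OF U3_vector_space]) (rule eventually_zero_nprod)+

lemma lprod_at_add_right: "lprod_at x a (b + c) = lprod_at x a b + lprod_at x a c"
  unfolding lprod_at_def U3_nprod_add_right
  by (rule exp_sum_add[OF U3_vector_space]) (rule eventually_zero_nprod)+

lemma lprod_at_scale_left: "lprod_at x (U3_scale r a) c = U3_scale r (lprod_at x a c)"
  unfolding lprod_at_def U3_nprod_scale_left
  by (rule exp_sum_scale[OF U3_vector_space]) (rule eventually_zero_nprod)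

lemma lprod_at_scale_right: "lprod_at x a (U3_scale r c) = U3_scale r (lprod_at x a c)"
  unfolding lprod_at_def U3_nprod_scale_right
  by (rule exp_sum_scale[OF U3_vector_space]) (rule eventually_zero_nprod)

lemma lprod_at_0_left [simp]: "lprod_at x 0 a = 0"
  using lprod_at_add_left[of x 0 0 a] by simp

lemma lprod_at_0_right [simp]: "lprod_at x a 0 = 0"
  using lprod_at_add_right[of x a 0 0] by simp

lemma lprod_at_der_left: "lprod_at x (U3_der a) b = U3_scale (- x) (lprod_at x a b)"
proof -
  have "lprod_at x (U3_der a) b = exp_sum U3_scale x (\<lambda>n. U3_scale (of_nat n) (U3_nprod (n - 1) (U3_scale (- 1) a) b))"
    unfolding lprod_at_def U3_nprod_der_left U3_nprod_scale_left U3.scale_scale by simp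
  also have "\<dots> = U3_scale x (lprod_at x (U3_scale (- 1) a) b)"
    unfolding lprod_at_def by (rule exp_sum_shift[OF U3_vector_space eventually_zero_nprod])
  finally show ?thesis unfolding lprod_at_scale_left by simp
qed

lemma lprod_at_der_right:
  "lprod_at x a (U3_der b) = U3_der (lprod_at x a b) + U3_scale x (lprod_at x a b)"
proof -
  have z: "eventually_zero (\<lambda>n. U3_der (U3_nprod n a b))"
    using eventually_zero_nprod[of a b] U3_der_0 unfolding eventually_zero_def by metis
  have z': "eventually_zero (\<lambda>n. U3_scale (of_nat n) (U3_nprod (n - 1) a b))"
  proof -
    obtain N where "\<forall>n\<ge>N. U3_nprod n a b = 0"
      using eventually_zero_nprod[of a b] unfolding eventually_zero_def by blast
    then have "\<forall>n\<ge>Suc N. U3_scale (of_nat n) (U3_nprod (n - 1) a b) = 0" by auto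
    then show ?thesis unfolding eventually_zero_def by blast
  qed
  show ?thesis
    unfolding lprod_at_def U3_nprod_der_right
    using exp_sum_add[OF U3_vector_space z z', of x] exp_sum_shift[OF U3_vector_space eventually_zero_nprod, of x a b]
      exp_sum_linear[OF U3_vector_space eventually_zero_nprod U3_der_add U3_der_scale U3_vector_space, of x a b]
    by simp
qed

lemma lprod_at_assoc: "lprod_at x a (lprod_at y b c) = lprod_at (x + y) (lprod_at x a b) c"
proof -
  obtain N1 where N1: "\<forall>n\<ge>N1. U3_nprod n a b = 0" using U3_locality by blast
  obtain N2 where N2: "\<forall>n\<ge>N2. U3_nprod n b c = 0" using U3_locality by blast
  let ?M = "max N1 N2"
  have "lprod_at x a (lprod_at y b c) = exp_sum U3_scale x (\<lambda>m. exp_sum U3_scale y (\<lambda>n. U3_nprod m a (U3_nprod n b c)))"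
    unfolding lprod_at_def
    by (subst exp_sum_linear[OF U3_vector_space eventually_zero_nprod _ _ U3_vector_space])
      (simp_all add: U3_nprod_add_right U3_nprod_scale_right)
  also have "\<dots> = exp_sum U3_scale (x + y) (\<lambda>k. exp_sum U3_scale x (\<lambda>i. U3_nprod k (U3_nprod i a b) c))"
  proof (rule exp_sum_binomial[OF U3_vector_space U3_nprod_nprod, where M = ?M])
    fix i k assume "?M \<le> i \<or> ?M \<le> k"
    then show "U3_nprod k (U3_nprod i a b) c = 0"
      using N1 U3_nprod_vanish_left[of N2 b c k i a] N2 by auto
  qed
  also have "\<dots> = lprod_at (x + y) (lprod_at x a b) c"
    unfolding lprod_at_def
    by (subst exp_sum_linear[OF U3_vector_space eventually_zero_nprod _ _ U3_vector_space, of "\<lambda>u. U3_nprod _ u c"])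
      (simp_all add: U3_nprod_add_left U3_nprod_scale_left)
  finally show ?thesis .
qed

lemma nprod_in_subspace:
  assumes "U3.subspace S" "\<And>x. lprod_at x a b \<in> S"
  shows "U3_nprod n a b \<in> S"
  using exp_coeffs_in_subspace[OF U3_vector_space assms(1) _ eventually_zero_nprod] assms(2)
  unfolding lprod_at_def by blast

text \<open>The \<open>n\<close>-products are recovered from the products at scalars by \<open>nprod_in_subspace\<close>, so closure
  under the latter is enough.\<close>

lemma U3_at_induct:
  assumes "U3.subspace S" "U3_gen \<in> S" "\<And>a. a \<in> S \<Longrightarrow> U3_der a \<in> S"
    "\<And>a b x. a \<in> S \<Longrightarrow> b \<in> S \<Longrightarrow> lprod_at x a b \<in> S"
  shows "a \<in> S"
proof (induction a rule: U3_induct)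
  case (nprod n a b)
  then show ?case using assms(4) by (intro nprod_in_subspace[OF assms(1)]) auto
qed (use assms U3.subspace_0 U3.subspace_add U3.subspace_scale in auto)

section \<open>A basis of the algebra\<close>

definition functional :: "('k::field_char_0 U3 \<Rightarrow> 'k) \<Rightarrow> bool" where
  "functional f \<longleftrightarrow> (\<forall>a b. f (a + b) = f a + f b) \<and> (\<forall>r a. f (U3_scale r a) = r * f a)"

lemma functional_simps:
  assumes "functional f"
  shows "f (a + b) = f a + f b" "f (U3_scale r a) = r * f a" "f (- a) = - f a" "f (a - b) = f a - f b"
    "f 0 = 0"
proof -
  show add: "f (a + b) = f a + f b" for a b using assms unfolding functional_def by blast
  show "f (U3_scale r a) = r * f a" using assms unfolding functional_def by blast
  show 0: "f 0 = 0" using add[of 0 0] by simp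
  show minus: "f (- a) = - f a" for a using add[of a "- a"] 0 by (simp add: add_eq_0_iff)
  show "f (a - b) = f a - f b" using add[of a "- b"] minus[of b] by simp
qed

text \<open>Functionals separate points, so an identity between linear combinations may be checked after an
  arbitrary functional is applied, where it becomes an identity in the field that the simplifier
  can decide.\<close>

lemma U3_eqI:
  fixes a b :: "'k::field_char_0 U3"
  assumes "\<And>f. functional f \<Longrightarrow> f a = f b"
  shows "a = b"
proof (rule ccontr)
  assume "a \<noteq> b"
  interpret vector_space_pair "U3_scale :: 'k \<Rightarrow> _" "(*) :: 'k \<Rightarrow> 'k \<Rightarrow> 'k"
    by unfold_locales (simp_all add: algebra_simps)
  have "U3.independent {a - b}" using \<open>a \<noteq> b\<close> by (simp add: U3.dependent_single)
  then obtain g where g: "Vector_Spaces.linear U3_scale (*) g" "g (a - b) = (1 :: 'k)"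
    using linear_independent_extend[of "{a - b}" "\<lambda>_. 1"] by auto
  then have "functional g"
    unfolding functional_def using linear_add linear_scale by blast
  with assms[OF this] g(2) show False by (simp add: functional_simps)
qed

lemma exp_sum_quadratic:
  assumes "\<And>n. 3 \<le> n \<Longrightarrow> f n = 0"
  shows "exp_sum U3_scale x f = f 0 + U3_scale x (f 1) + U3_scale (x ^ 2 / 2) (f 2)"
proof -
  have "exp_sum U3_scale x f = (\<Sum>n<3. U3_scale (x ^ n / fact n) (f n))"
    using assms by (intro exp_sum_eq[OF U3_vector_space]) auto
  then show ?thesis by (simp add: eval_nat_numeral)
qed

text \<open>The operator \<open>L\<close>.\<close>

definition left_gen :: "'k::field_char_0 U3 \<Rightarrow> 'k U3" where
  "left_gen a = U3_nprod 0 U3_gen a"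

text \<open>The element \<open>e\<close>.\<close>

definition quad_gen :: "'k::field_char_0 U3" where
  "quad_gen = U3_scale (1 / 2) (U3_nprod 2 U3_gen U3_gen)"

lemma left_gen_lprod_at: "left_gen a = lprod_at 0 U3_gen a"
  unfolding left_gen_def lprod_at_def by (rule exp_sum_0[OF U3_vector_space eventually_zero_nprod, symmetric])

lemma left_gen_add: "left_gen (a + b) = left_gen a + left_gen b"
  by (simp add: left_gen_def U3_nprod_add_right)

lemma left_gen_scale: "left_gen (U3_scale r a) = U3_scale r (left_gen a)"
  by (simp add: left_gen_def U3_nprod_scale_right)

lemma left_gen_0 [simp]: "left_gen 0 = 0"
  by (simp add: left_gen_def)

lemma left_gen_uminus: "left_gen (- a) = - left_gen a"
  using left_gen_add[of a "- a"] by (simp add: add_eq_0_iff)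

lemma left_gen_diff: "left_gen (a - b) = left_gen a - left_gen b"
  using left_gen_add[of a "- b"] by (simp add: left_gen_uminus)

lemma left_gen_der: "left_gen (U3_der a) = U3_der (left_gen a)"
  by (simp add: left_gen_def U3_nprod_der_right)

lemma left_gen_lprod: "lprod_at x (left_gen a) b = left_gen (lprod_at x a b)"
  unfolding left_gen_lprod_at using lprod_at_assoc[of 0 U3_gen x a b] by simp

lemma U3_der_uminus: "U3_der (- a) = - U3_der a"
  using U3_der_add[of a "- a"] by (simp add: add_eq_0_iff)

lemma U3_der_diff: "U3_der (a - b) = U3_der a - U3_der b"
  using U3_der_add[of a "- b"] by (simp add: U3_der_uminus)

lemma lprod_at_uminus_right: "lprod_at x a (- b) = - lprod_at x a b"
  using lprod_at_add_right[of x a b "- b"] by (simp add: add_eq_0_iff)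

lemma lprod_at_diff_right: "lprod_at x a (b - c) = lprod_at x a b - lprod_at x a c"
  using lprod_at_add_right[of x a b "- c"] by (simp add: lprod_at_uminus_right)

lemma lprod_at_uminus_left: "lprod_at x (- a) b = - lprod_at x a b"
  using lprod_at_add_left[of x a "- a" b] by (simp add: add_eq_0_iff)

lemma lprod_at_diff_left: "lprod_at x (a - b) c = lprod_at x a c - lprod_at x b c"
  using lprod_at_add_left[of x a "- b" c] by (simp add: lprod_at_uminus_left)

lemmas U3_linear = lprod_at_add_left lprod_at_add_right lprod_at_diff_left lprod_at_diff_right
  lprod_at_uminus_left lprod_at_uminus_right lprod_at_scale_left lprod_at_scale_right
  lprod_at_der_left lprod_at_der_right left_gen_add left_gen_diff left_gen_uminus left_gen_scale
  left_gen_der U3_der_add U3_der_diff U3_der_uminus U3_der_scale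

lemmas U3_scale_simps = U3.scale_right_distrib U3.scale_left_distrib U3.scale_right_diff_distrib
  U3.scale_left_diff_distrib U3.scale_scale

lemma nprod_1_gen_gen: "U3_nprod 1 U3_gen U3_gen = U3_gen + U3_der (quad_gen :: 'k::field_char_0 U3)"
proof -
  have "2 * f (U3_nprod 1 U3_gen U3_gen) - f (U3_der (U3_nprod 2 U3_gen U3_gen)) = 2 * f U3_gen"
    if "functional f" for f :: "'k U3 \<Rightarrow> 'k"
    using arg_cong[OF U3_gen_Virasoro, of f] by (simp only: functional_simps[OF that])
  then show ?thesis
    by (intro U3_eqI) (simp add: functional_simps quad_gen_def U3_der_scale field_simps del: One_nat_def)
qed

lemma nprod_2_gen_gen: "U3_nprod 2 U3_gen U3_gen = U3_scale 2 quad_gen"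
  by (simp add: quad_gen_def)

lemma lprod_at_gen_gen:
  "lprod_at x U3_gen U3_gen =
    left_gen U3_gen + U3_scale x (U3_gen + U3_der quad_gen) + U3_scale (x ^ 2) quad_gen"
  unfolding lprod_at_def using exp_sum_quadratic[of "\<lambda>n. U3_nprod n U3_gen U3_gen" x]
  by (simp add: U3_gen_locality left_gen_def nprod_1_gen_gen[unfolded One_nat_def] nprod_2_gen_gen)

text \<open>By associativity the left-hand side is \<open>(v\<^sub>xv)\<^sub>x\<^sub>+\<^sub>yc\<close>, where \<open>\<partial>\<close> in the first factor acts as
  \<open>- (x + y)\<close>; thus the term \<open>x(\<partial> + x)e\<close> of \<open>v\<^sub>xv\<close> contributes \<open>- xy e\<^sub>x\<^sub>+\<^sub>yc\<close>.\<close>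

lemma lprod_at_gen_gen_lprod_at:
  "lprod_at x U3_gen (lprod_at y U3_gen c) =
    left_gen (lprod_at (x + y) U3_gen c) + U3_scale x (lprod_at (x + y) U3_gen c)
      - U3_scale (x * y) (lprod_at (x + y) quad_gen c)"
  unfolding lprod_at_assoc lprod_at_gen_gen U3_linear left_gen_lprod
  by (rule U3_eqI) (simp add: functional_simps algebra_simps power2_eq_square)

text \<open>The only term of the previous formula that is not symmetric in \<open>x\<close> and \<open>y\<close> is
  \<open>x v\<^sub>x\<^sub>+\<^sub>yc\<close>; this is the Virasoro relation.\<close>

lemma gen_commutator:
  "lprod_at x U3_gen (lprod_at y U3_gen c) =
    lprod_at y U3_gen (lprod_at x U3_gen c) + U3_scale (x - y) (lprod_at (x + y) U3_gen c)"
  unfolding lprod_at_gen_gen_lprod_at add.commute[of y x]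
  by (rule U3_eqI) (simp add: functional_simps algebra_simps)

lemma lprod_at_gen_left_gen:
  "lprod_at x U3_gen (left_gen c) = left_gen (lprod_at x U3_gen c) + U3_scale x (lprod_at x U3_gen c)"
  using gen_commutator[of x 0 c] by (simp add: left_gen_lprod_at)

text \<open>Although \<open>e\<close> is a product of two generators, it is local of order two, not three, with respect to
  the generator: expanding \<open>v\<^sub>(\<^sub>1\<^sub>)(v\<^sub>(\<^sub>n\<^sub>+\<^sub>1\<^sub>)v) = 0\<close> by associativity leaves a nonzero multiple of
  \<open>e\<^sub>(\<^sub>n\<^sub>)v\<close> for \<open>n \<ge> 2\<close>.  In the other order, all terms in the expansion of
  \<open>v\<^sub>(\<^sub>n\<^sub>)(v\<^sub>(\<^sub>2\<^sub>)v)\<close> vanish.\<close>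

lemma quad_gen_locality:
  assumes "2 \<le> n"
  shows "U3_nprod n quad_gen (U3_gen :: 'k::field_char_0 U3) = 0"
    and "U3_nprod n U3_gen (quad_gen :: 'k U3) = 0"
proof -
  let ?v = "U3_gen :: 'k U3"
  have q: "U3_nprod n (left_gen ?v) ?v = 0" if "3 \<le> n" for n
    using U3_nprod_nprod[of 0 ?v n ?v ?v] by (simp add: left_gen_def U3_gen_locality[OF that])
  have e: "U3_nprod n quad_gen ?v = 0" if "2 \<le> n" for n
  proof -
    have "0 = U3_nprod 1 ?v (U3_nprod (Suc n) ?v ?v)"
      using that by (simp add: U3_gen_locality)
    also have "\<dots> = U3_nprod (Suc n) (?v + U3_der quad_gen) ?v + U3_nprod (Suc (Suc n)) (left_gen ?v) ?v"
      using U3_nprod_nprod[of 1 ?v "Suc n" ?v ?v] by (simp add: nprod_1_gen_gen[unfolded One_nat_def] left_gen_def)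
    also have "\<dots> = U3_scale (- of_nat (Suc n)) (U3_nprod n quad_gen ?v)"
      using q[of "Suc (Suc n)"] that
      by (simp add: U3_gen_locality U3_nprod_add_left U3_nprod_der_left del: of_nat_Suc)
    finally show ?thesis by (simp del: of_nat_Suc)
  qed
  then show "U3_nprod n quad_gen ?v = 0" using assms by simp
  have "U3_nprod n ?v (U3_nprod 2 ?v ?v) = 0"
    unfolding U3_nprod_nprod
  proof (rule sum.neutral, rule ballI)
    fix j assume j: "j \<in> {..n}"
    consider "n - j = 0" | "n - j = 1" | "n - j = 2" | "3 \<le> n - j" by linarith
    then have "U3_nprod (2 + j) (U3_nprod (n - j) ?v ?v) ?v = 0"
    proof cases
      case 1
      then show ?thesis using q[of "2 + j"] j assms by (simp add: left_gen_def)
    next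
      case 2
      then have "U3_nprod (2 + j) ?v ?v = 0" using assms j by (intro U3_gen_locality) simp
      moreover have "U3_nprod (1 + j) quad_gen ?v = 0" using 2 assms j by (intro e) simp
      ultimately show ?thesis
        unfolding 2 nprod_1_gen_gen by (simp add: U3_nprod_add_left U3_nprod_der_left)
    next
      case 3
      then show ?thesis using e[of "2 + j"] by (simp add: nprod_2_gen_gen U3_nprod_scale_left)
    qed (simp add: U3_gen_locality)
    then show "U3_scale (of_nat (n choose j)) (U3_nprod (2 + j) (U3_nprod (n - j) ?v ?v) ?v) = 0" by simp
  qed
  then show "U3_nprod n ?v quad_gen = 0"
    by (simp add: quad_gen_def U3_nprod_scale_right)
qed

text \<open>The elements \<open>e\<^sub>j\<close>.  As \<open>v\<^sub>xe\<^sub>j\<close> turns out to be affine in \<open>x\<close>, its coefficient \<open>v\<^sub>(\<^sub>1\<^sub>)e\<^sub>j\<close> is the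
  difference of the values at 1 and 0.\<close>

primrec quad :: "nat \<Rightarrow> 'k::field_char_0 U3" where
  "quad 0 = quad_gen"
| "quad (Suc j) = lprod_at 1 U3_gen (quad j) - left_gen (quad j)"

text \<open>For \<open>e\<^sub>0\<close> this is locality of order two.  The step applies the commutator of \<open>v\<^sub>x\<close> and \<open>v\<^sub>y\<close> to
  \<open>e\<^sub>j\<close>: it relates \<open>y v\<^sub>xe\<^sub>j\<^sub>+\<^sub>1\<close> to \<open>x v\<^sub>ye\<^sub>j\<^sub>+\<^sub>1\<close>, and \<open>y = 1\<close> shows that \<open>v\<^sub>xe\<^sub>j\<^sub>+\<^sub>1\<close> is affine
  in \<open>x\<close>.\<close>

lemma lprod_at_gen_quad:
  "lprod_at x U3_gen (quad j) = left_gen (quad j) + U3_scale x (quad (Suc j))"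
proof (induction j arbitrary: x)
  case 0
  have "lprod_at x U3_gen quad_gen = left_gen quad_gen + U3_scale x (U3_nprod 1 U3_gen quad_gen)" for x :: 'a
    unfolding lprod_at_def using exp_sum_quadratic[of "\<lambda>n. U3_nprod n U3_gen quad_gen" x]
    by (simp add: quad_gen_locality(2) left_gen_def)
  then show ?case by (simp add: U3_scale_simps)
next
  case (Suc j)
  let ?X = "\<lambda>x. lprod_at x U3_gen (quad (Suc j))"
  have "U3_scale y (?X x) - U3_scale x (?X y) = U3_scale (y - x) (left_gen (quad (Suc j)))" for x y :: 'a
  proof (rule U3_eqI)
    fix f :: "'a U3 \<Rightarrow> 'a" assume f: "functional f"
    have "f (lprod_at x U3_gen (lprod_at y U3_gen (quad j))) =
        f (lprod_at y U3_gen (lprod_at x U3_gen (quad j)) + U3_scale (x - y) (lprod_at (x + y) U3_gen (quad j)))"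
      by (subst gen_commutator) (rule refl)
    then show "f (U3_scale y (?X x) - U3_scale x (?X y)) = f (U3_scale (y - x) (left_gen (quad (Suc j))))"
      unfolding Suc.IH U3_linear lprod_at_gen_left_gen functional_simps[OF f]
      by (simp add: Suc.IH U3_linear functional_simps[OF f] algebra_simps del: quad.simps)
  qed
  from this[of 1 x] have "?X x = U3_scale x (?X 1) + U3_scale (1 - x) (left_gen (quad (Suc j)))"
    by (simp add: algebra_simps del: quad.simps)
  then show ?case
    unfolding quad.simps(2)[of "Suc j"]
    by (simp add: U3_scale_simps del: quad.simps)
qed

text \<open>For \<open>e\<^sub>0\<close> the formula for \<open>v\<^sub>y(v\<^sub>x\<^sub>-\<^sub>yv)\<close> contains \<open>y(x - y) e\<^sub>xv\<close> and otherwise only known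
  products.  The step is associativity: \<open>(v\<^sub>1e\<^sub>j)\<^sub>xv = v\<^sub>1((e\<^sub>j)\<^sub>x\<^sub>-\<^sub>1v)\<close>.\<close>

lemma lprod_at_quad_gen:
  "lprod_at x (quad j) U3_gen =
    left_gen (quad j) + U3_scale x (quad j) - U3_scale x (quad (Suc j)) - U3_der (quad (Suc j))"
proof (induction j arbitrary: x)
  case 0
  \<comment> \<open>Any y with y (x - y) nonzero would do.\<close>
  define y :: 'a where "y = (if x = 1 then 2 else 1)"
  have y: "y \<noteq> 0" "x - y \<noteq> 0" by (auto simp: y_def)
  have "U3_scale (y * (x - y)) (lprod_at x quad_gen U3_gen) =
    left_gen (lprod_at x U3_gen U3_gen) + U3_scale y (lprod_at x U3_gen U3_gen)
     - lprod_at y U3_gen (lprod_at (x - y) U3_gen U3_gen)"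
    using lprod_at_gen_gen_lprod_at[of y "x - y" U3_gen] by (simp add: algebra_simps)
  also have "\<dots> = U3_scale (y * (x - y)) (left_gen (quad 0) + U3_scale x (quad 0) - U3_scale x (quad (Suc 0)) - U3_der (quad (Suc 0)))"
    using lprod_at_gen_quad[of y 0]
    unfolding lprod_at_gen_gen U3_linear lprod_at_gen_left_gen quad.simps(1)
    by (intro U3_eqI) (simp add: functional_simps U3_linear algebra_simps power2_eq_square lprod_at_gen_gen del: quad.simps)
  finally show ?case using y by (simp del: quad.simps(2))
next
  case (Suc j)
  have "lprod_at x (quad (Suc j)) U3_gen = lprod_at 1 U3_gen (lprod_at (x - 1) (quad j) U3_gen)
      - left_gen (lprod_at x (quad j) U3_gen)"
    using lprod_at_assoc[of 1 U3_gen "x - 1" "quad j" U3_gen]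
    by (simp add: left_gen_lprod lprod_at_diff_left)
  also have "\<dots> = left_gen (quad (Suc j)) + U3_scale x (quad (Suc j)) - U3_scale x (quad (Suc (Suc j))) - U3_der (quad (Suc (Suc j)))"
    unfolding Suc.IH U3_linear lprod_at_gen_left_gen lprod_at_gen_quad
    by (rule U3_eqI) (simp add: functional_simps U3_linear algebra_simps del: quad.simps)
  finally show ?case .
qed

text \<open>Let \<open>T\<close> be the smallest subspace with the closure properties of \<open>S\<close>.  The formulas for \<open>v\<^sub>xc\<close> show
  that \<open>T\<close> is closed under all \<open>v\<^sub>x\<close>.  By associativity the elements \<open>a\<close> of \<open>T\<close> with
  \<open>a\<^sub>xT \<subseteq> T\<close> then form a subalgebra that contains the generator.\<close>

lemma U3_left_gen_induct:
  assumes S: "U3.subspace S" "\<And>a. a \<in> S \<Longrightarrow> U3_der a \<in> S" "\<And>a. a \<in> S \<Longrightarrow> left_gen a \<in> S"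
    and gen: "U3_gen \<in> S" "\<And>j. quad j \<in> S"
  shows "a \<in> S"
proof -
  let ?V = "\<lambda>S :: 'a U3 set. U3.subspace S \<and> (\<forall>a\<in>S. U3_der a \<in> S) \<and> (\<forall>a\<in>S. left_gen a \<in> S) \<and>
    U3_gen \<in> S \<and> (\<forall>j. quad j \<in> S)"
  define T where "T = \<Inter>{S. ?V S}"
  have T: "U3.subspace T" unfolding T_def by (rule U3.subspace_Inter) blast
  have der_closed: "U3_der a \<in> T" if "a \<in> T" for a using that unfolding T_def by blast
  have gen_closed: "lprod_at x U3_gen a \<in> T" if "a \<in> T" for a x
    unfolding T_def
  proof (rule InterI)
    fix S assume "S \<in> {S. ?V S}"
    then have V: "?V S" by simp
    let ?S = "{a. \<forall>x. lprod_at x U3_gen a \<in> S}"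
    have "U3.subspace ?S"
      using V unfolding U3.subspace_def[of ?S]
      by (auto simp: U3_linear intro: U3.subspace_0 intro!: U3.subspace_add U3.subspace_scale)
    moreover have "U3_der a \<in> ?S" if "a \<in> ?S" for a
      using that V by (auto simp: lprod_at_der_right intro!: U3.subspace_add U3.subspace_scale)
    moreover have "left_gen a \<in> ?S" if "a \<in> ?S" for a
      using that V by (auto simp: lprod_at_gen_left_gen intro!: U3.subspace_add U3.subspace_scale)
    moreover have "U3_gen \<in> ?S"
    proof -
      have "quad_gen \<in> S" using V quad.simps(1) by metis
      then show ?thesis using V by (auto simp: lprod_at_gen_gen intro!: U3.subspace_add U3.subspace_scale)
    qed
    moreover have "quad j \<in> ?S" for j
      using V by (auto simp: lprod_at_gen_quad simp del: quad.simps intro!: U3.subspace_add U3.subspace_scale)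
    ultimately have "?V ?S" by blast
    with that show "lprod_at x U3_gen a \<in> S" unfolding T_def by blast
  qed
  have "a \<in> {a \<in> T. \<forall>x. \<forall>c\<in>T. lprod_at x a c \<in> T}"
  proof (rule U3_at_induct)
    show "U3.subspace {a \<in> T. \<forall>x. \<forall>c\<in>T. lprod_at x a c \<in> T}"
      unfolding U3.subspace_def
      using U3.subspace_0[OF T] U3.subspace_add[OF T] U3.subspace_scale[OF T] by (auto simp: U3_linear)
    have "U3_gen \<in> T" unfolding T_def by blast
    then show "U3_gen \<in> {a \<in> T. \<forall>x. \<forall>c\<in>T. lprod_at x a c \<in> T}"
      using gen_closed by blast
    show "U3_der a \<in> {a \<in> T. \<forall>x. \<forall>c\<in>T. lprod_at x a c \<in> T}"
      if "a \<in> {a \<in> T. \<forall>x. \<forall>c\<in>T. lprod_at x a c \<in> T}" for a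
      using that U3.subspace_scale[OF T] U3.subspace_neg[OF T] der_closed by (auto simp: lprod_at_der_left)
    fix a b x
    assume a: "a \<in> {a \<in> T. \<forall>x. \<forall>c\<in>T. lprod_at x a c \<in> T}"
      and b: "b \<in> {a \<in> T. \<forall>x. \<forall>c\<in>T. lprod_at x a c \<in> T}"
    have "lprod_at y (lprod_at x a b) c \<in> T" if "c \<in> T" for y c
    proof -
      have "lprod_at x a (lprod_at (y - x) b c) \<in> T" using a b that by blast
      then show ?thesis by (simp add: lprod_at_assoc)
    qed
    then show "lprod_at x a b \<in> {a \<in> T. \<forall>x. \<forall>c\<in>T. lprod_at x a c \<in> T}"
      using a b by blast
  qed
  with S gen show ?thesis unfolding T_def by blast
qed

text \<open>\<open>L\<close> commutes with \<open>\<partial>\<close>, so the \<open>k[\<partial>]\<close>-span of the elements \<open>L\<^sup>kv\<close> and \<open>L\<^sup>ke\<^sub>j\<close> is closed under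
  \<open>L\<close>.\<close>

theorem U3_basis_induct:
  assumes "U3.subspace S" "\<And>a. a \<in> S \<Longrightarrow> U3_der a \<in> S"
    and "\<And>k. (left_gen ^^ k) U3_gen \<in> S" "\<And>k j. (left_gen ^^ k) (quad j) \<in> S"
  shows "a \<in> S"
proof -
  let ?V = "\<lambda>S :: 'a U3 set. U3.subspace S \<and> (\<forall>a\<in>S. U3_der a \<in> S) \<and>
    (\<forall>k. (left_gen ^^ k) U3_gen \<in> S) \<and> (\<forall>k j. (left_gen ^^ k) (quad j) \<in> S)"
  have "a \<in> \<Inter>{S. ?V S}"
  proof (rule U3_left_gen_induct)
    show "U3.subspace (\<Inter>{S. ?V S})" by (rule U3.subspace_Inter) blast
    show "left_gen a \<in> \<Inter>{S. ?V S}" if a: "a \<in> \<Inter>{S. ?V S}" for a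
    proof (rule InterI)
      fix S assume "S \<in> {S. ?V S}"
      then have V: "?V S" by simp
      have "U3.subspace {a. left_gen a \<in> S}"
        using V unfolding U3.subspace_def[of "Collect _"]
        by (auto simp: U3_linear intro: U3.subspace_0 intro!: U3.subspace_add U3.subspace_scale)
      moreover have "(left_gen ^^ k) g \<in> {a. left_gen a \<in> S}" if "\<forall>k. (left_gen ^^ k) g \<in> S" for k g
        using that[rule_format, of "Suc k"] by simp
      ultimately have "?V {a. left_gen a \<in> S}" using V by (auto simp: left_gen_der)
      with a show "left_gen a \<in> S" by blast
    qed
    show "U3_gen \<in> \<Inter>{S. ?V S}"
    proof (rule InterI)
      fix S assume "S \<in> {S. ?V S}"
      then have "(left_gen ^^ 0) U3_gen \<in> S" by blast
      then show "U3_gen \<in> S" by simp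
    qed
    show "quad j \<in> \<Inter>{S. ?V S}" for j
    proof (rule InterI)
      fix S assume "S \<in> {S. ?V S}"
      then have "(left_gen ^^ 0) (quad j) \<in> S" by blast
      then show "quad j \<in> S" by simp
    qed
  qed blast
  with assms show ?thesis by blast
qed

section \<open>The action on densities of varying weight\<close>

text \<open>The \<open>m\<close>-product of two operator-valued sequences \<open>a, b\<close> has the \<open>n\<close>-th coefficient
  \<open>\<Sum>\<^sub>j (-1)\<^sup>j (m choose j) a\<^sub>m\<^sub>-\<^sub>j b\<^sub>n\<^sub>+\<^sub>j\<close>.  Here \<open>T p q\<close> stands for \<open>a\<^sub>p b\<^sub>q\<close>, and the sum is
  written as an iterated difference, the form in which locality and associativity are visible.\<close>

primrec diff_prod :: "nat \<Rightarrow> (nat \<Rightarrow> nat \<Rightarrow> 'm::comm_ring_1) \<Rightarrow> nat \<Rightarrow> 'm" where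
  "diff_prod 0 T n = T 0 n"
| "diff_prod (Suc m) T n = diff_prod m (\<lambda>p q. T (Suc p) q - T p (Suc q)) n"

lemma diff_prod_add: "diff_prod m (\<lambda>p q. T p q + U p q) n = diff_prod m T n + diff_prod m U n"
proof (induction m arbitrary: T U)
  case (Suc m)
  have "diff_prod (Suc m) (\<lambda>p q. T p q + U p q) n =
      diff_prod m (\<lambda>p q. (T (Suc p) q - T p (Suc q)) + (U (Suc p) q - U p (Suc q))) n"
    by (simp add: algebra_simps)
  then show ?case unfolding Suc.IH by simp
qed simp

lemma diff_prod_map:
  assumes "\<And>a b. h (a - b) = h a - h b"
  shows "h (diff_prod m T n) = diff_prod m (\<lambda>p q. h (T p q)) n"
  by (induction m arbitrary: T) (simp_all add: assms)

lemma diff_prod_diff: "diff_prod m (\<lambda>p q. T p q - U p q) n = diff_prod m T n - diff_prod m U n"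
  using diff_prod_add[of m "\<lambda>p q. T p q - U p q" U n] by simp

lemma diff_prod_uminus: "diff_prod m (\<lambda>p q. - T p q) n = - diff_prod m T n"
  using diff_prod_diff[of m "\<lambda>_ _. 0" T n] diff_prod_diff[of m T T n] by simp

lemma diff_prod_shift: "diff_prod m T (Suc n) = diff_prod m (\<lambda>p q. T p (Suc q)) n"
  by (induction m arbitrary: T) simp_all

lemma diff_prod_zero:
  assumes "\<And>p q. N \<le> q \<Longrightarrow> T p q = 0" "N \<le> n"
  shows "diff_prod m T n = 0"
  using assms
proof (induction m arbitrary: T)
  case (Suc m)
  have "diff_prod m (\<lambda>p q. T (Suc p) q - T p (Suc q)) n = 0"
    by (rule Suc.IH) (use Suc.prems in auto)
  then show ?case by simp
qed simp

lemma diff_prod_der_left: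
  "diff_prod m (\<lambda>p q. of_nat p * T (p - 1) q) n = of_nat m * diff_prod (m - 1) T n"
proof (induction m arbitrary: T)
  case (Suc m)
  let ?D = "\<lambda>p q. T (Suc p) q - T p (Suc q)"
  have "(\<lambda>p q. of_nat (Suc p) * T (Suc p - 1) q - of_nat p * T (p - 1) (Suc q)) =
      (\<lambda>p q. T p q + of_nat p * ?D (p - 1) q)"
  proof (intro ext)
    fix p q
    show "of_nat (Suc p) * T (Suc p - 1) q - of_nat p * T (p - 1) (Suc q) = T p q + of_nat p * ?D (p - 1) q"
      by (cases p) (simp_all add: algebra_simps)
  qed
  then have "diff_prod (Suc m) (\<lambda>p q. of_nat p * T (p - 1) q) n =
      diff_prod m T n + of_nat m * diff_prod (m - 1) ?D n"
    by (simp only: diff_prod.simps diff_prod_add Suc.IH[of ?D])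
  also have "\<dots> = of_nat (Suc m) * diff_prod m T n"
    by (cases m) (simp_all add: algebra_simps)
  finally show ?case by simp
qed simp

lemma diff_prod_der_right:
  "diff_prod m (\<lambda>p q. of_nat q * T p (q - 1)) n =
    of_nat n * diff_prod m T (n - 1) - of_nat m * diff_prod (m - 1) T n"
proof (induction m arbitrary: T)
  case (Suc m)
  let ?D = "\<lambda>p q. T (Suc p) q - T p (Suc q)"
  have "(\<lambda>p q. of_nat q * T (Suc p) (q - 1) - of_nat (Suc q) * T p (Suc q - 1)) =
      (\<lambda>p q. of_nat q * ?D p (q - 1) - T p q)"
  proof (intro ext)
    fix p q
    show "of_nat q * T (Suc p) (q - 1) - of_nat (Suc q) * T p (Suc q - 1) = of_nat q * ?D p (q - 1) - T p q"
      by (cases q) (simp_all add: algebra_simps)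
  qed
  then have "diff_prod (Suc m) (\<lambda>p q. of_nat q * T p (q - 1)) n =
      of_nat n * diff_prod m ?D (n - 1) - of_nat m * diff_prod (m - 1) ?D n - diff_prod m T n"
    by (simp only: diff_prod.simps diff_prod_diff Suc.IH[of ?D])
  also have "\<dots> = of_nat n * diff_prod (Suc m) T (n - 1) - of_nat (Suc m) * diff_prod m T n"
    by (cases m) (simp_all add: algebra_simps)
  finally show ?case by simp
qed simp

lemma sum_Pascal:
  fixes F :: "nat \<Rightarrow> 'm::comm_ring_1"
  shows "(\<Sum>j\<le>Suc m. of_nat (Suc m choose j) * F j) =
    (\<Sum>j\<le>m. of_nat (m choose j) * (F j + F (Suc j)))"
proof -
  have "(\<Sum>j\<le>Suc m. of_nat (Suc m choose j) * F j) =
      F 0 + (\<Sum>j\<le>m. of_nat (Suc m choose Suc j) * F (Suc j))"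
    unfolding sum.atMost_Suc_shift by simp
  also have "\<dots> = F 0 + (\<Sum>j\<le>m. of_nat (m choose Suc j) * F (Suc j)) + (\<Sum>j\<le>m. of_nat (m choose j) * F (Suc j))"
    by (simp add: sum.distrib algebra_simps)
  also have "F 0 + (\<Sum>j\<le>m. of_nat (m choose Suc j) * F (Suc j)) = (\<Sum>j\<le>Suc m. of_nat (m choose j) * F j)"
    unfolding sum.atMost_Suc_shift by simp
  also have "\<dots> = (\<Sum>j\<le>m. of_nat (m choose j) * F j)"
    unfolding sum.atMost_Suc by (simp add: binomial_eq_0)
  finally show ?thesis by (simp add: sum.distrib algebra_simps)
qed

text \<open>In generating functions: \<open>z\<^sub>1\<^sup>m = ((z\<^sub>1 - z\<^sub>2) + z\<^sub>2)\<^sup>m\<close>.\<close>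

lemma diff_prod_inverse:
  "T m n = (\<Sum>j\<le>m. of_nat (m choose j) * diff_prod (m - j) T (n + j))"
proof (induction m arbitrary: T n)
  case (Suc m)
  let ?D = "\<lambda>p q. T (Suc p) q - T p (Suc q)"
  have "?D m n + T m (Suc n) = (\<Sum>j\<le>m. of_nat (m choose j) * diff_prod (m - j) ?D (n + j)) +
      (\<Sum>j\<le>m. of_nat (m choose j) * diff_prod (m - j) T (Suc n + j))"
    by (rule arg_cong2[OF Suc.IH[of ?D n] Suc.IH[of T "Suc n"]])
  also have "\<dots> = (\<Sum>j\<le>m. of_nat (m choose j) * (diff_prod (Suc m - j) T (n + j) + diff_prod (Suc m - Suc j) T (n + Suc j)))"
    unfolding distrib_left sum.distrib
    by (intro arg_cong2[of _ _ _ _ "(+)"] sum.cong refl) (simp_all add: Suc_diff_le)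
  finally show ?case unfolding sum_Pascal by simp
qed simp

text \<open>Expanded in powers of \<open>z\<^sub>1, z\<^sub>2, z\<^sub>3\<close> this is
  \<open>(z\<^sub>1 - z\<^sub>3)\<^sup>m = ((z\<^sub>1 - z\<^sub>2) + (z\<^sub>2 - z\<^sub>3))\<^sup>m\<close>.\<close>

lemma diff_prod_assoc:
  "diff_prod m (\<lambda>p k. diff_prod n (T p) k) k =
    (\<Sum>j\<le>m. of_nat (m choose j) * diff_prod (n + j) (\<lambda>q r. diff_prod (m - j) (\<lambda>p q. T p q r) q) k)"
proof (induction m arbitrary: T)
  case (Suc m)
  let ?D = "\<lambda>p q r. T (Suc p) q r - T p q (Suc r)"
  let ?F = "\<lambda>j. diff_prod (n + j) (\<lambda>q r. diff_prod (Suc m - j) (\<lambda>p q. T p q r) q) k"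
  have "diff_prod (Suc m) (\<lambda>p k. diff_prod n (T p) k) k = diff_prod m (\<lambda>p k. diff_prod n (?D p) k) k"
    by (simp add: diff_prod_shift diff_prod_diff)
  also have "\<dots> = (\<Sum>j\<le>m. of_nat (m choose j) * (?F j + ?F (Suc j)))"
    unfolding Suc.IH[of ?D]
  proof (intro sum.cong refl)
    fix j assume "j \<in> {..m}"
    then have j: "Suc m - j = Suc (m - j)" by auto
    have "?F j = diff_prod (n + j) (\<lambda>q r. diff_prod (m - j) (\<lambda>p q. T (Suc p) q r) q
        - diff_prod (m - j) (\<lambda>p q. T p (Suc q) r) q) k"
      unfolding j by (simp add: diff_prod_diff)
    moreover have "?F (Suc j) = diff_prod (n + j) (\<lambda>q r. diff_prod (m - j) (\<lambda>p q. T p (Suc q) r) q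
        - diff_prod (m - j) (\<lambda>p q. T p q (Suc r)) q) k"
      by (simp add: diff_prod_shift)
    ultimately have "?F j + ?F (Suc j) = diff_prod (n + j) (\<lambda>q r. diff_prod (m - j) (\<lambda>p q. ?D p q r) q) k"
      by (simp add: diff_prod_add[symmetric] diff_prod_diff)
    then show "of_nat (m choose j) * diff_prod (n + j) (\<lambda>q r. diff_prod (m - j) (\<lambda>p q. ?D p q r) q) k =
        of_nat (m choose j) * (?F j + ?F (Suc j))" by simp
  qed
  finally show ?case unfolding sum_Pascal .
qed simp

text \<open>The module is \<open>k[t][x]\<close>: the outer variable is \<open>x\<close>, the inner one is \<open>t\<close>.\<close>

type_synonym 'k density = "'k poly poly"

abbreviation scal :: "'k::field_char_0 \<Rightarrow> 'k density \<Rightarrow> 'k density" where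
  "scal r \<equiv> Polynomial.smult [:r:]"

definition var_x :: "'k::field_char_0 density" where "var_x = [:0, 1:]"
definition var_t :: "'k::field_char_0 density" where "var_t = [:[:0, 1:]:]"

lemma pderiv_var [simp]: "pderiv var_x = 1" "pderiv var_t = 0"
  by (simp_all add: var_x_def var_t_def pderiv_pCons)

lemma scal_1 [simp]: "scal 1 g = g" and scal_minus_1 [simp]: "scal (- 1) g = - g"
proof -
  show "scal 1 g = g" by (simp flip: one_pCons)
  have "[:- 1:] = (- 1 :: 'a poly)" by (simp add: one_pCons)
  then show "scal (- 1) g = - g" by simp
qed

lemma scal_add: "scal (r + q) g = scal r g + scal q g"
  by (simp flip: smult_add_left)

lemma scal_vector_space: "vector_space scal"
  by unfold_locales (simp_all only: smult_add_right scal_add scal_1 smult_smult mult_pCons_left, simp)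

text \<open>The operator \<open>s\<^sub>(\<^sub>n\<^sub>)\<close> on the module.  For the generator this is \<open>x D\<^sup>n + n t D\<^sup>n\<^sup>-\<^sup>1\<close>, the action of a
  vector field on densities of weight \<open>t\<close> after a Fourier transform.\<close>

primrec term_act :: "'k::field_char_0 U3_term \<Rightarrow> nat \<Rightarrow> 'k density \<Rightarrow> 'k density" where
  "term_act Gen n g = var_x * (pderiv ^^ n) g + of_nat n * (var_t * (pderiv ^^ (n - 1)) g)"
| "term_act Zero n g = 0"
| "term_act (Add s t) n g = term_act s n g + term_act t n g"
| "term_act (Scale r s) n g = scal r (term_act s n g)"
| "term_act (Der s) n g = - (of_nat n * term_act s (n - 1) g)"
| "term_act (NProd m s t) n g = diff_prod m (\<lambda>p q. term_act s p (term_act t q g)) n"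

lemma funpow_pderiv_add: "(pderiv ^^ n) (g + h) = (pderiv ^^ n) g + (pderiv ^^ n) h"
  by (induction n) (simp_all add: pderiv_add)

lemma funpow_pderiv_smult: "(pderiv ^^ n) (Polynomial.smult c g) = Polynomial.smult c ((pderiv ^^ n) g)"
  by (induction n) (simp_all add: pderiv_smult)

lemma funpow_pderiv_var_x:
  "(pderiv ^^ n) (var_x * g) = var_x * (pderiv ^^ n) g + of_nat n * (pderiv ^^ (n - 1)) g"
proof (induction n)
  case (Suc n)
  have d: "pderiv (of_nat n * h) = of_nat n * pderiv h" for h :: "'a density"
    by (simp add: of_nat_poly pderiv_smult)
  have "(pderiv ^^ Suc n) (var_x * g) = (pderiv ^^ n) g + var_x * (pderiv ^^ Suc n) g + of_nat n * (pderiv ^^ Suc (n - 1)) g"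
    by (simp add: Suc.IH pderiv_add pderiv_mult d)
  also have "of_nat n * (pderiv ^^ Suc (n - 1)) g = of_nat n * (pderiv ^^ n) g"
    by (cases n) simp_all
  finally show ?case by (simp add: algebra_simps)
qed simp

lemma term_act_add: "term_act s n (g + h) = term_act s n g + term_act s n h"
proof (induction s arbitrary: n g h)
  case (NProd m s t)
  then show ?case by (simp add: diff_prod_add)
qed (simp_all add: funpow_pderiv_add distrib_left smult_add_right)

lemma term_act_smult: "term_act s n (Polynomial.smult c g) = Polynomial.smult c (term_act s n g)"
proof (induction s arbitrary: n g)
  case (NProd m s t)
  then show ?case
    by (simp add: diff_prod_map[of "Polynomial.smult c"] smult_diff_right)
qed (simp_all add: funpow_pderiv_smult smult_add_right mult.commute)

lemma term_act_diff: "term_act s n (g - h) = term_act s n g - term_act s n h"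
  using term_act_add[of s n "g - h" h] by simp

lemma term_act_0: "term_act s n 0 = 0"
  using term_act_add[of s n 0 0] by simp

lemma of_nat_scal: "scal (of_nat c) g = of_nat c * g"
  by (simp add: of_nat_poly)

lemma funpow_pderiv_term_act_Gen:
  "(pderiv ^^ p) (term_act Gen q g) = var_x * (pderiv ^^ (p + q)) g + of_nat p * (pderiv ^^ (p + q - 1)) g
      + of_nat q * (var_t * (pderiv ^^ (p + q - 1)) g)"
proof -
  have n: "(pderiv ^^ p) (of_nat c * h) = of_nat c * (pderiv ^^ p) h" for c and h :: "'a density"
    using funpow_pderiv_smult[of p "of_nat c" h] by (simp add: of_nat_poly)
  have t: "(pderiv ^^ p) (var_t * h) = var_t * (pderiv ^^ p) h" for h :: "'a density"
    using funpow_pderiv_smult[of p "[:0, 1:]" h] by (simp add: var_t_def)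
  have pq: "of_nat p * (pderiv ^^ (p - 1)) ((pderiv ^^ q) g) = of_nat p * (pderiv ^^ (p + q - 1)) g"
    by (cases p) (simp_all add: funpow_add)
  have qp: "of_nat q * (var_t * (pderiv ^^ p) ((pderiv ^^ (q - 1)) g)) = of_nat q * (var_t * (pderiv ^^ (p + q - 1)) g)"
    by (cases q) (simp_all add: funpow_add funpow_swap1)
  have "(pderiv ^^ p) (term_act Gen q g) = var_x * (pderiv ^^ (p + q)) g
      + of_nat p * (pderiv ^^ (p - 1)) ((pderiv ^^ q) g)
      + of_nat q * (var_t * (pderiv ^^ p) ((pderiv ^^ (q - 1)) g))"
    unfolding term_act.simps(1) funpow_pderiv_add funpow_pderiv_var_x n t by (simp add: funpow_add)
  then show ?thesis unfolding pq qp .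
qed

lemma term_act_Gen_Gen:
  "term_act Gen p (term_act Gen q g) =
    var_x * var_x * (pderiv ^^ (p + q)) g + (of_nat p + of_nat (p + q) * var_t) * var_x * (pderiv ^^ (p + q - 1)) g
     + (var_t * (of_nat p * of_nat p - of_nat p) + var_t * var_t * of_nat p * of_nat q) * (pderiv ^^ (p + q - 2)) g"
  unfolding term_act.simps(1)[of p "term_act Gen q g"] funpow_pderiv_term_act_Gen[of p]
    funpow_pderiv_term_act_Gen[of "p - 1"]
  by (cases p) (simp_all add: algebra_simps del: term_act.simps)

lemma term_act_Gen_Gen_diff:
  "term_act Gen (Suc p) (term_act Gen q g) - term_act Gen p (term_act Gen (Suc q) g) =
    var_x * (pderiv ^^ (p + q)) g + (2 * of_nat p * var_t + (of_nat q - of_nat p) * var_t * var_t) * (pderiv ^^ (p + q - 1)) g"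
  unfolding term_act_Gen_Gen by (simp add: algebra_simps)

text \<open>The second difference depends on \<open>p + q\<close> only, so the third one vanishes: the generator is local
  of order three with itself.\<close>

lemma term_act_Gen_Gen_diff2:
  "diff_prod (Suc (Suc m)) (\<lambda>p q. term_act Gen p (term_act Gen q g)) n =
    diff_prod m (\<lambda>p q. (2 * var_t - 2 * var_t * var_t) * (pderiv ^^ (p + q)) g) n"
  unfolding diff_prod.simps term_act_Gen_Gen_diff by (simp add: algebra_simps)

lemma scal_minus_of_nat: "scal (- of_nat c) g = - (of_nat c * g)"
proof -
  have "[:- of_nat c:] = - [:of_nat c :: 'a:]" by simp
  then show ?thesis unfolding of_nat_scal[symmetric] by (simp only: smult_minus_left)
qed

text \<open>The axioms for \<open>n\<close>-products reduce to the identities for \<open>diff_prod\<close>, and the defining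
  relations to the two differences just computed; hence the action descends to \<open>U(3)\<close>.\<close>

lemma term_act_cong:
  assumes "s \<approx> t"
  shows "term_act s = term_act t"
  using assms
proof induction
  case (NProd_NProd m s n t u)
  let ?T = "\<lambda>j. Scale (of_nat (m choose j)) (NProd (n + j) (NProd (m - j) s t) u)"
  have sum: "term_act (foldr Add (map ?T js) Zero) k g = (\<Sum>j\<leftarrow>js. term_act (?T j) k g)" for js k g
    by (induction js) simp_all
  show ?case
  proof (intro ext)
    fix k g
    have "term_act (NProd m s (NProd n t u)) k g = (\<Sum>j\<le>m. term_act (?T j) k g)"
      using diff_prod_assoc[of m n "\<lambda>p q r. term_act s p (term_act t q (term_act u r g))" k]
      by (simp add: diff_prod_map[of "term_act s _"] term_act_diff of_nat_scal)
    also have "\<dots> = (\<Sum>j\<in>set [0..<Suc m]. term_act (?T j) k g)"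
      by (intro sum.cong) auto
    also have "\<dots> = term_act (foldr Add (map ?T [0..<Suc m]) Zero) k g"
      unfolding sum by (rule interv_sum_list_conv_sum_set_nat[symmetric])
    finally show "term_act (NProd m s (NProd n t u)) k g = term_act (foldr Add (map ?T [0..<Suc m]) Zero) k g" .
  qed
next
  case (NProd_Der_left n s t)
  show ?case
  proof (intro ext)
    fix k g
    show "term_act (NProd n (Der s) t) k g = term_act (Scale (- of_nat n) (NProd (n - 1) s t)) k g"
      using diff_prod_der_left[of n "\<lambda>p q. term_act s p (term_act t q g)" k]
      by (simp only: term_act.simps diff_prod_uminus scal_minus_of_nat)
  qed
next
  case (NProd_Der_right n s t)
  show ?case
  proof (intro ext)
    fix k g
    have "term_act s p (- (of_nat q * h)) = - (of_nat q * term_act s p h)" for p q h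
      using term_act_smult[of s p "of_nat q" h] term_act_diff[of s p 0 "of_nat q * h"]
      by (simp add: term_act_0 of_nat_poly)
    then show "term_act (NProd n s (Der t)) k g =
        term_act (Add (Der (NProd n s t)) (Scale (of_nat n) (NProd (n - 1) s t))) k g"
      using diff_prod_der_right[of n "\<lambda>p q. term_act s p (term_act t q g)" k]
      by (simp only: term_act.simps diff_prod_uminus of_nat_scal) simp
  qed
next
  case (Gen_locality n)
  define m where "m = n - 3"
  have n: "n = Suc (Suc (Suc m))" using Gen_locality by (simp add: m_def)
  show ?case
  proof (intro ext)
    fix k g
    show "term_act (NProd n Gen Gen) k g = term_act Zero k g"
      unfolding n term_act.simps(6) term_act_Gen_Gen_diff2 using diff_prod_zero[of 0 "\<lambda>_ _. 0" k m] by simp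
  qed
next
  case Gen_Virasoro
  show ?case
  proof (intro ext)
    fix k :: nat and g :: "'a density"
    have "diff_prod 1 (\<lambda>p q. term_act Gen p (term_act Gen q g)) k =
        var_x * (pderiv ^^ k) g + of_nat k * var_t * var_t * (pderiv ^^ (k - 1)) g"
      using term_act_Gen_Gen_diff[of 0 k g] by simp
    moreover have "diff_prod 2 (\<lambda>p q. term_act Gen p (term_act Gen q g)) (k - 1) =
        (2 * var_t - 2 * var_t * var_t) * (pderiv ^^ (k - 1)) g"
      using term_act_Gen_Gen_diff2[of 0 g "k - 1"] by (simp add: numeral_2_eq_2)
    moreover have "scal 2 h = 2 * h" for h :: "'a density"
      by (metis of_nat_numeral of_nat_scal)
    ultimately show "term_act (Add (Scale 2 (NProd 1 Gen Gen)) (Scale (- 1) (Der (NProd 2 Gen Gen)))) k g =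
        term_act (Scale 2 Gen) k g"
      unfolding term_act.simps by (simp only: scal_minus_1) (simp add: algebra_simps)
  qed
next
  case (NProd_Add_left n s t u)
  show ?case by (intro ext) (simp add: diff_prod_add)
next
  case (NProd_Add_right n s t u)
  show ?case by (intro ext) (simp add: term_act_add diff_prod_add)
next
  case (NProd_Scale_left n r s t)
  show ?case by (intro ext) (simp add: diff_prod_map[of "scal r"] smult_diff_right)
next
  case (NProd_Scale_right n s r t)
  show ?case by (intro ext) (simp add: diff_prod_map[of "scal r"] smult_diff_right term_act_smult)
next
  case (Scale_Scale r q s)
  show ?case by (intro ext) (simp add: mult.commute[of q r])
next
  case (Der_Scale r s)
  show ?case by (intro ext) simp
qed (simp_all add: fun_eq_iff scal_add smult_add_right add_ac distrib_left)

definition act :: "'k::field_char_0 U3 \<Rightarrow> nat \<Rightarrow> 'k density \<Rightarrow> 'k density" where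
  "act a = term_act (rep_U3 a)"

lemma act_abs_U3: "act (abs_U3 s) = term_act s"
  unfolding act_def
  by (rule term_act_cong) (simp add: U3.abs_eq_iff[symmetric] Quotient3_abs_rep[OF Quotient3_U3])

lemma act_simps:
  "act U3_gen n g = var_x * (pderiv ^^ n) g + of_nat n * (var_t * (pderiv ^^ (n - 1)) g)"
  "act (a + b) n g = act a n g + act b n g"
  "act (U3_scale r a) n g = scal r (act a n g)"
  "act (U3_der a) n g = - (of_nat n * act a (n - 1) g)"
  "act (U3_nprod m a b) n g = diff_prod m (\<lambda>p q. act a p (act b q g)) n"
proof -
  obtain s t where a: "a = abs_U3 s" and b: "b = abs_U3 t" by (metis abs_U3_surj)
  show "act U3_gen n g = var_x * (pderiv ^^ n) g + of_nat n * (var_t * (pderiv ^^ (n - 1)) g)"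
    unfolding U3_gen_def act_abs_U3 by (rule term_act.simps)
  show "act (a + b) n g = act a n g + act b n g"
    unfolding a b plus_U3.abs_eq act_abs_U3 by (rule term_act.simps)
  show "act (U3_scale r a) n g = scal r (act a n g)"
    unfolding a U3_scale.abs_eq act_abs_U3 by (rule term_act.simps)
  show "act (U3_der a) n g = - (of_nat n * act a (n - 1) g)"
    unfolding a U3_der.abs_eq act_abs_U3 by (rule term_act.simps)
  show "act (U3_nprod m a b) n g = diff_prod m (\<lambda>p q. act a p (act b q g)) n"
    unfolding a b U3_nprod.abs_eq act_abs_U3 by (rule term_act.simps)
qed

lemma act_density_add: "act a n (g + h) = act a n g + act a n h"
  by (simp add: act_def term_act_add)

lemma act_density_smult: "act a n (Polynomial.smult c g) = Polynomial.smult c (act a n g)"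
  by (simp add: act_def term_act_smult)

lemma act_density_0 [simp]: "act a n 0 = 0"
  by (simp add: act_def term_act_0)

lemma act_zero [simp]: "act 0 n g = 0"
  using act_simps(2)[of 0 0 n g] by simp

lemma funpow_pderiv_eventually_zero:
  fixes g :: "'k::field_char_0 density"
  assumes "degree g < n"
  shows "(pderiv ^^ n) g = 0"
proof (cases "g = 0")
  case True
  then show ?thesis using funpow_pderiv_add[of n 0 0] by simp
next
  case False
  have "(pderiv ^^ n) g = 0 \<or> degree ((pderiv ^^ n) g) + n \<le> degree g" for n
  proof (induction n)
    case (Suc n)
    then show ?case
      by (cases "degree ((pderiv ^^ n) g) = 0") (auto simp: pderiv_eq_0_iff degree_pderiv)
  qed simp
  with assms show ?thesis by (meson leD le_add2 le_trans)
qed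

lemma act_locality: "\<exists>N. \<forall>n\<ge>N. act a n g = 0"
proof -
  have shift: "\<exists>N. \<forall>n\<ge>N. P n \<and> P (n - 1)" if "\<exists>N. \<forall>n\<ge>N. P n" for P :: "nat \<Rightarrow> bool"
  proof -
    from that obtain N where "\<forall>n\<ge>N. P n" by blast
    then have "\<forall>n\<ge>Suc N. P n \<and> P (n - 1)" by auto
    then show ?thesis by blast
  qed
  show ?thesis
  proof (induction a rule: U3_induct)
    case gen
    have "\<exists>N. \<forall>n\<ge>N. (pderiv ^^ n) g = 0"
      using funpow_pderiv_eventually_zero[of g] by (meson Suc_le_eq)
    from shift[OF this] obtain N
      where "\<forall>n\<ge>N. (pderiv ^^ n) g = 0 \<and> (pderiv ^^ (n - 1)) g = 0" by blast
    then show ?case by (intro exI[of _ N]) (simp add: act_simps)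
  next
    case (add a b)
    then obtain N1 N2 where "\<forall>n\<ge>N1. act a n g = 0" "\<forall>n\<ge>N2. act b n g = 0" by blast
    then show ?case by (intro exI[of _ "max N1 N2"]) (simp add: act_simps)
  next
    case (scale r a)
    then show ?case by (auto simp: act_simps)
  next
    case (der a)
    from shift[OF this] show ?case by (auto simp: act_simps)
  next
    case (nprod m a b)
    then obtain N where N: "\<forall>n\<ge>N. act b n g = 0" by blast
    have "act (U3_nprod m a b) n g = 0" if "N \<le> n" for n
      unfolding act_simps by (rule diff_prod_zero[OF _ that]) (simp add: N)
    then show ?case by blast
  qed simp
qed

lemma eventually_zero_act: "eventually_zero (\<lambda>n. act a n g)"
  using act_locality unfolding eventually_zero_def .

definition act_at :: "'k::field_char_0 \<Rightarrow> 'k U3 \<Rightarrow> 'k density \<Rightarrow> 'k density" where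
  "act_at x a g = exp_sum scal x (\<lambda>n. act a n g)"

lemma act_at_linear:
  "act_at x (a + b) g = act_at x a g + act_at x b g"
  "act_at x (U3_scale r a) g = scal r (act_at x a g)"
  "act_at x (U3_der a) g = - scal x (act_at x a g)"
proof -
  show "act_at x (a + b) g = act_at x a g + act_at x b g"
    unfolding act_at_def act_simps by (rule exp_sum_add[OF scal_vector_space]) (rule eventually_zero_act)+
  show scale: "act_at x (U3_scale r a) g = scal r (act_at x a g)" for r a
    unfolding act_at_def act_simps by (rule exp_sum_scale[OF scal_vector_space eventually_zero_act])
  have "act_at x (U3_der a) g = exp_sum scal x (\<lambda>n. scal (of_nat n) (act (U3_scale (- 1) a) (n - 1) g))"
    unfolding act_at_def act_simps by (simp add: of_nat_poly)
  also have "\<dots> = scal x (act_at x (U3_scale (- 1) a) g)"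
    unfolding act_at_def by (rule exp_sum_shift[OF scal_vector_space eventually_zero_act])
  also have "\<dots> = - scal x (act_at x a g)" unfolding scale by simp
  finally show "act_at x (U3_der a) g = - scal x (act_at x a g)" .
qed

lemma act_at_density_linear:
  "act_at x a (g + h) = act_at x a g + act_at x a h"
  "act_at x a (Polynomial.smult c g) = Polynomial.smult c (act_at x a g)"
proof -
  show "act_at x a (g + h) = act_at x a g + act_at x a h"
    unfolding act_at_def act_density_add by (rule exp_sum_add[OF scal_vector_space]) (rule eventually_zero_act)+
  show "act_at x a (Polynomial.smult c g) = Polynomial.smult c (act_at x a g)"
    unfolding act_at_def act_density_smult
    by (rule exp_sum_linear[OF scal_vector_space eventually_zero_act _ _ scal_vector_space, symmetric])
      (simp_all add: smult_add_right mult.commute)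
qed

lemma act_at_lprod_at: "act_at (x + y) (lprod_at x a b) g = act_at x a (act_at y b g)"
proof -
  obtain N1 where N1: "\<forall>n\<ge>N1. U3_nprod n a b = 0" using U3_locality by blast
  obtain N2 where N2: "\<forall>n\<ge>N2. act b n g = 0" using act_locality by blast
  let ?M = "max N1 N2"
  have "act_at x a (act_at y b g) = exp_sum scal x (\<lambda>m. exp_sum scal y (\<lambda>n. act a m (act b n g)))"
    unfolding act_at_def
    by (subst exp_sum_linear[OF scal_vector_space eventually_zero_act _ _ scal_vector_space])
      (simp_all add: act_density_add act_density_smult)
  also have "\<dots> = exp_sum scal (x + y) (\<lambda>k. exp_sum scal x (\<lambda>i. act (U3_nprod i a b) k g))"
  proof (rule exp_sum_binomial[OF scal_vector_space, where M = ?M])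
    fix m n
    show "act a m (act b n g) = (\<Sum>j\<le>m. scal (of_nat (m choose j)) (act (U3_nprod (m - j) a b) (n + j) g))"
      unfolding of_nat_scal act_simps by (rule diff_prod_inverse)
  next
    fix i k assume "?M \<le> i \<or> ?M \<le> k"
    then consider "N1 \<le> i" | "N2 \<le> k" by auto
    then show "act (U3_nprod i a b) k g = 0"
    proof cases
      case 1
      then show ?thesis using N1 by simp
    next
      case 2
      then show ?thesis
        unfolding act_simps(5) by (intro diff_prod_zero[of N2]) (simp_all add: N2)
    qed
  qed
  also have "\<dots> = act_at (x + y) (lprod_at x a b) g"
    unfolding act_at_def lprod_at_def
    by (subst exp_sum_linear[OF U3_vector_space eventually_zero_nprod _ _ scal_vector_space, of "\<lambda>u. act u _ g"])
      (simp_all add: act_simps)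
  finally show ?thesis by simp
qed

lemma act_at_gen: "act_at x U3_gen 1 = var_x + scal x var_t"
proof -
  have p: "(pderiv ^^ n) (1 :: 'a density) = 0" if "0 < n" for n
    using that funpow_pderiv_eventually_zero[of "1 :: 'a density" n] by simp
  have "\<forall>n\<ge>2. act U3_gen n (1 :: 'a density) = 0"
    unfolding act_simps using p by simp
  then have "act_at x U3_gen 1 = (\<Sum>n<2. scal (x ^ n / fact n) (act U3_gen n 1))"
    unfolding act_at_def by (rule exp_sum_eq[OF scal_vector_space])
  then show ?thesis by (simp add: numeral_2_eq_2 act_simps p flip: one_pCons)
qed

text \<open>On the generator this is the commutator of \<open>D\<^sup>n\<close> and \<open>x\<close>.  The class of elements with this
  property is closed under products because the shifts of \<open>x\<close> add up.\<close>

lemma act_at_var_x: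
  fixes x :: "'k::field_char_0"
  shows "act_at x a (var_x * g) = (var_x + [:[:x:]:]) * act_at x a g"
proof -
  let ?S = "{a :: 'k U3. \<forall>x g. act_at x a (var_x * g) = (var_x + [:[:x:]:]) * act_at x a g}"
  have "a \<in> ?S"
  proof (rule U3_at_induct)
    show "U3.subspace ?S"
      unfolding U3.subspace_def using act_at_linear(2)[of _ 0 "0 :: 'k U3"]
      by (auto simp: act_at_linear distrib_left distrib_right smult_add_right mult.commute)
    show "U3_gen \<in> ?S"
      unfolding mem_Collect_eq
    proof (intro allI)
      fix x :: 'k and g :: "'k density"
      have "act U3_gen n (var_x * g) = var_x * act U3_gen n g + scal (of_nat n) (act U3_gen (n - 1) g)" for n
        unfolding act_simps funpow_pderiv_var_x of_nat_scal
        by (cases n) (simp_all add: algebra_simps)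
      then have "act_at x U3_gen (var_x * g) = exp_sum scal x (\<lambda>n. var_x * act U3_gen n g + scal (of_nat n) (act U3_gen (n - 1) g))"
        by (simp add: act_at_def)
      also have "\<dots> = exp_sum scal x (\<lambda>n. var_x * act U3_gen n g) + exp_sum scal x (\<lambda>n. scal (of_nat n) (act U3_gen (n - 1) g))"
      proof (rule exp_sum_add[OF scal_vector_space])
        obtain N where N: "\<forall>n\<ge>N. act U3_gen n g = 0" using act_locality by blast
        then show "eventually_zero (\<lambda>n. var_x * act U3_gen n g)" unfolding eventually_zero_def by auto
        have "\<forall>n\<ge>Suc N. scal (of_nat n) (act U3_gen (n - 1) g) = 0" using N by auto
        then show "eventually_zero (\<lambda>n. scal (of_nat n) (act U3_gen (n - 1) g))"
          unfolding eventually_zero_def by blast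
      qed
      also have "\<dots> = var_x * act_at x U3_gen g + scal x (act_at x U3_gen g)"
        unfolding act_at_def exp_sum_shift[OF scal_vector_space eventually_zero_act]
        by (subst exp_sum_linear[OF scal_vector_space eventually_zero_act _ _ scal_vector_space, of "(*) var_x", symmetric])
          (simp_all add: algebra_simps)
      finally show "act_at x U3_gen (var_x * g) = (var_x + [:[:x:]:]) * act_at x U3_gen g"
        by (simp add: algebra_simps)
    qed
    fix a b :: "'k U3" and z
    assume a: "a \<in> ?S"
    then show "U3_der a \<in> ?S"
      by (auto simp: act_at_linear distrib_right smult_add_right)
    assume b: "b \<in> ?S"
    show "lprod_at z a b \<in> ?S"
      unfolding mem_Collect_eq
    proof (intro allI)
      fix x g
      have "act_at x (lprod_at z a b) h = act_at z a (act_at (x - z) b h)" for h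
        using act_at_lprod_at[of z "x - z" a b h] by simp
      moreover have "act_at z a ([:[:x - z:]:] * h) = [:[:x - z:]:] * act_at z a h" for h
        using act_at_density_linear(2)[of z a "[:x - z:]" h] by simp
      moreover have "[:[:x:]:] = [:[:z:]:] + [:[:x - z:]:]" by simp
      ultimately show "act_at x (lprod_at z a b) (var_x * g) = (var_x + [:[:x:]:]) * act_at x (lprod_at z a b) g"
        using a b by (simp only: mem_Collect_eq distrib_right act_at_density_linear(1)) (simp add: algebra_simps)
    qed
  qed
  then show ?thesis by blast
qed

text \<open>By the previous lemma the operator of \<open>a\<close> is determined by its value at 1, its symbol.\<close>

definition symbol :: "'k::field_char_0 \<Rightarrow> 'k U3 \<Rightarrow> 'k density" where
  "symbol x a = act_at x a 1"

lemma act_at_symbol: "act_at x a g = symbol x a * pcompose g [:[:x:], 1:]"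
proof (induction g rule: pCons_induct)
  case 0
  then show ?case using act_at_density_linear(2)[of x a 0 0] by simp
next
  case (pCons c g)
  have "pCons c g = Polynomial.smult c 1 + var_x * g" by (simp add: var_x_def one_pCons)
  then show ?case
    using pCons.IH
    by (simp only: act_at_density_linear act_at_var_x)
      (simp add: symbol_def pcompose_add pcompose_mult pcompose_smult pcompose_pCons var_x_def algebra_simps)
qed

lemma symbol_linear:
  "symbol x (a + b) = symbol x a + symbol x b"
  "symbol x (U3_scale r a) = scal r (symbol x a)"
  "symbol x (U3_der a) = - scal x (symbol x a)"
  by (simp_all add: symbol_def act_at_linear)

lemma symbol_lprod_at:
  "symbol (x + y) (lprod_at x a b) = symbol x a * pcompose (symbol y b) [:[:x:], 1:]"
  using act_at_symbol[of x a "symbol y b"] act_at_lprod_at[of x y a b 1] by (simp add: symbol_def)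

lemma symbol_gen: "symbol x U3_gen = [:[:0, x:], 1:]"
  by (simp add: symbol_def act_at_gen var_x_def var_t_def)

lemma symbol_left_gen: "symbol x (left_gen a) = pCons 0 (symbol x a)"
  using symbol_lprod_at[of 0 x U3_gen a] by (simp add: left_gen_lprod_at symbol_gen pcompose_idR)

lemma symbol_diff: "symbol x (a - b) = symbol x a - symbol x b"
  using symbol_linear(1)[of x "a - b" b] by simp

text \<open>For \<open>e\<^sub>0\<close> the symbol of \<open>v\<^sub>yv\<close> at \<open>\<lambda> = x\<close> is computed in two ways; \<open>\<partial>\<close> acts as \<open>- x\<close>, so the
  unknown symbol of \<open>y(\<partial> + y)e\<close> appears with the factor \<open>y(y - x)\<close>.\<close>

lemma symbol_quad: "symbol x (quad j) = [:[:0, 1:] ^ Suc j - [:0, 1:] ^ Suc (Suc j):]"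
proof (induction j arbitrary: x)
  case 0
  \<comment> \<open>Any y with y (y - x) nonzero would do.\<close>
  define y where "y = (if x = - 1 then 1 else x + 1)"
  have y: "y * y - x * y \<noteq> 0" by (auto simp: y_def algebra_simps add_eq_0_iff)
  have diff: "a - b = q - p" if "a + p = b + q" for a b p q :: "'a density"
  proof -
    have "a - b = (a + p) - (b + p)" by simp
    then show ?thesis unfolding that by simp
  qed
  have "symbol (y + (x - y)) (lprod_at y U3_gen U3_gen) =
      symbol y U3_gen * pcompose (symbol (x - y) U3_gen) [:[:y:], 1:]" by (rule symbol_lprod_at)
  then have "scal (y * y) (symbol x quad_gen) + [:[:0, x * y:], [:y, x:], 1:] =
      scal (x * y) (symbol x quad_gen) + [:[:0, y * y, x * y - y * y:], [:y, x:], 1:]"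
    by (simp add: lprod_at_gen_gen symbol_linear symbol_left_gen symbol_gen pcompose_pCons
        power2_eq_square algebra_simps)
  then have "scal (y * y) (symbol x quad_gen) - scal (x * y) (symbol x quad_gen) =
      [:[:0, y * y, x * y - y * y:], [:y, x:], 1:] - [:[:0, x * y:], [:y, x:], 1:]"
    by (rule diff)
  then have "scal (y * y - x * y) (symbol x quad_gen) = scal (y * y - x * y) [:[:0, 1, - 1:]:]"
    by (simp add: algebra_simps flip: smult_diff_left)
  then have "scal (1 / (y * y - x * y)) (scal (y * y - x * y) (symbol x quad_gen)) =
      scal (1 / (y * y - x * y)) (scal (y * y - x * y) [:[:0, 1, - 1:]:])" by (rule arg_cong)
  moreover have "(x * y - y * y) / (y * y - x * y) = - 1" using y by (simp add: divide_eq_eq)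
  ultimately show ?case using y by simp
next
  case (Suc j)
  show ?case
    using symbol_lprod_at[of 1 "x - 1" U3_gen "quad j"]
    by (simp add: symbol_diff symbol_left_gen symbol_gen Suc.IH)
qed

section \<open>Freeness over the polynomials in the derivation\<close>

text \<open>Nested, this describes the linear forms on \<open>k[t][x]\<close>.\<close>

definition pairing :: "(nat \<Rightarrow> 'c::zero \<Rightarrow> 'k::comm_ring_1) \<Rightarrow> 'c poly \<Rightarrow> 'k" where
  "pairing c p = (\<Sum>i\<le>degree p. c i (coeff p i))"

lemma pairing_eq:
  assumes "\<And>i. c i 0 = 0" "degree p \<le> N"
  shows "pairing c p = (\<Sum>i\<le>N. c i (coeff p i))"
  unfolding pairing_def using assms
  by (intro sum.mono_neutral_left) (auto simp: coeff_eq_0)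

lemma pairing_add:
  fixes p q :: "'c::comm_monoid_add poly"
  assumes "\<And>i a b. c i (a + b) = c i a + c i b"
  shows "pairing c (p + q) = pairing c p + pairing c q"
proof -
  have c0: "c i 0 = 0" for i using assms[of i 0 0] by simp
  let ?N = "max (degree p) (degree q)"
  have "pairing c p = (\<Sum>i\<le>?N. c i (coeff p i))" "pairing c q = (\<Sum>i\<le>?N. c i (coeff q i))"
    "pairing c (p + q) = (\<Sum>i\<le>?N. c i (coeff (p + q) i))"
    by (rule pairing_eq; simp add: c0 degree_add_le_max)+
  then show ?thesis by (simp add: assms sum.distrib)
qed

lemma pairing_scale:
  assumes "\<And>i. c i 0 = 0" "\<And>i a. c i (r * a) = s * c i a"
  shows "pairing c (Polynomial.smult r p) = s * pairing c p"
proof -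
  have "pairing c (Polynomial.smult r p) = (\<Sum>i\<le>degree p. c i (coeff (Polynomial.smult r p) i))"
    by (rule pairing_eq) (simp_all add: assms degree_smult_le)
  then show ?thesis by (simp add: pairing_def assms sum_distrib_left)
qed

lemma pairing_monom:
  assumes "\<And>i. c i 0 = 0"
  shows "pairing c (monom a n) = c n a"
proof -
  have "pairing c (monom a n) = (\<Sum>i\<le>n. c i (coeff (monom a n) i))"
    by (rule pairing_eq) (simp_all add: assms degree_monom_le)
  also have "\<dots> = (\<Sum>i\<le>n. if i = n then c n a else 0)" by (intro sum.cong) (simp_all add: assms)
  finally show ?thesis by simp
qed

text \<open>Freeness of \<open>U(3)\<close> over \<open>k[\<partial>]\<close> with basis \<open>L\<^sup>kv\<close> and \<open>L\<^sup>ke\<^sub>j\<close>, phrased as the existence of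
  functionals: a linear form on symbols at \<open>\<lambda> = - m\<close> turns \<open>\<partial>\<close> into multiplication by \<open>m\<close>, and
  the symbols of the basis elements at a fixed \<open>\<lambda>\<close> are linearly independent.\<close>

theorem U3_free:
  fixes m :: "'k::field_char_0"
  obtains l where "functional l" "\<And>a. l (U3_der a) = m * l a"
    "\<And>k. l ((left_gen ^^ k) U3_gen) = g k" "\<And>k j. l ((left_gen ^^ k) (quad j)) = h k j"
proof -
  \<comment> \<open>The symbols are X^(k+1) - m t X^k for L^k v and (t^(j+1) - t^(j+2)) X^k for L^k e_j, and F k j is the
    value of the linear form on t^j X^k.  The value 0 for j = 1 frees the first from the term in t, and
    the second condition is solved by telescoping.\<close>
  define F where "F k j = (case j of 0 \<Rightarrow> (case k of 0 \<Rightarrow> 0 | Suc k \<Rightarrow> g k) | Suc j \<Rightarrow> - (\<Sum>i<j. h k i))" for k j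
  let ?c = "\<lambda>k j (a :: 'k). F k j * a"
  let ?P = "pairing (\<lambda>k. pairing (?c k))"
  have c: "pairing (?c k) (p + q) = pairing (?c k) p + pairing (?c k) q" for k and p q :: "'k poly"
    by (rule pairing_add) (simp add: algebra_simps)
  have c0: "pairing (?c k) 0 = 0" for k using c[of k 0 0] by simp
  have P: "?P (p + q) = ?P p + ?P q" for p q :: "'k density"
    by (rule pairing_add) (rule c)
  have Pm: "?P (p - q) = ?P p - ?P q" for p q :: "'k density"
    using P[of "p - q" q] by simp
  have Ps: "?P (scal r p) = r * ?P p" for r and p :: "'k density"
    by (rule pairing_scale) (simp_all add: c0 pairing_scale[of "?c _" r r])
  have mon: "?P (monom (monom a j) k) = F k j * a" for a j k
    by (simp add: pairing_monom c0)
  define l where "l a = ?P (symbol (- m) a)" for a :: "'k U3"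
  have L: "symbol x ((left_gen ^^ k) a) = monom 1 k * symbol x a" for x a and k
  proof (induction k)
    case (Suc k)
    have "pCons 0 (monom 1 k * symbol x a) = monom 1 (Suc k) * symbol x a"
      unfolding monom_Suc by simp
    then show ?case using Suc by (simp add: symbol_left_gen)
  qed (simp add: monom_0 one_pCons[symmetric])
  show ?thesis
  proof
    show "functional l" unfolding functional_def l_def by (simp add: symbol_linear P Ps)
    show "l (U3_der a) = m * l a" for a
      using Pm[of 0 "scal (- m) (symbol (- m) a)"] Ps[of "- m" "symbol (- m) a"] Pm[of 0 0]
      unfolding l_def symbol_linear by simp
    show "l ((left_gen ^^ k) U3_gen) = g k" for k
    proof -
      have "symbol (- m) ((left_gen ^^ k) U3_gen) = monom (monom 1 0) (Suc k) + monom (monom (- m) 1) k"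
        unfolding L symbol_gen
        by (simp add: monom_Suc monom_0 mult.commute[of "monom 1 k"] smult_monom add.commute flip: one_pCons)
      then show ?thesis by (simp only: l_def P mon) (simp add: F_def)
    qed
    show "l ((left_gen ^^ k) (quad j)) = h k j" for k j
    proof -
      have e: "[:0, 1:] ^ n = monom (1 :: 'k) n" for n by (simp add: monom_altdef)
      have "symbol (- m) ((left_gen ^^ k) (quad j)) =
          monom (monom 1 (Suc j)) k - monom (monom 1 (Suc (Suc j))) k"
        unfolding L symbol_quad e by (simp only: mult.commute[of "monom 1 k"]) (simp add: smult_monom diff_monom)
      then show ?thesis by (simp only: l_def Pm mon) (simp add: F_def)
    qed
  qed
qed

section \<open>Polynomial functions\<close>

definition polyfun :: "('k::field_char_0 \<Rightarrow> 'k) \<Rightarrow> bool" where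
  "polyfun f \<longleftrightarrow> (\<exists>p. \<forall>x. f x = poly p x)"

text \<open>The inner variable of \<open>P\<close> is the first argument, the outer one the second.\<close>

definition polyfun2 :: "('k::field_char_0 \<Rightarrow> 'k \<Rightarrow> 'k) \<Rightarrow> bool" where
  "polyfun2 f \<longleftrightarrow> (\<exists>P. \<forall>x y. f x y = poly (poly P [:y:]) x)"

lemma polyfun_const: "polyfun (\<lambda>x. c)"
  unfolding polyfun_def by (intro exI[of _ "[:c:]"]) simp

lemma polyfun_id: "polyfun (\<lambda>x. x)"
  unfolding polyfun_def by (intro exI[of _ "[:0, 1:]"]) simp

lemma polyfun_add: "polyfun f \<Longrightarrow> polyfun g \<Longrightarrow> polyfun (\<lambda>x. f x + g x)"
  unfolding polyfun_def
proof (elim exE)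
  fix p q
  assume "\<forall>x. f x = poly p x" "\<forall>x. g x = poly q x"
  then show "\<exists>p. \<forall>x. f x + g x = poly p x"
    by (intro exI[of _ "p + q"]) simp
qed

lemma polyfun_diff: "polyfun f \<Longrightarrow> polyfun g \<Longrightarrow> polyfun (\<lambda>x. f x - g x)"
  unfolding polyfun_def
proof (elim exE)
  fix p q
  assume "\<forall>x. f x = poly p x" "\<forall>x. g x = poly q x"
  then show "\<exists>p. \<forall>x. f x - g x = poly p x"
    by (intro exI[of _ "p - q"]) simp
qed

lemma polyfun_mult: "polyfun f \<Longrightarrow> polyfun g \<Longrightarrow> polyfun (\<lambda>x. f x * g x)"
  unfolding polyfun_def
proof (elim exE)
  fix p q
  assume "\<forall>x. f x = poly p x" "\<forall>x. g x = poly q x"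
  then show "\<exists>p. \<forall>x. f x * g x = poly p x"
    by (intro exI[of _ "p * q"]) simp
qed

lemma polyfun_uminus: "polyfun f \<Longrightarrow> polyfun (\<lambda>x. - f x)"
  using polyfun_diff[OF polyfun_const[of 0], of f] by simp

lemma polyfun_power: "polyfun f \<Longrightarrow> polyfun (\<lambda>x. f x ^ n)"
  by (induction n) (simp_all add: polyfun_const polyfun_mult)

lemma polyfun_divide: "polyfun f \<Longrightarrow> polyfun (\<lambda>x. f x / c)"
  using polyfun_mult[of f "\<lambda>_. inverse c"] by (simp add: polyfun_const field_simps)

lemma polyfun_sum: "(\<And>i. i \<in> I \<Longrightarrow> polyfun (f i)) \<Longrightarrow> polyfun (\<lambda>x. \<Sum>i\<in>I. f i x)"
  by (induction I rule: infinite_finite_induct) (simp_all add: polyfun_const polyfun_add)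

lemma polyfun2_const: "polyfun2 (\<lambda>x y. c)"
  unfolding polyfun2_def by (intro exI[of _ "[:[:c:]:]"]) simp

lemma polyfun2_fst: "polyfun2 (\<lambda>x y. x)"
  unfolding polyfun2_def by (intro exI[of _ "[:[:0, 1:]:]"]) simp

lemma polyfun2_snd: "polyfun2 (\<lambda>x y. y)"
  unfolding polyfun2_def by (intro exI[of _ "[:0, 1:]"]) simp

lemma polyfun2_add: "polyfun2 f \<Longrightarrow> polyfun2 g \<Longrightarrow> polyfun2 (\<lambda>x y. f x y + g x y)"
  unfolding polyfun2_def
proof (elim exE)
  fix p q
  assume "\<forall>x y. f x y = poly (poly p [:y:]) x" "\<forall>x y. g x y = poly (poly q [:y:]) x"
  then show "\<exists>p. \<forall>x y. f x y + g x y = poly (poly p [:y:]) x"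
    by (intro exI[of _ "p + q"]) simp
qed

lemma polyfun2_diff: "polyfun2 f \<Longrightarrow> polyfun2 g \<Longrightarrow> polyfun2 (\<lambda>x y. f x y - g x y)"
  unfolding polyfun2_def
proof (elim exE)
  fix p q
  assume "\<forall>x y. f x y = poly (poly p [:y:]) x" "\<forall>x y. g x y = poly (poly q [:y:]) x"
  then show "\<exists>p. \<forall>x y. f x y - g x y = poly (poly p [:y:]) x"
    by (intro exI[of _ "p - q"]) simp
qed

lemma polyfun2_mult: "polyfun2 f \<Longrightarrow> polyfun2 g \<Longrightarrow> polyfun2 (\<lambda>x y. f x y * g x y)"
  unfolding polyfun2_def
proof (elim exE)
  fix p q
  assume "\<forall>x y. f x y = poly (poly p [:y:]) x" "\<forall>x y. g x y = poly (poly q [:y:]) x"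
  then show "\<exists>p. \<forall>x y. f x y * g x y = poly (poly p [:y:]) x"
    by (intro exI[of _ "p * q"]) simp
qed

lemma polyfun2_uminus: "polyfun2 f \<Longrightarrow> polyfun2 (\<lambda>x y. - f x y)"
  using polyfun2_diff[OF polyfun2_const[of 0], of f] by simp

lemma polyfun2_power: "polyfun2 f \<Longrightarrow> polyfun2 (\<lambda>x y. f x y ^ n)"
  by (induction n) (simp_all add: polyfun2_const polyfun2_mult)

lemma polyfun2_divide: "polyfun2 f \<Longrightarrow> polyfun2 (\<lambda>x y. f x y / c)"
  using polyfun2_mult[of f "\<lambda>_ _. inverse c"] by (simp add: polyfun2_const field_simps)

lemma polyfun2_sum: "(\<And>i. i \<in> I \<Longrightarrow> polyfun2 (f i)) \<Longrightarrow> polyfun2 (\<lambda>x y. \<Sum>i\<in>I. f i x y)"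
  by (induction I rule: infinite_finite_induct) (simp_all add: polyfun2_const polyfun2_add)

lemma polyfun2_prod: "(\<And>i. i \<in> I \<Longrightarrow> polyfun2 (f i)) \<Longrightarrow> polyfun2 (\<lambda>x y. \<Prod>i\<in>I. f i x y)"
  by (induction I rule: infinite_finite_induct) (simp_all add: polyfun2_const polyfun2_mult)

lemma polyfun_compose:
  assumes "polyfun f" "polyfun g"
  shows "polyfun (\<lambda>x. f (g x))"
proof -
  obtain p where p: "\<forall>x. f x = poly p x" using assms(1) unfolding polyfun_def by blast
  have "polyfun (\<lambda>x. poly p (g x))"
    by (induction p) (simp_all add: polyfun_const polyfun_add polyfun_mult assms(2))
  then show ?thesis using p by simp
qed

lemma polyfun_compose2:
  assumes "polyfun f" "polyfun2 g"
  shows "polyfun2 (\<lambda>x y. f (g x y))"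
proof -
  obtain p where p: "\<forall>x. f x = poly p x" using assms(1) unfolding polyfun_def by blast
  have "polyfun2 (\<lambda>x y. poly p (g x y))"
    by (induction p) (simp_all add: polyfun2_const polyfun2_add polyfun2_mult assms(2))
  then show ?thesis using p by simp
qed

lemma polyfun2_compose:
  assumes "polyfun2 f" "polyfun g" "polyfun h"
  shows "polyfun (\<lambda>z. f (g z) (h z))"
proof -
  obtain P where P: "\<forall>x y. f x y = poly (poly P [:y:]) x" using assms(1) unfolding polyfun2_def by blast
  have "polyfun (\<lambda>z. poly (poly P [:h z:]) (g z))"
  proof (induction P)
    case (pCons a P)
    have "polyfun (\<lambda>z. poly a (g z))"
      by (rule polyfun_compose[OF _ assms(2)]) (auto simp: polyfun_def)
    with pCons show ?case by (simp add: polyfun_add polyfun_mult assms)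
  qed (simp add: polyfun_const)
  then show ?thesis using P by simp
qed

lemma polyfun2_compose2:
  assumes "polyfun2 f" "polyfun2 g" "polyfun2 h"
  shows "polyfun2 (\<lambda>x y. f (g x y) (h x y))"
proof -
  obtain P where P: "\<forall>x y. f x y = poly (poly P [:y:]) x" using assms(1) unfolding polyfun2_def by blast
  have "polyfun2 (\<lambda>x y. poly (poly P [:h x y:]) (g x y))"
  proof (induction P)
    case (pCons a P)
    have "polyfun2 (\<lambda>x y. poly a (g x y))"
      by (rule polyfun_compose2[OF _ assms(2)]) (auto simp: polyfun_def)
    with pCons show ?case by (simp add: polyfun2_add polyfun2_mult assms)
  qed (simp add: polyfun2_const)
  then show ?thesis using P by simp
qed

lemmas polyfun_intros = polyfun_const polyfun_id polyfun_add polyfun_diff polyfun_mult polyfun_uminus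
  polyfun_power polyfun_divide polyfun2_const polyfun2_fst polyfun2_snd polyfun2_add polyfun2_diff
  polyfun2_mult polyfun2_uminus polyfun2_power polyfun2_divide

lemma polyfun2_swap: "polyfun2 f \<Longrightarrow> polyfun2 (\<lambda>x y. f y x)"
  using polyfun2_compose2[of f "\<lambda>x y. y" "\<lambda>x y. x"] by (simp add: polyfun_intros)

lemma polyfun2_polyfun_fst: "polyfun2 f \<Longrightarrow> polyfun (\<lambda>x. f x c)"
  using polyfun2_compose[of f "\<lambda>x. x" "\<lambda>_. c"] by (simp add: polyfun_intros)

lemma polyfun2_polyfun_snd: "polyfun2 f \<Longrightarrow> polyfun (f c)"
  using polyfun2_compose[of f "\<lambda>_. c" "\<lambda>x. x"] by (simp add: polyfun_intros)

lemma polyfun_split: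
  assumes "polyfun f"
  obtains g where "polyfun g" "\<And>x. f x = f 0 + x * g x"
proof -
  obtain p where p: "\<forall>x. f x = poly p x" using assms unfolding polyfun_def by blast
  obtain a q where q: "p = pCons a q" by (rule pCons_cases)
  show ?thesis
    by (rule that[of "poly q"]) (auto simp: polyfun_def p q)
qed

lemma polyfun2_split_snd:
  assumes "polyfun2 f"
  obtains g where "polyfun2 g" "\<And>x y. f x y = f x 0 + y * g x y"
proof -
  obtain P where P: "\<forall>x y. f x y = poly (poly P [:y:]) x" using assms unfolding polyfun2_def by blast
  obtain a Q where Q: "P = pCons a Q" by (rule pCons_cases)
  show ?thesis
    by (rule that[of "\<lambda>x y. poly (poly Q [:y:]) x"]) (auto simp: polyfun2_def P Q)
qed

lemma polyfun2_split_fst: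
  assumes "polyfun2 f"
  obtains g where "polyfun2 g" "\<And>x y. f x y = f 0 y + x * g x y"
proof -
  define h where "h x y = f y x" for x y
  have "polyfun2 h" using polyfun2_swap[OF assms] by (simp add: h_def[abs_def])
  then obtain g where g: "polyfun2 g" "\<And>x y. h x y = h x 0 + y * g x y"
    by (rule polyfun2_split_snd) (rule that)
  show ?thesis
    by (rule that[of "\<lambda>x y. g y x"]) (rule polyfun2_swap[OF g(1)], rule g(2)[unfolded h_def])
qed

text \<open>A polynomial function is determined by its values at nonzero scalars.  Several identities below
  are obtained after division by a parameter, and this lemma recovers the case that the parameter
  is zero.\<close>

lemma polyfun_eqI:
  assumes "polyfun f" "polyfun g" "\<And>x. x \<noteq> 0 \<Longrightarrow> f x = g x"
  shows "f x = g x"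
proof -
  obtain p where p: "\<forall>x. f x - g x = poly p x"
    using polyfun_diff[OF assms(1,2)] unfolding polyfun_def by blast
  have "p = 0"
  proof (rule ccontr)
    assume "p \<noteq> 0"
    then have "finite {x. poly p x = 0}" by (rule poly_roots_finite)
    moreover have "UNIV - {0} \<subseteq> {x. poly p x = 0}"
    proof
      fix x :: 'a assume "x \<in> UNIV - {0}"
      then have "f x - g x = 0" using assms(3) by simp
      then show "x \<in> {x. poly p x = 0}" using p by simp
    qed
    ultimately have "finite (UNIV - {0 :: 'a})" by (rule rev_finite_subset)
    then show False using infinite_UNIV_char_0[where 'a = 'a] by simp
  qed
  then have "f x - g x = 0" using p by simp
  then show ?thesis by simp
qed

lemma poly2_eqI:
  fixes P Q :: "'k::field_char_0 poly poly"
  assumes "\<And>x y. poly (poly P [:y:]) x = poly (poly Q [:y:]) x"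
  shows "P = Q"
proof (rule ccontr)
  assume "P \<noteq> Q"
  then have "finite {z. poly (P - Q) z = 0}" by (intro poly_roots_finite) simp
  moreover have "poly (P - Q) [:y:] = 0" for y
    using assms by (intro poly_all_0_iff_0[THEN iffD1]) simp
  then have "range (\<lambda>y. [:y:]) \<subseteq> {z. poly (P - Q) z = 0}" by blast
  ultimately have "finite (range (\<lambda>y. [:y :: 'k:]))" by (rule rev_finite_subset)
  then have "finite (UNIV :: 'k set)" by (rule finite_imageD) (simp add: inj_on_def)
  then show False using infinite_UNIV_char_0 by blast
qed

definition coeff2 :: "nat \<Rightarrow> nat \<Rightarrow> ('k::field_char_0 \<Rightarrow> 'k \<Rightarrow> 'k) \<Rightarrow> 'k" where
  "coeff2 i j f = coeff (coeff (THE P. \<forall>x y. f x y = poly (poly P [:y:]) x) j) i"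

lemma coeff2_eq:
  assumes "\<And>x y. f x y = poly (poly P [:y:]) x"
  shows "coeff2 i j f = coeff (coeff P j) i"
proof -
  have "(THE P. \<forall>x y. f x y = poly (poly P [:y:]) x) = P"
    by (rule the_equality) (use assms in \<open>auto intro: poly2_eqI\<close>)
  then show ?thesis by (simp add: coeff2_def)
qed

lemma coeff2_add: "polyfun2 f \<Longrightarrow> polyfun2 g \<Longrightarrow> coeff2 i j (\<lambda>x y. f x y + g x y) = coeff2 i j f + coeff2 i j g"
proof -
  assume "polyfun2 f" "polyfun2 g"
  then obtain P Q where P: "\<And>x y. f x y = poly (poly P [:y:]) x" and Q: "\<And>x y. g x y = poly (poly Q [:y:]) x"
    unfolding polyfun2_def by blast
  show ?thesis using coeff2_eq[of "\<lambda>x y. f x y + g x y" "P + Q"] coeff2_eq[of f P] coeff2_eq[of g Q] P Q by simp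
qed

lemma coeff2_scale: "polyfun2 f \<Longrightarrow> coeff2 i j (\<lambda>x y. c * f x y) = c * coeff2 i j f"
proof -
  assume "polyfun2 f"
  then obtain P where P: "\<And>x y. f x y = poly (poly P [:y:]) x" unfolding polyfun2_def by blast
  show ?thesis using coeff2_eq[of "\<lambda>x y. c * f x y" "Polynomial.smult [:c:] P"] coeff2_eq[of f P] P by simp
qed

lemma coeff2_mult_fst:
  "polyfun2 f \<Longrightarrow> coeff2 i j (\<lambda>x y. x * f x y) = (case i of 0 \<Rightarrow> 0 | Suc i \<Rightarrow> coeff2 i j f)"
proof -
  assume "polyfun2 f"
  then obtain P where P: "\<And>x y. f x y = poly (poly P [:y:]) x" unfolding polyfun2_def by blast
  show ?thesis using coeff2_eq[of "\<lambda>x y. x * f x y" "Polynomial.smult [:0, 1:] P"] coeff2_eq[of f P] P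
    by (simp split: nat.split)
qed

lemma coeff2_mult_snd:
  "polyfun2 f \<Longrightarrow> coeff2 i j (\<lambda>x y. y * f x y) = (case j of 0 \<Rightarrow> 0 | Suc j \<Rightarrow> coeff2 i j f)"
proof -
  assume "polyfun2 f"
  then obtain P where P: "\<And>x y. f x y = poly (poly P [:y:]) x" unfolding polyfun2_def by blast
  show ?thesis using coeff2_eq[of "\<lambda>x y. y * f x y" "pCons 0 P"] coeff2_eq[of f P] P
    by (simp split: nat.split)
qed

section \<open>Evaluation of polynomials in several variables\<close>

definition monom_eval :: "(nat \<Rightarrow> 'k::comm_ring_1) \<Rightarrow> (nat \<Rightarrow>\<^sub>0 nat) \<Rightarrow> 'k" where
  "monom_eval v m = (\<Prod>i\<in>Poly_Mapping.keys m. v i ^ Poly_Mapping.lookup m i)"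

definition mpoly_eval :: "(nat \<Rightarrow> 'k::comm_ring_1) \<Rightarrow> 'k mpoly \<Rightarrow> 'k" where
  "mpoly_eval v p = (\<Sum>m\<in>Poly_Mapping.keys p. Poly_Mapping.lookup p m * monom_eval v m)"

lemma monom_eval_superset:
  assumes "finite S" "Poly_Mapping.keys m \<subseteq> S"
  shows "monom_eval v m = (\<Prod>i\<in>S. v i ^ Poly_Mapping.lookup m i)"
  unfolding monom_eval_def by (rule prod.mono_neutral_left[OF assms]) (simp add: not_in_keys_iff_lookup_eq_zero)

lemma monom_eval_add: "monom_eval v (m + n) = monom_eval v m * monom_eval v n"
proof -
  let ?S = "Poly_Mapping.keys m \<union> Poly_Mapping.keys n"
  have "Poly_Mapping.keys (m + n) \<subseteq> ?S" by (rule Poly_Mapping.keys_add)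
  then show ?thesis
    by (simp add: monom_eval_superset[of ?S] lookup_add power_add prod.distrib)
qed

lemma mpoly_eval_superset:
  assumes "finite S" "Poly_Mapping.keys p \<subseteq> S"
  shows "mpoly_eval v p = (\<Sum>m\<in>S. Poly_Mapping.lookup p m * monom_eval v m)"
  unfolding mpoly_eval_def by (rule sum.mono_neutral_left[OF assms]) (simp add: not_in_keys_iff_lookup_eq_zero)

lemma mpoly_eval_add: "mpoly_eval v (p + q) = mpoly_eval v p + mpoly_eval v q"
proof -
  let ?S = "Poly_Mapping.keys p \<union> Poly_Mapping.keys q"
  have "Poly_Mapping.keys (p + q) \<subseteq> ?S" by (rule Poly_Mapping.keys_add)
  then show ?thesis
    by (simp add: mpoly_eval_superset[of ?S] lookup_add distrib_right sum.distrib)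
qed

lemma mpoly_eval_0 [simp]: "mpoly_eval v 0 = 0"
  by (simp add: mpoly_eval_def)

lemma mpoly_eval_sum: "mpoly_eval v (\<Sum>i\<in>I. f i) = (\<Sum>i\<in>I. mpoly_eval v (f i))"
  by (induction I rule: infinite_finite_induct) (simp_all add: mpoly_eval_add)

lemma mpoly_eval_single: "mpoly_eval v (Poly_Mapping.single m c) = c * monom_eval v m"
  by (simp add: mpoly_eval_def)

lemma mpoly_expand: "(\<Sum>m\<in>Poly_Mapping.keys p. Poly_Mapping.single m (Poly_Mapping.lookup p m)) = p"
  by (rule poly_mapping_eqI)
    (simp add: lookup_sum lookup_single when_def not_in_keys_iff_lookup_eq_zero)

lemma mpoly_eval_mult: "mpoly_eval v (p * q) = mpoly_eval v p * mpoly_eval v q"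
proof -
  have single: "mpoly_eval v (Poly_Mapping.single m c * Poly_Mapping.single n d) =
      mpoly_eval v (Poly_Mapping.single m c) * mpoly_eval v (Poly_Mapping.single n d)" for m n c d
    by (simp add: mult_single mpoly_eval_single monom_eval_add)
  let ?s = "\<lambda>p :: 'a mpoly. \<Sum>m\<in>Poly_Mapping.keys p. Poly_Mapping.single m (Poly_Mapping.lookup p m)"
  have "mpoly_eval v (?s p * ?s q) = mpoly_eval v (?s p) * mpoly_eval v (?s q)"
    unfolding sum_product mpoly_eval_sum single ..
  then show ?thesis unfolding mpoly_expand .
qed

lemma mpoly_eval_const [simp]: "mpoly_eval v (const c) = c"
  by (simp add: const_def mpoly_eval_single monom_eval_def)

lemma mpoly_eval_lam [simp]: "mpoly_eval v (lam i) = v i"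
  by (simp add: lam_def mpoly_eval_single monom_eval_def)

lemma mpoly_eval_1 [simp]: "mpoly_eval v 1 = 1"
  by (simp add: mpoly_eval_single monom_eval_def flip: single_one)

lemma mpoly_eval_uminus [simp]: "mpoly_eval v (- p) = - mpoly_eval v p"
  using mpoly_eval_add[of v p "- p"] by (simp add: add_eq_0_iff)

lemma mpoly_eval_diff: "mpoly_eval v (p - q) = mpoly_eval v p - mpoly_eval v q"
  using mpoly_eval_add[of v p "- q"] by simp

lemma mpoly_eval_power: "mpoly_eval v (p ^ n) = mpoly_eval v p ^ n"
  by (induction n) (simp_all add: mpoly_eval_mult)

lemma mpoly_eval_prod: "mpoly_eval v (\<Prod>i\<in>I. f i) = (\<Prod>i\<in>I. mpoly_eval v (f i))"
  by (induction I rule: infinite_finite_induct) (simp_all add: mpoly_eval_mult)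

lemma mpoly_eval_subst: "mpoly_eval v (mpoly_subst \<sigma> p) = mpoly_eval (\<lambda>i. mpoly_eval v (\<sigma> i)) p"
  by (simp add: mpoly_subst_def mpoly_eval_sum mpoly_eval_mult mpoly_eval_prod mpoly_eval_power
      mpoly_eval_def[of "\<lambda>i. mpoly_eval v (\<sigma> i)"] monom_eval_def[of "\<lambda>i. mpoly_eval v (\<sigma> i)"])

lemmas mpoly_eval_simps = mpoly_eval_add mpoly_eval_diff mpoly_eval_mult mpoly_eval_sum mpoly_eval_power

lemma mpoly_eval_cong:
  assumes "\<And>i. i \<in> mpoly_vars p \<Longrightarrow> v i = w i"
  shows "mpoly_eval v p = mpoly_eval w p"
proof -
  have "v i = w i" if "m \<in> Poly_Mapping.keys p" "i \<in> Poly_Mapping.keys m" for m i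
    using assms that unfolding mpoly_vars_def by blast
  then show ?thesis
    unfolding mpoly_eval_def monom_eval_def
    by (intro sum.cong prod.cong refl arg_cong2[of _ _ _ _ "(*)"]) simp_all
qed

text \<open>For the substitution in the next lemma: exponents below \<open>B\<close> can be read off from their code in
  base \<open>B\<close>.\<close>

lemma digits_unique:
  fixes f g :: "nat \<Rightarrow> nat"
  assumes "\<And>i. f i < B" "\<And>i. g i < B" "(\<Sum>i<V. f i * B ^ i) = (\<Sum>i<V. g i * B ^ i)" "i < V"
  shows "f i = g i"
  using assms
proof (induction V arbitrary: f g i)
  case (Suc V)
  have shift: "(\<Sum>i<Suc V. f i * B ^ i) = f 0 + B * (\<Sum>i<V. f (Suc i) * B ^ i)" for f :: "nat \<Rightarrow> nat"
    unfolding sum.lessThan_Suc_shift by (simp add: sum_distrib_left mult_ac)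
  have "(f 0 + B * (\<Sum>i<V. f (Suc i) * B ^ i)) mod B = (g 0 + B * (\<Sum>i<V. g (Suc i) * B ^ i)) mod B"
    using Suc.prems(3) unfolding shift by simp
  then have 0: "f 0 = g 0" using Suc.prems(1,2) by simp
  have "0 < B" using Suc.prems(1)[of 0] by simp
  with 0 have "(\<Sum>i<V. f (Suc i) * B ^ i) = (\<Sum>i<V. g (Suc i) * B ^ i)"
    using Suc.prems(3) unfolding shift by simp
  then have "f (Suc i) = g (Suc i)" if "i < V" for i
    using Suc.IH[of "\<lambda>i. f (Suc i)" "\<lambda>i. g (Suc i)"] Suc.prems(1,2) that by blast
  with 0 Suc.prems(4) show ?case by (cases i) auto
qed simp

text \<open>Over an infinite field a polynomial is determined by its values; substituting \<open>x\<close> to the power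
  \<open>B ^ i\<close> for the \<open>i\<close>-th variable, with \<open>B\<close> larger than all exponents, reduces this to one
  variable.\<close>

lemma mpoly_eqI:
  fixes p q :: "'k::field_char_0 mpoly"
  assumes "\<And>v. mpoly_eval v p = mpoly_eval v q"
  shows "p = q"
proof (rule ccontr)
  define r where "r = p - q"
  assume "p \<noteq> q"
  then have "Poly_Mapping.keys r \<noteq> {}" by (simp add: r_def)
  then obtain m0 where m0: "m0 \<in> Poly_Mapping.keys r" by blast
  define E where "E = (\<Union>m\<in>Poly_Mapping.keys r. Poly_Mapping.lookup m ` Poly_Mapping.keys m)"
  define I where "I = (\<Union>m\<in>Poly_Mapping.keys r. Poly_Mapping.keys m)"
  have fin: "finite E" "finite I" by (simp_all add: E_def I_def)
  then obtain B V where B: "\<forall>e\<in>E. e < B" and V: "\<forall>i\<in>I. i < V" by (meson finite_nat_set_iff_bounded)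
  define B' where "B' = Suc B"
  have bound: "Poly_Mapping.lookup m i < B'" if "m \<in> Poly_Mapping.keys r" for m i
    using B that by (cases "i \<in> Poly_Mapping.keys m")
      (auto simp: E_def B'_def not_in_keys_iff_lookup_eq_zero less_SucI)
  define code where "code m = (\<Sum>i<V. Poly_Mapping.lookup m i * B' ^ i)" for m
  have inj: "m = n" if "m \<in> Poly_Mapping.keys r" "n \<in> Poly_Mapping.keys r" "code m = code n" for m n
  proof (rule poly_mapping_eqI)
    fix i
    show "Poly_Mapping.lookup m i = Poly_Mapping.lookup n i"
    proof (cases "i < V")
      case True
      then show ?thesis
        using digits_unique[of "Poly_Mapping.lookup m" B' "Poly_Mapping.lookup n" V i] bound that
        by (simp add: code_def)
    next
      case False
      then have "i \<notin> Poly_Mapping.keys m" "i \<notin> Poly_Mapping.keys n" using V that by (auto simp: I_def)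
      then show ?thesis by (simp add: not_in_keys_iff_lookup_eq_zero)
    qed
  qed
  define P where "P = (\<Sum>m\<in>Poly_Mapping.keys r. monom (Poly_Mapping.lookup r m) (code m))"
  have "poly P x = 0" for x
  proof -
    have "monom_eval (\<lambda>i. x ^ (B' ^ i)) m = x ^ code m" if "m \<in> Poly_Mapping.keys r" for m
    proof -
      have "Poly_Mapping.keys m \<subseteq> {..<V}" using V that by (auto simp: I_def)
      then show ?thesis
        by (subst monom_eval_superset[of "{..<V}"])
          (simp_all add: code_def power_sum mult.commute flip: power_mult)
    qed
    then have "poly P x = mpoly_eval (\<lambda>i. x ^ (B' ^ i)) r"
      by (simp add: P_def poly_sum poly_monom mpoly_eval_def)
    also have "\<dots> = 0" by (simp add: r_def mpoly_eval_diff assms)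
    finally show ?thesis .
  qed
  then have "P = 0" using poly_all_0_iff_0[of P] by blast
  have "coeff P (code m0) = (\<Sum>m\<in>Poly_Mapping.keys r. if m = m0 then Poly_Mapping.lookup r m else 0)"
    unfolding P_def coeff_sum using inj m0 by (intro sum.cong refl) auto
  also have "\<dots> = Poly_Mapping.lookup r m0" using m0 by simp
  finally show False using m0 \<open>P = 0\<close> by (simp add: in_keys_iff)
qed

lemma mpoly_vars_add: "mpoly_vars (p + q) \<subseteq> mpoly_vars p \<union> mpoly_vars q"
  using Poly_Mapping.keys_add[of p q] unfolding mpoly_vars_def by blast

lemma mpoly_vars_mult: "mpoly_vars (p * q) \<subseteq> mpoly_vars p \<union> mpoly_vars q"
proof
  fix i assume "i \<in> mpoly_vars (p * q)"
  then obtain m where m: "m \<in> Poly_Mapping.keys (p * q)" "i \<in> Poly_Mapping.keys m"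
    unfolding mpoly_vars_def by blast
  then obtain a b where "m = a + b" "a \<in> Poly_Mapping.keys p" "b \<in> Poly_Mapping.keys q"
    using Poly_Mapping.keys_mult[of p q] by blast
  with m(2) Poly_Mapping.keys_add[of a b] show "i \<in> mpoly_vars p \<union> mpoly_vars q"
    unfolding mpoly_vars_def by blast
qed

lemma mpoly_vars_const [simp]: "mpoly_vars (const c) = {}"
  by (simp add: mpoly_vars_def const_def)

lemma mpoly_vars_0 [simp]: "mpoly_vars 0 = {}"
  by (simp add: mpoly_vars_def)

lemma mpoly_vars_lam: "mpoly_vars (lam i) \<subseteq> {i}"
  by (simp add: mpoly_vars_def lam_def)

lemma polyfun_mpoly_in:
  assumes "polyfun f"
  obtains q where "mpoly_vars q \<subseteq> {i}" "\<And>v. mpoly_eval v q = f (v i)"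
proof -
  obtain p where p: "\<forall>x. f x = poly p x" using assms unfolding polyfun_def by blast
  have "\<exists>q. mpoly_vars q \<subseteq> {i} \<and> (\<forall>v. mpoly_eval v q = poly p (v i))"
  proof (induction p)
    case (pCons a p)
    then obtain q where q: "mpoly_vars q \<subseteq> {i}" "\<forall>v. mpoly_eval v q = poly p (v i)" by blast
    have "mpoly_vars (const a + lam i * q) \<subseteq> {i}"
      using mpoly_vars_add[of "const a" "lam i * q"] mpoly_vars_mult[of "lam i" q] mpoly_vars_lam[of i] q(1)
      by auto
    then show ?case using q(2) by (intro exI[of _ "const a + lam i * q"]) (simp add: mpoly_eval_simps)
  qed (auto intro!: exI[of _ 0])
  then obtain q where "mpoly_vars q \<subseteq> {i}" "\<forall>v. mpoly_eval v q = poly p (v i)" by blast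
  then show ?thesis using p by (intro that[of q]) simp_all
qed

lemma polyfun2_mpoly:
  assumes "polyfun2 f"
  obtains q where "mpoly_vars q \<subseteq> {0, 1}" "\<And>v. mpoly_eval v q = f (v 0) (v 1)"
proof -
  obtain P where P: "\<forall>x y. f x y = poly (poly P [:y:]) x" using assms unfolding polyfun2_def by blast
  have "\<exists>q. mpoly_vars q \<subseteq> {0, 1} \<and> (\<forall>v. mpoly_eval v q = poly (poly P [:v 1:]) (v 0))"
  proof (induction P)
    case (pCons p P)
    then obtain q where q: "mpoly_vars q \<subseteq> {0, 1}" "\<forall>v. mpoly_eval v q = poly (poly P [:v 1:]) (v 0)" by blast
    have "polyfun (poly p)" unfolding polyfun_def by blast
    then obtain r where r: "mpoly_vars r \<subseteq> {0}" "\<And>v. mpoly_eval v r = poly p (v 0)"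
      by (rule polyfun_mpoly_in) (rule that)
    have "mpoly_vars (r + lam 1 * q) \<subseteq> {0, 1}"
      using mpoly_vars_add[of r "lam 1 * q"] mpoly_vars_mult[of "lam 1" q] mpoly_vars_lam[of 1] q(1) r(1)
      by blast
    then show ?case using q(2) r(2) by (intro exI[of _ "r + lam 1 * q"]) (simp add: mpoly_eval_simps)
  qed (auto intro!: exI[of _ 0])
  then obtain q where "mpoly_vars q \<subseteq> {0, 1}" "\<forall>v. mpoly_eval v q = poly (poly P [:v 1:]) (v 0)" by blast
  then show ?thesis using P by (intro that[of q]) simp_all
qed

lemma mpoly_polyfun2: "polyfun2 (\<lambda>x y. mpoly_eval (\<lambda>i. if i = 0 then x else y) p)"
proof -
  have "polyfun2 (\<lambda>x y. if i = 0 then x else y)" for i :: nat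
    by (cases "i = 0") (simp_all add: polyfun2_fst polyfun2_snd)
  then show ?thesis
    unfolding mpoly_eval_def monom_eval_def
    by (intro polyfun2_sum polyfun2_mult polyfun2_prod polyfun2_power polyfun2_const)
qed

lemma mpoly_polyfun: "polyfun (\<lambda>x. mpoly_eval (\<lambda>i. x) p)"
  using polyfun2_compose[OF mpoly_polyfun2[of p] polyfun_id polyfun_id] by simp

section \<open>Cochains as functions\<close>

lemma functional_lprod_at:
  assumes "functional f"
  shows "f (lprod_at x a b) = (\<Sum>k\<le>degree (U3_lprod a b). x ^ k * f (coeff (U3_lprod a b) k))"
proof -
  have "U3_nprod n a b = 0" if "Suc (degree (U3_lprod a b)) \<le> n" for n
  proof -
    have "coeff (U3_lprod a b) n = 0" using that by (intro coeff_eq_0) simp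
    then show ?thesis by (simp add: coeff_U3_lprod)
  qed
  then have "lprod_at x a b = (\<Sum>n<Suc (degree (U3_lprod a b)). U3_scale (x ^ n / fact n) (U3_nprod n a b))"
    unfolding lprod_at_def by (intro exp_sum_eq[OF U3_vector_space]) blast
  also have "\<dots> = (\<Sum>n\<le>degree (U3_lprod a b). U3_scale (x ^ n) (coeff (U3_lprod a b) n))"
    by (simp add: lessThan_Suc_atMost coeff_U3_lprod field_simps)
  also have "f \<dots> = (\<Sum>k\<le>degree (U3_lprod a b). f (U3_scale (x ^ k) (coeff (U3_lprod a b) k)))"
  proof -
    have "f (sum g S) = (\<Sum>k\<in>S. f (g k))" if "finite S" for g :: "nat \<Rightarrow> 'a U3" and S
      using that by induction (simp_all add: functional_simps[OF assms])
    then show ?thesis by blast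
  qed
  finally show ?thesis by (simp add: functional_simps[OF assms])
qed

text \<open>Cochains as functions of scalars.  By \<open>mpoly_eqI\<close> and the lemmas on realisation below they are the
  same as the polynomial-valued ones.\<close>

definition cochain2 :: "('k::field_char_0 U3 \<Rightarrow> 'k U3 \<Rightarrow> 'k \<Rightarrow> 'k) \<Rightarrow> bool" where
  "cochain2 \<psi> \<longleftrightarrow> (\<forall>b x. functional (\<lambda>a. \<psi> a b x)) \<and> (\<forall>a x. functional (\<lambda>b. \<psi> a b x)) \<and>
    (\<forall>a b x. \<psi> (U3_der a) b x = - x * \<psi> a b x) \<and> (\<forall>a b x. \<psi> a (U3_der b) x = x * \<psi> a b x) \<and>
    (\<forall>a b. polyfun (\<psi> a b))"

definition cochain3 :: "('k::field_char_0 U3 \<Rightarrow> 'k U3 \<Rightarrow> 'k U3 \<Rightarrow> 'k \<Rightarrow> 'k \<Rightarrow> 'k) \<Rightarrow> bool" where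
  "cochain3 \<phi> \<longleftrightarrow> (\<forall>b c x y. functional (\<lambda>a. \<phi> a b c x y)) \<and> (\<forall>a c x y. functional (\<lambda>b. \<phi> a b c x y)) \<and>
    (\<forall>a b x y. functional (\<lambda>c. \<phi> a b c x y)) \<and>
    (\<forall>a b c x y. \<phi> (U3_der a) b c x y = - x * \<phi> a b c x y) \<and>
    (\<forall>a b c x y. \<phi> a (U3_der b) c x y = - y * \<phi> a b c x y) \<and>
    (\<forall>a b c x y. \<phi> a b (U3_der c) x y = (x + y) * \<phi> a b c x y) \<and>
    (\<forall>a b c. polyfun2 (\<phi> a b c))"

text \<open>The differentials of 2-cochains and, below, of 3-cochains; the indices are \<open>\<lambda>\<^sub>1 = x\<close>,
  \<open>\<lambda>\<^sub>2 = y\<close>, \<open>\<lambda>\<^sub>3 = z\<close>.\<close>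

definition diff2 :: "('k::field_char_0 U3 \<Rightarrow> 'k U3 \<Rightarrow> 'k \<Rightarrow> 'k) \<Rightarrow> 'k U3 \<Rightarrow> 'k U3 \<Rightarrow> 'k U3 \<Rightarrow> 'k \<Rightarrow> 'k \<Rightarrow> 'k" where
  "diff2 \<psi> a b c x y = \<psi> a (lprod_at y b c) x - \<psi> (lprod_at x a b) c (x + y)"

definition diff3 :: "('k::field_char_0 U3 \<Rightarrow> 'k U3 \<Rightarrow> 'k U3 \<Rightarrow> 'k \<Rightarrow> 'k \<Rightarrow> 'k) \<Rightarrow>
    'k U3 \<Rightarrow> 'k U3 \<Rightarrow> 'k U3 \<Rightarrow> 'k U3 \<Rightarrow> 'k \<Rightarrow> 'k \<Rightarrow> 'k \<Rightarrow> 'k" where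
  "diff3 \<phi> a b c d x y z = \<phi> a (lprod_at y b c) d x (y + z) - \<phi> (lprod_at x a b) c d (x + y) z
    - \<phi> a b (lprod_at z c d) x y"

definition eval2 :: "('k::field_char_0 U3 list \<Rightarrow> 'k mpoly) \<Rightarrow> 'k U3 \<Rightarrow> 'k U3 \<Rightarrow> 'k \<Rightarrow> 'k" where
  "eval2 \<Psi> a b x = mpoly_eval (\<lambda>i. x) (\<Psi> [a, b])"

definition eval3 :: "('k::field_char_0 U3 list \<Rightarrow> 'k mpoly) \<Rightarrow> 'k U3 \<Rightarrow> 'k U3 \<Rightarrow> 'k U3 \<Rightarrow> 'k \<Rightarrow> 'k \<Rightarrow> 'k" where
  "eval3 \<Phi> a b c x y = mpoly_eval (\<lambda>i. if i = 0 then x else y) (\<Phi> [a, b, c])"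

lemma cochains_vars:
  "\<Phi> \<in> U3.cochains n \<Longrightarrow> length as = n \<Longrightarrow> mpoly_vars (\<Phi> as) \<subseteq> {..<n - 1}"
  unfolding U3.cochains_def by blast

lemma cochains_add:
  "\<Phi> \<in> U3.cochains n \<Longrightarrow> length as = n \<Longrightarrow> i < n \<Longrightarrow> \<Phi> (as[i := a + b]) = \<Phi> (as[i := a]) + \<Phi> (as[i := b])"
  unfolding U3.cochains_def by blast

lemma cochains_scale:
  "\<Phi> \<in> U3.cochains n \<Longrightarrow> length as = n \<Longrightarrow> i < n \<Longrightarrow> \<Phi> (as[i := U3_scale r a]) = const r * \<Phi> (as[i := a])"
  unfolding U3.cochains_def by blast

lemma cochains_der:
  "\<Phi> \<in> U3.cochains n \<Longrightarrow> length as = n \<Longrightarrow> i < n - 1 \<Longrightarrow> \<Phi> (as[i := U3_der (as ! i)]) = - lam i * \<Phi> as"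
  unfolding U3.cochains_def by blast

lemma cochains_der_last:
  "\<Phi> \<in> U3.cochains n \<Longrightarrow> length as = n \<Longrightarrow> 0 < n \<Longrightarrow>
    \<Phi> (as[n - 1 := U3_der (as ! (n - 1))]) = (\<Sum>i<n - 1. lam i) * \<Phi> as"
  unfolding U3.cochains_def by blast

lemma cochains_zero: "\<Phi> \<in> U3.cochains n \<Longrightarrow> length as \<noteq> n \<Longrightarrow> \<Phi> as = 0"
  unfolding U3.cochains_def by blast

lemma cochains_functional:
  assumes "\<Phi> \<in> U3.cochains n" "length as = n" "i < n"
  shows "functional (\<lambda>a. mpoly_eval v (\<Phi> (as[i := a])))"
  unfolding functional_def using cochains_add[OF assms] cochains_scale[OF assms]
  by (simp add: mpoly_eval_simps)

lemma mpoly_eval_cochain2: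
  assumes "\<Psi> \<in> U3.cochains 2"
  shows "mpoly_eval v (\<Psi> [a, b]) = eval2 \<Psi> a b (v 0)"
  unfolding eval2_def
  by (rule mpoly_eval_cong) (use cochains_vars[OF assms, of "[a, b]"] in auto)

lemma mpoly_eval_cochain3:
  assumes "\<Phi> \<in> U3.cochains 3"
  shows "mpoly_eval v (\<Phi> [a, b, c]) = eval3 \<Phi> a b c (v 0) (v 1)"
  unfolding eval3_def
proof (rule mpoly_eval_cong)
  fix i assume "i \<in> mpoly_vars (\<Phi> [a, b, c])"
  then have "i < 2" using cochains_vars[OF assms, of "[a, b, c]"] by auto
  then show "v i = (if i = 0 then v 0 else v 1)" by (cases i) auto
qed

lemma cochain2_eval2:
  assumes "\<Psi> \<in> U3.cochains 2"
  shows "cochain2 (eval2 \<Psi>)"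
  unfolding cochain2_def
proof (intro conjI allI)
  fix a b and x :: 'a
  show "functional (\<lambda>a. eval2 \<Psi> a b x)"
    using cochains_functional[OF assms, of "[0, b]" 0] by (simp add: eval2_def)
  show "functional (\<lambda>b. eval2 \<Psi> a b x)"
    using cochains_functional[OF assms, of "[a, 0]" 1] by (simp add: eval2_def)
  show "eval2 \<Psi> (U3_der a) b x = - x * eval2 \<Psi> a b x"
    using cochains_der[OF assms, of "[a, b]" 0] by (simp add: eval2_def mpoly_eval_simps)
  show "eval2 \<Psi> a (U3_der b) x = x * eval2 \<Psi> a b x"
    using cochains_der_last[OF assms, of "[a, b]"] by (simp add: eval2_def mpoly_eval_simps)
  show "polyfun (eval2 \<Psi> a b)" unfolding eval2_def by (rule mpoly_polyfun)
qed

lemma cochain3_eval3: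
  assumes "\<Phi> \<in> U3.cochains 3"
  shows "cochain3 (eval3 \<Phi>)"
  unfolding cochain3_def
proof (intro conjI allI)
  fix a b c and x y :: 'a
  show "functional (\<lambda>a. eval3 \<Phi> a b c x y)"
    using cochains_functional[OF assms, of "[0, b, c]" 0] by (simp add: eval3_def)
  show "functional (\<lambda>b. eval3 \<Phi> a b c x y)"
    using cochains_functional[OF assms, of "[a, 0, c]" 1] by (simp add: eval3_def)
  show "functional (\<lambda>c. eval3 \<Phi> a b c x y)"
    using cochains_functional[OF assms, of "[a, b, 0]" 2] by (simp add: eval3_def)
  show "eval3 \<Phi> (U3_der a) b c x y = - x * eval3 \<Phi> a b c x y"
    using cochains_der[OF assms, of "[a, b, c]" 0] by (simp add: eval3_def mpoly_eval_simps)
  show "eval3 \<Phi> a (U3_der b) c x y = - y * eval3 \<Phi> a b c x y"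
    using cochains_der[OF assms, of "[a, b, c]" 1] by (simp add: eval3_def mpoly_eval_simps)
  show "eval3 \<Phi> a b (U3_der c) x y = (x + y) * eval3 \<Phi> a b c x y"
    using cochains_der_last[OF assms, of "[a, b, c]"]
    by (simp add: eval3_def mpoly_eval_simps numeral_2_eq_2)
  show "polyfun2 (eval3 \<Phi> a b c)" unfolding eval3_def by (rule mpoly_polyfun2)
qed

lemma length_2E:
  assumes "length as = 2"
  obtains a b where "as = [a, b]"
  using assms by (cases as; cases "tl as") (auto simp: numeral_2_eq_2)

lemma length_3E:
  assumes "length as = 3"
  obtains a b c where "as = [a, b, c]"
  using assms by (auto simp: numeral_3_eq_3 length_Suc_conv)

lemma length_4E:
  assumes "length as = 4"
  obtains a b c d where "as = [a, b, c, d]"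
  using assms by (auto simp: eval_nat_numeral length_Suc_conv)

lemma realize_cochain2:
  fixes \<psi> :: "'k::field_char_0 U3 \<Rightarrow> _"
  assumes "cochain2 \<psi>"
  obtains \<Psi> where "\<Psi> \<in> U3.cochains 2" "eval2 \<Psi> = \<psi>"
proof -
  have "\<exists>q. mpoly_vars q \<subseteq> {0} \<and> (\<forall>v. mpoly_eval v q = \<psi> a b (v 0))" for a b
  proof -
    have "polyfun (\<psi> a b)" using assms by (simp add: cochain2_def)
    then show ?thesis by (rule polyfun_mpoly_in[of _ 0]) blast
  qed
  note ex = this
  define Q where "Q a b = (SOME q. mpoly_vars q \<subseteq> {0} \<and> (\<forall>v. mpoly_eval v q = \<psi> a b (v 0)))" for a b
  have Q: "mpoly_vars (Q a b) \<subseteq> {0}" "mpoly_eval v (Q a b) = \<psi> a b (v 0)" for a b v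
    using someI_ex[OF ex[of a b]] unfolding Q_def by simp_all
  define \<Psi> where "\<Psi> as = (if length as = 2 then Q (as ! 0) (as ! 1) else 0)" for as
  have \<Psi>: "\<Psi> [a, b] = Q a b" for a b by (simp add: \<Psi>_def)
  have lin: "functional (\<lambda>a. \<psi> a b x)" "functional (\<lambda>b. \<psi> a b x)" "\<psi> (U3_der a) b x = - x * \<psi> a b x"
    "\<psi> a (U3_der b) x = x * \<psi> a b x" for a b x
    using assms by (simp_all add: cochain2_def)
  note lin1 = functional_simps[OF lin(1)] and lin2 = functional_simps[OF lin(2)]
  have "\<Psi> \<in> U3.cochains 2"
    unfolding U3.cochains_def mem_Collect_eq
  proof (intro conjI allI impI)
    fix as :: "'k U3 list" and i :: nat and a b r
    show "\<Psi> as = 0" if "length as \<noteq> 2" using that by (simp add: \<Psi>_def)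
    {
      assume "length as = 2"
      then obtain c d where as: "as = [c, d]" by (rule length_2E)
      show "mpoly_vars (\<Psi> as) \<subseteq> {..<2 - 1}" using Q(1)[of c d] by (auto simp: as \<Psi>)
    }
    {
      assume *: "length as = 2 \<and> i < 2"
      then obtain c d where as: "as = [c, d]" using length_2E by blast
      have i: "i = 0 \<or> i = 1" using * by auto
      show "\<Psi> (as[i := a + b]) = \<Psi> (as[i := a]) + \<Psi> (as[i := b])"
        using i by (intro mpoly_eqI) (auto simp: as \<Psi> Q(2) mpoly_eval_simps lin1 lin2)
    }
    {
      assume *: "length as = 2 \<and> i < 2"
      then obtain c d where as: "as = [c, d]" using length_2E by blast
      have i: "i = 0 \<or> i = 1" using * by auto
      show "\<Psi> (as[i := U3_scale r a]) = const r * \<Psi> (as[i := a])"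
        using i by (intro mpoly_eqI) (auto simp: as \<Psi> Q(2) mpoly_eval_simps lin1 lin2)
    }
    {
      assume *: "length as = 2 \<and> i < 2 - 1"
      then obtain c d where as: "as = [c, d]" using length_2E by blast
      have i: "i = 0" using * by auto
      show "\<Psi> (as[i := U3_der (as ! i)]) = - lam i * \<Psi> as"
        by (intro mpoly_eqI) (simp add: as i \<Psi> Q(2) mpoly_eval_simps lin)
    }
    {
      assume "length as = 2 \<and> (0 :: nat) < 2"
      then obtain c d where as: "as = [c, d]" using length_2E by blast
      show "\<Psi> (as[2 - 1 := U3_der (as ! (2 - 1))]) = (\<Sum>i<2 - 1. lam i) * \<Psi> as"
        by (intro mpoly_eqI) (simp add: as \<Psi> Q(2) mpoly_eval_simps lin)
    }
  qed
  moreover have "eval2 \<Psi> = \<psi>" by (intro ext) (simp add: eval2_def \<Psi> Q(2))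
  ultimately show ?thesis by (rule that)
qed

lemma realize_cochain3:
  fixes \<phi> :: "'k::field_char_0 U3 \<Rightarrow> _"
  assumes "cochain3 \<phi>"
  obtains \<Phi> where "\<Phi> \<in> U3.cochains 3" "eval3 \<Phi> = \<phi>"
proof -
  have "\<exists>q. mpoly_vars q \<subseteq> {0, 1} \<and> (\<forall>v. mpoly_eval v q = \<phi> a b c (v 0) (v 1))" for a b c
  proof -
    have "polyfun2 (\<phi> a b c)" using assms by (simp add: cochain3_def)
    then show ?thesis by (rule polyfun2_mpoly) blast
  qed
  note ex = this
  define Q where "Q a b c = (SOME q. mpoly_vars q \<subseteq> {0, 1} \<and> (\<forall>v. mpoly_eval v q = \<phi> a b c (v 0) (v 1)))"
    for a b c
  have Q: "mpoly_vars (Q a b c) \<subseteq> {0, 1}" "mpoly_eval v (Q a b c) = \<phi> a b c (v 0) (v 1)" for a b c v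
    using someI_ex[OF ex[of a b c]] unfolding Q_def by simp_all
  define \<Phi> where "\<Phi> as = (if length as = 3 then Q (as ! 0) (as ! 1) (as ! 2) else 0)" for as
  have \<Phi>: "\<Phi> [a, b, c] = Q a b c" for a b c by (simp add: \<Phi>_def)
  have lin: "functional (\<lambda>a. \<phi> a b c x y)" "functional (\<lambda>b. \<phi> a b c x y)" "functional (\<lambda>c. \<phi> a b c x y)"
    "\<phi> (U3_der a) b c x y = - x * \<phi> a b c x y" "\<phi> a (U3_der b) c x y = - y * \<phi> a b c x y"
    "\<phi> a b (U3_der c) x y = (x + y) * \<phi> a b c x y" for a b c x y
    using assms by (simp_all add: cochain3_def)
  note lin1 = functional_simps[OF lin(1)] and lin2 = functional_simps[OF lin(2)]
    and lin3 = functional_simps[OF lin(3)]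
  have "\<Phi> \<in> U3.cochains 3"
    unfolding U3.cochains_def mem_Collect_eq
  proof (intro conjI allI impI)
    fix as :: "'k U3 list" and i :: nat and a b r
    have i3: "i = 0 \<or> i = 1 \<or> i = 2" if "i < 3" using that by auto
    show "\<Phi> as = 0" if "length as \<noteq> 3" using that by (simp add: \<Phi>_def)
    {
      assume "length as = 3"
      then obtain c d e where as: "as = [c, d, e]" by (rule length_3E)
      show "mpoly_vars (\<Phi> as) \<subseteq> {..<3 - 1}" using Q(1)[of c d e] by (auto simp: as \<Phi>)
    }
    {
      assume *: "length as = 3 \<and> i < 3"
      then obtain c d e where as: "as = [c, d, e]" using length_3E by blast
      show "\<Phi> (as[i := a + b]) = \<Phi> (as[i := a]) + \<Phi> (as[i := b])"
        using i3 * by (intro mpoly_eqI) (auto simp: as \<Phi> Q(2) mpoly_eval_simps lin1 lin2 lin3)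
    }
    {
      assume *: "length as = 3 \<and> i < 3"
      then obtain c d e where as: "as = [c, d, e]" using length_3E by blast
      show "\<Phi> (as[i := U3_scale r a]) = const r * \<Phi> (as[i := a])"
        using i3 * by (intro mpoly_eqI) (auto simp: as \<Phi> Q(2) mpoly_eval_simps lin1 lin2 lin3)
    }
    {
      assume *: "length as = 3 \<and> i < 3 - 1"
      then obtain c d e where as: "as = [c, d, e]" using length_3E by blast
      have "i = 0 \<or> i = 1" using * by auto
      then show "\<Phi> (as[i := U3_der (as ! i)]) = - lam i * \<Phi> as"
        by (intro mpoly_eqI) (auto simp: as \<Phi> Q(2) mpoly_eval_simps lin)
    }
    {
      assume *: "length as = 3 \<and> (0 :: nat) < 3"
      then obtain c d e where as: "as = [c, d, e]" using length_3E by blast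
      show "\<Phi> (as[3 - 1 := U3_der (as ! (3 - 1))]) = (\<Sum>i<3 - 1. lam i) * \<Phi> as"
        by (intro mpoly_eqI) (simp add: as \<Phi> Q(2) mpoly_eval_simps lin numeral_2_eq_2)
    }
  qed
  moreover have "eval3 \<Phi> = \<phi>" by (intro ext) (simp add: eval3_def \<Phi> Q(2))
  ultimately show ?thesis by (rule that)
qed

lemma mpoly_eval_hochschild_d_2:
  assumes "\<Psi> \<in> U3.cochains 2"
  shows "mpoly_eval v (U3.hochschild_d 2 \<Psi> [a, b, c]) = diff2 (eval2 \<Psi>) a b c (v 0) (v 1)"
proof -
  have lin: "functional (\<lambda>a. eval2 \<Psi> a b x)" "functional (\<lambda>b. eval2 \<Psi> a b x)" for a b x
    using cochain2_eval2[OF assms] by (simp_all add: cochain2_def)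
  show ?thesis
    unfolding U3.hochschild_d_def diff2_def functional_lprod_at[OF lin(1)] functional_lprod_at[OF lin(2)]
    by (simp add: numeral_2_eq_2 mpoly_eval_simps mpoly_eval_subst
        mpoly_eval_cochain2[OF assms, unfolded numeral_2_eq_2] lam_merge_def)
qed

lemma mpoly_eval_hochschild_d_3:
  assumes "\<Phi> \<in> U3.cochains 3"
  shows "mpoly_eval v (U3.hochschild_d 3 \<Phi> [a, b, c, d]) = diff3 (eval3 \<Phi>) a b c d (v 0) (v 1) (v 2)"
proof -
  have lin: "functional (\<lambda>a. eval3 \<Phi> a b c x y)" "functional (\<lambda>b. eval3 \<Phi> a b c x y)"
    "functional (\<lambda>c. eval3 \<Phi> a b c x y)" for a b c x y
    using cochain3_eval3[OF assms] by (simp_all add: cochain3_def)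
  show ?thesis
    unfolding U3.hochschild_d_def diff3_def functional_lprod_at[OF lin(1)] functional_lprod_at[OF lin(2)]
      functional_lprod_at[OF lin(3)]
    by (simp add: eval_nat_numeral mpoly_eval_simps mpoly_eval_subst
        mpoly_eval_cochain3[OF assms, unfolded eval_nat_numeral] lam_merge_def)
qed

lemma cocycles_3_iff:
  "\<Phi> \<in> U3.cocycles 3 \<longleftrightarrow> \<Phi> \<in> U3.cochains 3 \<and> (\<forall>a b c d x y z. diff3 (eval3 \<Phi>) a b c d x y z = 0)"
proof (intro iffI conjI allI)
  assume "\<Phi> \<in> U3.cocycles 3"
  then have \<Phi>: "\<Phi> \<in> U3.cochains 3" and d: "U3.hochschild_d 3 \<Phi> = 0" by (simp_all add: U3.cocycles_def)
  show "\<Phi> \<in> U3.cochains 3" by (rule \<Phi>)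
  fix a b c d x y z
  show "diff3 (eval3 \<Phi>) a b c d x y z = 0"
    using mpoly_eval_hochschild_d_3[OF \<Phi>, of "\<lambda>i. if i = 0 then x else if i = 1 then y else z" a b c d]
    by (simp add: d)
next
  assume *: "\<Phi> \<in> U3.cochains 3 \<and> (\<forall>a b c d x y z. diff3 (eval3 \<Phi>) a b c d x y z = 0)"
  have "U3.hochschild_d 3 \<Phi> as = 0" for as
  proof (cases "length as = 4")
    case True
    then obtain a b c d where as: "as = [a, b, c, d]" by (rule length_4E)
    show ?thesis
      by (rule mpoly_eqI) (use * in \<open>simp add: as mpoly_eval_hochschild_d_3\<close>)
  qed (simp add: U3.hochschild_d_def)
  with * show "\<Phi> \<in> U3.cocycles 3" by (auto simp: U3.cocycles_def)
qed

lemma coboundaries_3_iff: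
  "\<Phi> \<in> U3.coboundaries 3 \<longleftrightarrow> \<Phi> \<in> U3.hochschild_d 2 ` U3.cochains 2"
  by (simp add: U3.coboundaries_def numeral_3_eq_3 numeral_2_eq_2)

lemma eval3_coboundary:
  assumes "\<Psi> \<in> U3.cochains 2"
  shows "eval3 (U3.hochschild_d 2 \<Psi>) = diff2 (eval2 \<Psi>)"
  by (intro ext) (simp add: eval3_def mpoly_eval_hochschild_d_2[OF assms])

lemma coboundaryI:
  assumes "\<Phi> \<in> U3.cochains 3" "cochain2 \<psi>" "eval3 \<Phi> = diff2 \<psi>"
  shows "\<Phi> \<in> U3.coboundaries 3"
proof -
  obtain \<Psi> where \<Psi>: "\<Psi> \<in> U3.cochains 2" "eval2 \<Psi> = \<psi>" by (rule realize_cochain2[OF assms(2)])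
  have "\<Phi> as = U3.hochschild_d 2 \<Psi> as" for as
  proof (cases "length as = 3")
    case True
    then obtain a b c where as: "as = [a, b, c]" by (rule length_3E)
    show ?thesis
      by (rule mpoly_eqI)
        (simp add: as mpoly_eval_cochain3[OF assms(1)] mpoly_eval_hochschild_d_2[OF \<Psi>(1)] \<Psi>(2) assms(3))
  next
    case False
    then show ?thesis using cochains_zero[OF assms(1)] by (simp add: U3.hochschild_d_def)
  qed
  then show ?thesis unfolding coboundaries_3_iff using \<Psi>(1) by blast
qed

section \<open>Functional equations for the potential\<close>

text \<open>The shape in \<open>y\<close> of \<open>\<psi>\<^sub>x(a, v\<^sub>yv)\<close>, where \<open>c\<close> is \<open>\<psi>\<^sub>x(a, v)\<close>.  The coefficient of \<open>y(x + y)\<close>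
  is written out as half of a second difference, because it has to be polynomial in further
  parameters.\<close>

definition square_form :: "'k::field_char_0 \<Rightarrow> 'k \<Rightarrow> ('k \<Rightarrow> 'k) \<Rightarrow> bool" where
  "square_form x c f \<longleftrightarrow> (\<forall>y. f y = f 0 + y * c + y * (x + y) * ((f 1 + f (- 1) - 2 * f 0) / 2))"

lemma square_formI:
  assumes "\<And>y. f y = t + y * c + y * (x + y) * q"
  shows "square_form x c f"
proof -
  have "f 0 = t" "f 1 = t + c + (1 + x) * q" "f (- 1) = t - c + (1 - x) * q"
    using assms[of 0] assms[of 1] assms[of "- 1"] by (simp_all add: algebra_simps)
  then have "(f 1 + f (- 1) - 2 * f 0) / 2 = q" by (simp add: field_simps)
  then show ?thesis using assms \<open>f 0 = t\<close> by (simp add: square_form_def)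
qed

lemma polyfun_eqI_except:
  assumes "polyfun f" "polyfun g" "\<And>x. x \<noteq> c \<Longrightarrow> f x = g x"
  shows "f x = g x"
proof -
  have s: "polyfun (\<lambda>x. h (x + c))" if "polyfun h" for h :: "'a \<Rightarrow> 'a"
    by (rule polyfun_compose[OF that]) (intro polyfun_add polyfun_id polyfun_const)
  show ?thesis
    using polyfun_eqI[OF s[OF assms(1)] s[OF assms(2)], of "x - c"] assms(3) by simp
qed

text \<open>Both sides are polynomial in \<open>x\<close>.\<close>

lemma square_form_extend:
  assumes "polyfun2 F" "polyfun c" "\<And>x. x \<noteq> 0 \<Longrightarrow> square_form x (c x) (F x)"
  shows "square_form x (c x) (F x)"
  unfolding square_form_def
proof
  fix y
  have F: "polyfun (\<lambda>x. F x z)" for z by (rule polyfun2_polyfun_fst[OF assms(1)])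
  show "F x y = F x 0 + y * c x + y * (x + y) * ((F x 1 + F x (- 1) - 2 * F x 0) / 2)"
  proof (rule polyfun_eqI[where x = x and f = "\<lambda>x. F x y"
        and g = "\<lambda>x. F x 0 + y * c x + y * (x + y) * ((F x 1 + F x (- 1) - 2 * F x 0) / 2)"])
    show "polyfun (\<lambda>x. F x y)" by (rule F)
    show "polyfun (\<lambda>x. F x 0 + y * c x + y * (x + y) * ((F x 1 + F x (- 1) - 2 * F x 0) / 2))"
      by (intro polyfun_add polyfun_diff polyfun_mult polyfun_divide polyfun_const polyfun_id F assms(2))
  qed (use assms(3) in \<open>unfold square_form_def, blast\<close>)
qed

lemma polyfun_split_unique:
  assumes "polyfun f" "polyfun g" "\<And>x. x * f x = x * g x"
  shows "f x = g x"
proof (rule polyfun_eqI[OF assms(1,2)])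
  fix x :: 'a assume "x \<noteq> 0"
  then show "f x = g x" using assms(3)[of x] by simp
qed

text \<open>The functions are \<open>p = \<phi>(a, v, v)\<close>, \<open>Q = \<phi>(a, e, v)\<close>, \<open>k0 = \<phi>(a, v, Lv)\<close>,
  \<open>k2 = \<phi>(a, v, e)\<close> (for \<open>a = v\<close>, their quotients by \<open>x\<close>), and the equation is the cocycle identity at \<open>(a, v, v, v)\<close> for
  \<open>\<lambda>\<^sub>1 + \<lambda>\<^sub>2 = 0\<close>.  There the term \<open>\<phi>(a\<^sub>xv, v, v)\<close> is evaluated at 0 in its first parameter,
  where it is known, and \<open>Q\<close> can be solved for.\<close>

lemma antidiagonal_step:
  fixes p k0 k2 Q :: "'k::field_char_0 \<Rightarrow> 'k \<Rightarrow> 'k" and d :: "'k \<Rightarrow> 'k"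
  assumes poly: "polyfun2 p" "polyfun2 k0" "polyfun2 k2" "polyfun2 Q"
    and eq: "\<And>x z. x * (d0 + z * d z) = x * z * Q x (z - x) +
      (k0 x 0 + (z - x) * p x 0 + (z - x) * z * k2 x 0) - (k0 x (- x) + z * p x (- x) + z * z * k2 x (- x))"
    and d: "polyfun d"
    and p': "polyfun2 p'" "\<And>x y. p x y = p x 0 + y * p' x y"
    and k2': "polyfun2 k2'" "\<And>x y. k2 x y = k2 x 0 + y * k2' x y"
  shows "Q x (z - x) = d z - (p' x (- x) - k2 x 0) - z * k2' x (- x)"
proof -
  obtain k0' where k0': "polyfun2 k0'" "\<And>x y. k0 x y = k0 x 0 + y * k0' x y"
    using polyfun2_split_snd[OF poly(2)] by blast
  have sub: "polyfun (\<lambda>x. f x (g x))" if "polyfun2 f" "polyfun g" for f :: "'k \<Rightarrow> 'k \<Rightarrow> 'k" and g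
    using polyfun2_compose[OF that(1) polyfun_id that(2)] .
  have neg: "polyfun (\<lambda>x. - x)" by (intro polyfun_uminus polyfun_id)
  have zx: "polyfun (\<lambda>x. z - x)" for z :: 'k by (intro polyfun_diff polyfun_id polyfun_const)
  have full: "d0 + z * d z = z * Q x (z - x) + k0' x (- x) + z * p' x (- x) - p x 0
      + z * z * k2' x (- x) - z * k2 x 0" for x z
  proof (rule polyfun_split_unique[where x = x and f = "\<lambda>x. d0 + z * d z" and
        g = "\<lambda>x. z * Q x (z - x) + k0' x (- x) + z * p' x (- x) - p x 0 + z * z * k2' x (- x) - z * k2 x 0"])
    show "polyfun (\<lambda>x. z * Q x (z - x) + k0' x (- x) + z * p' x (- x) - p x 0 + z * z * k2' x (- x) - z * k2 x 0)"
      by (intro polyfun_add polyfun_diff polyfun_mult polyfun_const sub[OF poly(4) zx] sub[OF k0'(1) neg]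
          sub[OF p'(1) neg] sub[OF k2'(1) neg] polyfun2_polyfun_fst[OF poly(1)] polyfun2_polyfun_fst[OF poly(3)])
    show "x * (d0 + z * d z) = x * (z * Q x (z - x) + k0' x (- x) + z * p' x (- x) - p x 0
      + z * z * k2' x (- x) - z * k2 x 0)" for x
      using eq[of x z] k0'(2)[of x "- x"] p'(2)[of x "- x"] k2'(2)[of x "- x"] by (simp add: algebra_simps)
  qed (rule polyfun_const)
  show ?thesis
  proof (rule polyfun_split_unique[where x = z and f = "\<lambda>z. Q x (z - x)" and
        g = "\<lambda>z. d z - (p' x (- x) - k2 x 0) - z * k2' x (- x)"])
    show "polyfun (\<lambda>z. Q x (z - x))"
      using polyfun2_compose[OF poly(4) polyfun_const[of x], of "\<lambda>z. z - x"]
      by (simp add: polyfun_diff polyfun_id polyfun_const)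
    show "polyfun (\<lambda>z. d z - (p' x (- x) - k2 x 0) - z * k2' x (- x))"
      by (intro polyfun_diff polyfun_mult polyfun_id polyfun_const d)
    show "z * Q x (z - x) = z * (d z - (p' x (- x) - k2 x 0) - z * k2' x (- x))" for z
    proof -
      have d0: "d0 = k0' x (- x) - p x 0" using full[of 0 x] by simp
      show ?thesis using full[of z x] unfolding d0 by (simp add: algebra_simps)
    qed
  qed
qed

text \<open>Here \<open>p\<close> and \<open>p'\<close> are \<open>\<phi>(e\<^sub>j, v, v)\<close> and \<open>\<phi>(e\<^sub>j\<^sub>+\<^sub>1, v, v)\<close>.  After normalisation the cocycle
  identity at \<open>(e\<^sub>j, v, v, v)\<close> involves only these and values of \<open>\<phi>(e\<^sub>j, \<cdot>, \<cdot>)\<close>.  The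
  antidiagonal determines \<open>Q\<close>, and \<open>x = 0\<close> then determines \<open>p'\<close> up to terms of the form
  \<open>t + y(x + y)q\<close>.\<close>

lemma square_form_quad_Suc:
  fixes p p' Q k0 k2 :: "'k::field_char_0 \<Rightarrow> 'k \<Rightarrow> 'k"
  assumes poly: "polyfun2 p" "polyfun2 p'" "polyfun2 Q" "polyfun2 k0" "polyfun2 k2"
    and eq: "\<And>x y z. x * p (x + y) z + y * p' (x + y) z = - (y * z) * Q x (y + z) + (x + y) * p x (y + z)
      + (k0 x 0 + (y + z) * p x 0 + (y + z) * (x + y + z) * k2 x 0)
      - (k0 x y + z * p x y + z * (x + y + z) * k2 x y)"
    and u: "polyfun u" "\<And>y. p 0 y = p 0 0 + y * u y"
    and u': "polyfun u'" "\<And>y. p' 0 y = p' 0 0 + y * u' y"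
  shows "square_form x (- u x) (\<lambda>y. p' x y - x * u (x + y) - y * u' (x + y) - u 0 * (x + y))"
proof -
  obtain q where q: "polyfun2 q" "\<And>x y. p x y = p x 0 + y * q x y"
    using polyfun2_split_snd[OF poly(1)] by blast
  obtain k0' where k0': "polyfun2 k0'" "\<And>x y. k0 x y = k0 x 0 + y * k0' x y"
    using polyfun2_split_snd[OF poly(4)] by blast
  obtain k2' where k2': "polyfun2 k2'" "\<And>x y. k2 x y = k2 x 0 + y * k2' x y"
    using polyfun2_split_snd[OF poly(5)] by blast
  have qu: "q 0 y = u y" for y
    by (rule polyfun_split_unique[OF polyfun2_polyfun_snd[OF q(1)] u(1)])
      (use q(2)[of 0] u(2) in \<open>metis add_left_cancel\<close>)
  have Q: "Q 0 z = u z - u' z - (u 0 - k2 0 0) - z * k2' 0 0" for z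
  proof -
    have "Q x (z - x) = (u z - u' z) - (q x (- x) - k2 x 0) - z * k2' x (- x)" for x z
    proof (rule antidiagonal_step[OF poly(1,4,5,3) _ polyfun_diff[OF u(1) u'(1)] q k2'])
      show "x * ((p 0 0 - p' 0 0) + z * (u z - u' z)) = x * z * Q x (z - x) +
        (k0 x 0 + (z - x) * p x 0 + (z - x) * z * k2 x 0) - (k0 x (- x) + z * p x (- x) + z * z * k2 x (- x))" for x z
        using eq[of x "- x" z] u(2)[of z] u'(2)[of z] by (simp add: algebra_simps)
    qed
    from this[of 0 z] show ?thesis by (simp add: qu)
  qed
  have "square_form x (- u x) (\<lambda>y. p' x y - x * u (x + y) - y * u' (x + y) - u 0 * (x + y))" if "x \<noteq> 0" for x
  proof (rule square_formI)
    fix y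
    have "x * p' x y = - (x * y) * (u (x + y) - u' (x + y) - (u 0 - k2 0 0) - (x + y) * k2' 0 0)
       + x * (p 0 0 + (x + y) * u (x + y))
       + (k0 0 0 + (x + y) * p 0 0 + (x + y) * (x + y) * k2 0 0)
       - (k0 0 0 + x * k0' 0 x + y * (p 0 0 + x * u x) + y * (x + y) * (k2 0 0 + x * k2' 0 x))"
      using eq[of 0 x y] u(2)[of "x + y"] u(2)[of x] k0'(2)[of 0 x] k2'(2)[of 0 x] Q[of "x + y"] by simp
    then have "x * (p' x y - x * u (x + y) - y * u' (x + y) - u 0 * (x + y)) =
      x * ((2 * p 0 0 - k0' 0 x + x * (k2 0 0 - u 0)) + y * (- u x) + y * (x + y) * (k2' 0 0 - k2' 0 x))"
      by (simp add: algebra_simps)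
    then show "p' x y - x * u (x + y) - y * u' (x + y) - u 0 * (x + y) =
      (2 * p 0 0 - k0' 0 x + x * (k2 0 0 - u 0)) + y * (- u x) + y * (x + y) * (k2' 0 0 - k2' 0 x)"
      using that by simp
  qed
  then show ?thesis
  proof (rule square_form_extend[where x = x and c = "\<lambda>x. - u x" and
        F = "\<lambda>x y. p' x y - x * u (x + y) - y * u' (x + y) - u 0 * (x + y)", rotated 2])
    have s: "polyfun2 (\<lambda>x y. g (x + y))" if "polyfun g" for g :: "'k \<Rightarrow> 'k"
      by (rule polyfun_compose2[OF that]) (intro polyfun2_add polyfun2_fst polyfun2_snd)
    show "polyfun2 (\<lambda>x y. p' x y - x * u (x + y) - y * u' (x + y) - u 0 * (x + y))"
      by (intro polyfun2_diff polyfun2_mult polyfun2_add polyfun2_fst polyfun2_snd polyfun2_const s u(1) u'(1) poly(2))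
    show "polyfun (\<lambda>x. - u x)" by (rule polyfun_uminus[OF u(1)])
  qed
qed

text \<open>The analogue for \<open>a = v\<close>.  After normalisation \<open>\<phi>(v, \<cdot>, \<cdot>)\<close> is divisible by its first
  parameter, and \<open>\<pi>\<close>, \<open>Q\<close>, \<open>k0\<close>, \<open>k2\<close> are the quotients; \<open>p\<close> is \<open>\<phi>(e\<^sub>0, v, v)\<close>.
  Eliminating \<open>p\<close> and \<open>Q\<close> as before leaves the cocycle identity as an equation for \<open>\<pi>\<close>,
  equivalently for \<open>\<omega>\<close>.  It determines the linear coefficient of \<open>\<omega>(x, y) - \<omega>(0, x + y)\<close> in \<open>y\<close>, and this
  differs from the required one by the constant \<open>w2 0 + W 0\<close>: here the obstruction enters.\<close>

lemma square_form_gen: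
  fixes \<pi> p Q k0 k2 \<omega> :: "'k::field_char_0 \<Rightarrow> 'k \<Rightarrow> 'k"
  assumes poly: "polyfun2 \<pi>" "polyfun2 p" "polyfun2 Q" "polyfun2 k0" "polyfun2 k2"
    and eq: "\<And>x y z. (x + y) * \<pi> (x + y) z - y * p (x + y) z = - (y * z) * Q x (y + z) + (x + y) * \<pi> x (y + z)
      + (k0 x 0 + (y + z) * \<pi> x 0 + (y + z) * (x + y + z) * k2 x 0)
      - (k0 x y + z * \<pi> x y + z * (x + y + z) * k2 x y)"
    and u: "polyfun u" "\<And>y. p 0 y = p 0 0 + y * u y"
    and w: "polyfun w1" "polyfun w2" "\<And>y. \<pi> 0 y = w0 + y * w1 y" "\<And>y. w1 y = w1 0 + y * w2 y"
    and \<omega>: "polyfun2 \<omega>" "\<And>x y. \<pi> x y = w0 + (x + y) * w1 (x + y) + x * \<omega> x y"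
    and W: "polyfun W" "\<And>y. \<omega> 0 y = W0 + y * W y"
    and obstruction: "w2 0 + W 0 = 0"
  shows "square_form x (- x * W x) (\<lambda>y. p x y - x * ((x + y) * W (x + y)) - y * u (x + y))" (is ?quad)
    and "square_form x (- x * x * W x - x * w1 x)
      (\<lambda>y. x * (\<pi> x y - (x + y) * (x + y) * W (x + y) - (x + y) * w1 (x + y) + y * ((x + y) * W (x + y)))
        - w1 0 * ((x + y) * (x + y)))" (is ?gen)
proof -
  obtain q where q: "polyfun2 q" "\<And>x y. \<pi> x y = \<pi> x 0 + y * q x y"
    using polyfun2_split_snd[OF poly(1)] by blast
  obtain k0' where k0': "polyfun2 k0'" "\<And>x y. k0 x y = k0 x 0 + y * k0' x y"
    using polyfun2_split_snd[OF poly(4)] by blast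
  obtain k2' where k2': "polyfun2 k2'" "\<And>x y. k2 x y = k2 x 0 + y * k2' x y"
    using polyfun2_split_snd[OF poly(5)] by blast
  obtain \<omega>' where \<omega>': "polyfun2 \<omega>'" "\<And>x y. \<omega> x y = \<omega> x 0 + y * \<omega>' x y"
    using polyfun2_split_snd[OF \<omega>(1)] by blast
  have sub: "polyfun (\<lambda>x. f x (g x))" if "polyfun2 f" "polyfun g" for f :: "'k \<Rightarrow> 'k \<Rightarrow> 'k" and g
    using polyfun2_compose[OF that(1) polyfun_id that(2)] .
  have neg: "polyfun (\<lambda>x. - x)" by (intro polyfun_uminus polyfun_id)
  have qw: "q 0 y = w1 y" for y
    by (rule polyfun_split_unique[OF polyfun2_polyfun_snd[OF q(1)] w(1)])
      (metis add_left_cancel q(2) w(3) mult_zero_left add.right_neutral)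
  have \<omega>W: "\<omega>' 0 y = W y" for y
    by (rule polyfun_split_unique[OF polyfun2_polyfun_snd[OF \<omega>'(1)] W(1)])
      (metis add_left_cancel \<omega>'(2) W(2) mult_zero_left add.right_neutral)
  have Q: "Q x (z - x) = u z - (q x (- x) - k2 x 0) - z * k2' x (- x)" for x z
  proof (rule antidiagonal_step[OF poly(1,4,5,3) _ u(1) q k2'])
    show "x * (p 0 0 + z * u z) = x * z * Q x (z - x) +
      (k0 x 0 + (z - x) * \<pi> x 0 + (z - x) * z * k2 x 0) - (k0 x (- x) + z * \<pi> x (- x) + z * z * k2 x (- x))" for x z
      using eq[of x "- x" z] u(2)[of z] by (simp add: algebra_simps)
  qed
  define z0 where "z0 x = w0 + x * k2 0 0 - k0' 0 x" for x
  define z2 where "z2 x = k2' 0 0 - k2' 0 x" for x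
  have p: "p x y = \<pi> x y - w0 - (x + y) * w1 (x + y) + y * u (x + y) -
      (z0 x + y * (w1 0 - w1 x) + y * (x + y) * z2 x)" for x y
  proof (rule polyfun_split_unique[where x = x and f = "\<lambda>x. p x y" and
        g = "\<lambda>x. \<pi> x y - w0 - (x + y) * w1 (x + y) + y * u (x + y) -
      (z0 x + y * (w1 0 - w1 x) + y * (x + y) * z2 x)"])
    have s: "polyfun (\<lambda>x. g (x + y))" if "polyfun g" for g :: "'k \<Rightarrow> 'k"
      by (rule polyfun_compose[OF that]) (intro polyfun_add polyfun_id polyfun_const)
    show "polyfun (\<lambda>x. p x y)" by (rule polyfun2_polyfun_fst[OF poly(2)])
    show "polyfun (\<lambda>x. \<pi> x y - w0 - (x + y) * w1 (x + y) + y * u (x + y) -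
      (z0 x + y * (w1 0 - w1 x) + y * (x + y) * z2 x))"
      unfolding z0_def z2_def
      by (intro polyfun_add polyfun_diff polyfun_mult polyfun_id polyfun_const s u(1) w(1)
          polyfun2_polyfun_fst[OF poly(1)] polyfun2_polyfun_snd[OF k0'(1)] polyfun2_polyfun_snd[OF k2'(1)])
    fix x
    have "x * \<pi> x y - x * p x y = - (x * y) * (u (x + y) - (w1 0 - k2 0 0) - (x + y) * k2' 0 0)
       + x * (w0 + (x + y) * w1 (x + y))
       + (k0 0 0 + (x + y) * w0 + (x + y) * (x + y) * k2 0 0)
       - (k0 0 0 + x * k0' 0 x + y * (w0 + x * w1 x) + y * (x + y) * (k2 0 0 + x * k2' 0 x))"
      using eq[of 0 x y] w(3)[of "x + y"] w(3)[of x] w(3)[of 0] k0'(2)[of 0 x] k2'(2)[of 0 x] Q[of 0 "x + y"]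
      by (simp add: qw)
    then show "x * p x y = x * (\<pi> x y - w0 - (x + y) * w1 (x + y) + y * u (x + y) -
      (z0 x + y * (w1 0 - w1 x) + y * (x + y) * z2 x))"
      by (simp add: algebra_simps z0_def z2_def)
  qed
  have \<omega>_form: "square_form s (w2 0 - w2 s + W 0 - W s) (\<lambda>y. \<omega> s y - \<omega> 0 (s + y))" if s: "s \<noteq> 0" for s
  proof -
    \<comment> \<open>The equation for the parameters l and s - l, divided by l, has the required form in y for l different
      from 0; N and G are the quotients, which extend to l = 0.\<close>
    define N where "N l = s * (w2 l - w2 s) + (s - l) * (\<omega>' l (- l) - \<omega>' l (s - l))" for l
    define G where "G l y = s * (\<omega> s y - \<omega> l (s + y - l))" for l y
    have square_form: "square_form s (N l) (G l)" if l: "l \<noteq> 0" for l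
    proof (rule square_formI)
      fix y
      define m where "m = s - l"
      have sl: "s = l + m" by (simp add: m_def)
      have e1: "l * \<pi> s y + m * (w0 + (s + y) * w1 (s + y) - y * u (s + y) + (z0 s + y * (w1 0 - w1 s) + y * (s + y) * z2 s)) =
         - (m * y) * (u (s + y) - (q l (- l) - k2 l 0) - (s + y) * k2' l (- l)) + s * \<pi> l (m + y)
         + (k0 l 0 + (m + y) * \<pi> l 0 + (m + y) * (s + y) * k2 l 0)
         - (k0 l m + y * \<pi> l m + y * (s + y) * k2 l m)"
      proof -
        have P: "w0 + (s + y) * w1 (s + y) - y * u (s + y) + (z0 s + y * (w1 0 - w1 s) + y * (s + y) * z2 s) =
            \<pi> s y - p s y"
          unfolding p[of s y] by simp
        have Q': "u (s + y) - (q l (- l) - k2 l 0) - (s + y) * k2' l (- l) = Q l (m + y)"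
          using Q[of l "s + y"] by (simp add: m_def algebra_simps)
        show ?thesis
          using eq[of l m y] unfolding P Q' sl[symmetric] by (simp add: sl algebra_simps)
      qed
      have "l * q l (- l) = l * w1 l + l * (l * \<omega>' l (- l))"
        using q(2)[of l "- l"] \<omega>(2)[of l 0] \<omega>(2)[of l "- l"] \<omega>'(2)[of l "- l"] by (simp add: algebra_simps)
      then have ql: "q l (- l) = w1 l + l * \<omega>' l (- l)" using l by (metis distrib_left mult_left_cancel)
      have e2: "\<pi> s y = w0 + (s + y) * w1 (s + y) + s * \<omega> s y" by (rule \<omega>(2))
      have e3: "\<pi> l (m + y) = w0 + (s + y) * w1 (s + y) + l * \<omega> l (s + y - l)"
        using \<omega>(2)[of l "m + y"] by (simp add: sl algebra_simps)
      have e4: "\<pi> l 0 = w0 + l * w1 l + l * \<omega> l 0" using \<omega>(2)[of l 0] by simp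
      have e5: "\<pi> l m = w0 + s * w1 s + l * (\<omega> l 0 + m * \<omega>' l m)"
        using \<omega>(2)[of l m] \<omega>'(2)[of l m] by (simp add: sl)
      have w1l: "w1 l = w1 0 + l * w2 l" and w1s: "w1 s = w1 0 + s * w2 s" using w(4) by blast+
      define t where "t = k0 l 0 + (s - l) * \<pi> l 0 + (s - l) * s * k2 l 0 - k0 l (s - l) - (s - l) * z0 s"
      define q2 where "q2 = k2 l 0 - k2 l (s - l) - (s - l) * z2 s + (s - l) * k2' l (- l)"
      have "- m * (w1 0 - w1 s) + m * (q l (- l) - k2 l 0) + \<pi> l 0 + m * k2 l 0 - \<pi> l m = l * N l"
        unfolding ql e4 e5 w1l w1s N_def m_def[symmetric] by (simp add: sl algebra_simps)
      moreover have "l * s * (\<omega> s y - \<omega> l (s + y - l)) = t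
          + y * (- m * (w1 0 - w1 s) + m * (q l (- l) - k2 l 0) + \<pi> l 0 + m * k2 l 0 - \<pi> l m)
          + y * (s + y) * q2"
        using e1 unfolding e2 e3 t_def q2_def m_def[symmetric] by (simp add: sl algebra_simps)
      ultimately have "l * s * (\<omega> s y - \<omega> l (s + y - l)) = t + y * (l * N l) + y * (s + y) * q2" by simp
      then have "l * G l y = t + y * (l * N l) + y * (s + y) * q2" unfolding G_def by (simp only: mult.assoc)
      then have "G l y = t / l + y * N l + y * (s + y) * (q2 / l)" using l by (simp add: field_simps)
      then show "G l y = (k0 l 0 + (s - l) * \<pi> l 0 + (s - l) * s * k2 l 0 - k0 l (s - l) - (s - l) * z0 s) / l
         + y * N l + y * (s + y) * ((k2 l 0 - k2 l (s - l) - (s - l) * z2 s + (s - l) * k2' l (- l)) / l)"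
        unfolding t_def q2_def .
    qed
    have "square_form s (N 0) (G 0)"
      unfolding square_form_def
    proof
      fix y
      have G: "polyfun (\<lambda>l. G l z)" for z
        unfolding G_def by (intro polyfun_mult polyfun_diff polyfun_const sub[OF \<omega>(1)] polyfun_id)
      have sl: "polyfun (\<lambda>l. s - l)" by (intro polyfun_diff polyfun_id polyfun_const)
      have N: "polyfun N"
        unfolding N_def[abs_def]
        by (intro polyfun_mult polyfun_add polyfun_diff polyfun_const polyfun_id w(2) sub[OF \<omega>'(1)] neg sl)
      show "G 0 y = G 0 0 + y * N 0 + y * (s + y) * ((G 0 1 + G 0 (- 1) - 2 * G 0 0) / 2)"
      proof (rule polyfun_eqI[where x = 0 and f = "\<lambda>l. G l y" and
            g = "\<lambda>l. G l 0 + y * N l + y * (s + y) * ((G l 1 + G l (- 1) - 2 * G l 0) / 2)"])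
        show "polyfun (\<lambda>l. G l y)" by (rule G)
        show "polyfun (\<lambda>l. G l 0 + y * N l + y * (s + y) * ((G l 1 + G l (- 1) - 2 * G l 0) / 2))"
          by (intro polyfun_add polyfun_diff polyfun_mult polyfun_divide polyfun_const G N)
      qed (use square_form in \<open>unfold square_form_def, blast\<close>)
    qed
    note G0 = this[unfolded square_form_def, rule_format]
    have N0: "N 0 = s * (w2 0 - w2 s + W 0 - W s)" by (simp add: N_def \<omega>W algebra_simps)
    have *: "s * (\<omega> s y - \<omega> 0 (s + y)) = s * (\<omega> s 0 - \<omega> 0 s) + y * (s * (w2 0 - w2 s + W 0 - W s))
        + y * (s + y) * ((s * (\<omega> s 1 - \<omega> 0 (s + 1)) + s * (\<omega> s (- 1) - \<omega> 0 (s - 1)) - 2 * (s * (\<omega> s 0 - \<omega> 0 s))) / 2)" for y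
      using G0[of y] unfolding G_def N0 by simp
    show ?thesis
    proof (rule square_formI)
      fix y
      have "s * (\<omega> s y - \<omega> 0 (s + y)) = s * ((\<omega> s 0 - \<omega> 0 s) + y * (w2 0 - w2 s + W 0 - W s)
        + y * (s + y) * (((\<omega> s 1 - \<omega> 0 (s + 1)) + (\<omega> s (- 1) - \<omega> 0 (s - 1)) - 2 * (\<omega> s 0 - \<omega> 0 s)) / 2))"
        using *[of y] by (simp add: field_simps)
      then show "\<omega> s y - \<omega> 0 (s + y) = (\<omega> s 0 - \<omega> 0 s) + y * (w2 0 - w2 s + W 0 - W s)
        + y * (s + y) * (((\<omega> s 1 - \<omega> 0 (s + 1)) + (\<omega> s (- 1) - \<omega> 0 (s - 1)) - 2 * (\<omega> s 0 - \<omega> 0 s)) / 2)"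
        using s by simp
    qed
  qed
  have \<omega>_eq: "\<exists>t r. \<forall>y. \<omega> x y = W0 + (x + y) * W (x + y) + t + y * (- (w2 x + W x)) + y * (x + y) * r" if "x \<noteq> 0" for x
  proof -
    have "w2 0 - w2 x + W 0 - W x = - (w2 x + W x)" using obstruction by (simp add: algebra_simps)
    then have "\<omega> x y - \<omega> 0 (x + y) = (\<omega> x 0 - \<omega> 0 x) + y * (- (w2 x + W x)) + y * (x + y) *
        ((\<omega> x 1 - \<omega> 0 (x + 1) + (\<omega> x (- 1) - \<omega> 0 (x - 1)) - 2 * (\<omega> x 0 - \<omega> 0 x)) / 2)" for y
      using \<omega>_form[OF that, unfolded square_form_def, rule_format, of y] by simp
    then have "\<omega> x y = W0 + (x + y) * W (x + y) + (\<omega> x 0 - \<omega> 0 x) + y * (- (w2 x + W x)) + y * (x + y) *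
        ((\<omega> x 1 - \<omega> 0 (x + 1) + (\<omega> x (- 1) - \<omega> 0 (x - 1)) - 2 * (\<omega> x 0 - \<omega> 0 x)) / 2)" for y
      using W(2)[of "x + y"] by (simp add: algebra_simps)
    then show ?thesis by blast
  qed
  have sum: "polyfun2 (\<lambda>x y. g (x + y))" if "polyfun g" for g :: "'k \<Rightarrow> 'k"
    by (rule polyfun_compose2[OF that]) (intro polyfun2_add polyfun2_fst polyfun2_snd)
  show ?quad
  proof (rule square_form_extend[where x = x and c = "\<lambda>x. - x * W x" and
        F = "\<lambda>x y. p x y - x * ((x + y) * W (x + y)) - y * u (x + y)"])
    show "polyfun2 (\<lambda>x y. p x y - x * ((x + y) * W (x + y)) - y * u (x + y))"
      by (intro polyfun2_diff polyfun2_mult polyfun2_add polyfun2_fst polyfun2_snd sum u(1) W(1) poly(2))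
    show "polyfun (\<lambda>x. - x * W x)" by (intro polyfun_mult polyfun_uminus polyfun_id W(1))
    fix x :: 'k assume x: "x \<noteq> 0"
    obtain t r where t: "\<And>y. \<omega> x y = W0 + (x + y) * W (x + y) + t + y * (- (w2 x + W x)) + y * (x + y) * r"
      using \<omega>_eq[OF x] by blast
    show "square_form x (- x * W x) (\<lambda>y. p x y - x * ((x + y) * W (x + y)) - y * u (x + y))"
    proof (rule square_formI)
      fix y
      show "p x y - x * ((x + y) * W (x + y)) - y * u (x + y) =
        (x * W0 + x * t - z0 x) + y * (- x * W x) + y * (x + y) * (x * r - z2 x)"
        unfolding p \<omega>(2)[of x y] t[of y] using w(4)[of x] by (simp add: algebra_simps)
    qed
  qed
  show ?gen
  proof (rule square_form_extend[where x = x and c = "\<lambda>x. - x * x * W x - x * w1 x" and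
        F = "\<lambda>x y. x * (\<pi> x y - (x + y) * (x + y) * W (x + y) - (x + y) * w1 (x + y)
          + y * ((x + y) * W (x + y))) - w1 0 * ((x + y) * (x + y))"])
    show "polyfun2 (\<lambda>x y. x * (\<pi> x y - (x + y) * (x + y) * W (x + y) - (x + y) * w1 (x + y) + y * ((x + y) * W (x + y)))
        - w1 0 * ((x + y) * (x + y)))"
      by (intro polyfun2_diff polyfun2_mult polyfun2_add polyfun2_fst polyfun2_snd polyfun2_const sum w(1) W(1) poly(1))
    show "polyfun (\<lambda>x. - x * x * W x - x * w1 x)"
      by (intro polyfun_diff polyfun_mult polyfun_uminus polyfun_id W(1) w(1))
    fix x :: 'k assume x: "x \<noteq> 0"
    obtain t r where t: "\<And>y. \<omega> x y = W0 + (x + y) * W (x + y) + t + y * (- (w2 x + W x)) + y * (x + y) * r"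
      using \<omega>_eq[OF x] by blast
    show "square_form x (- x * x * W x - x * w1 x) (\<lambda>y. x * (\<pi> x y - (x + y) * (x + y) * W (x + y) - (x + y) * w1 (x + y)
        + y * ((x + y) * W (x + y))) - w1 0 * ((x + y) * (x + y)))"
    proof (rule square_formI)
      fix y
      show "x * (\<pi> x y - (x + y) * (x + y) * W (x + y) - (x + y) * w1 (x + y) + y * ((x + y) * W (x + y)))
          - w1 0 * ((x + y) * (x + y)) =
        (x * w0 + x * x * (W0 + t) - w1 0 * x * x) + y * (- x * x * W x - x * w1 x) + y * (x + y) * (x * x * r - w1 0)"
        unfolding \<omega>(2)[of x y] t[of y] using w(4)[of x] by (simp add: algebra_simps)
    qed
  qed
qed

section \<open>Every cocycle without obstruction is a coboundary\<close>

lemma functionalI: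
  assumes "\<And>a b. f (a + b) = f a + f b" "\<And>r a. f (U3_scale r a) = r * f a"
  shows "functional f"
  using assms by (simp add: functional_def)

lemma functional_lprod_left: "functional f \<Longrightarrow> functional (\<lambda>a. f (lprod_at x a b))"
  by (rule functionalI) (simp_all add: U3_linear functional_simps)

lemma functional_lprod_right: "functional f \<Longrightarrow> functional (\<lambda>b. f (lprod_at x a b))"
  by (rule functionalI) (simp_all add: lprod_at_add_right lprod_at_scale_right functional_simps)

lemma functional_left_gen: "functional f \<Longrightarrow> functional (\<lambda>a. f (left_gen a))"
  by (rule functionalI) (simp_all add: left_gen_add left_gen_scale functional_simps)

lemma functional_add: "functional f \<Longrightarrow> functional g \<Longrightarrow> functional (\<lambda>a. f a + g a)"
  by (rule functionalI) (simp_all add: functional_simps algebra_simps)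

lemma functional_diff: "functional f \<Longrightarrow> functional g \<Longrightarrow> functional (\<lambda>a. f a - g a)"
  by (rule functionalI) (simp_all add: functional_simps algebra_simps)

lemma functional_mult: "functional f \<Longrightarrow> functional (\<lambda>a. c * f a)"
  by (rule functionalI) (simp_all add: functional_simps algebra_simps)

lemma functional_0: "functional (\<lambda>a. 0)"
  by (rule functionalI) simp_all

lemma U3_basis_induct_pred:
  assumes "P 0" "\<And>a b. P a \<Longrightarrow> P b \<Longrightarrow> P (a + b)" "\<And>r a. P a \<Longrightarrow> P (U3_scale r a)"
    and "\<And>a. P a \<Longrightarrow> P (U3_der a)"
    and "\<And>k. P ((left_gen ^^ k) U3_gen)" "\<And>k j. P ((left_gen ^^ k) (quad j))"
  shows "P a"
proof -
  have "U3.subspace {a. P a}" unfolding U3.subspace_def using assms(1-3) by blast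
  then have "a \<in> {a. P a}" by (rule U3_basis_induct) (use assms(4-6) in auto)
  then show ?thesis by simp
qed

lemma U3_functional_eqI:
  assumes f: "functional f" "\<And>a. f (U3_der a) = m * f a"
    and g: "functional g" "\<And>a. g (U3_der a) = m * g a"
    and "\<And>k. f ((left_gen ^^ k) U3_gen) = g ((left_gen ^^ k) U3_gen)"
    and "\<And>k j. f ((left_gen ^^ k) (quad j)) = g ((left_gen ^^ k) (quad j))"
  shows "f a = g a"
  by (induction a rule: U3_basis_induct_pred) (simp_all add: functional_simps f g assms)

lemma U3_polyfunI:
  assumes "\<And>x. functional (\<lambda>a. f a x)" "\<And>a x. f (U3_der a) x = m x * f a x" "polyfun m"
    and "\<And>k. polyfun (f ((left_gen ^^ k) U3_gen))" "\<And>k j. polyfun (f ((left_gen ^^ k) (quad j)))"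
  shows "polyfun (f a)"
proof (induction a rule: U3_basis_induct_pred)
  case 1
  have "f 0 = (\<lambda>x. 0)" using functional_simps(5)[OF assms(1)] by auto
  then show ?case by (simp add: polyfun_const)
next
  case (2 a b)
  have "f (a + b) = (\<lambda>x. f a x + f b x)" using functional_simps(1)[OF assms(1)] by auto
  with 2 show ?case by (simp add: polyfun_add)
next
  case (3 r a)
  have "f (U3_scale r a) = (\<lambda>x. r * f a x)" using functional_simps(2)[OF assms(1)] by auto
  with 3 show ?case by (simp add: polyfun_mult polyfun_const)
next
  case (4 a)
  have "f (U3_der a) = (\<lambda>x. m x * f a x)" using assms(2) by auto
  with 4 show ?case by (simp add: polyfun_mult assms(3))
qed (rule assms(4,5))+

text \<open>A family of functionals, indexed so that it can serve as a cochain in its remaining arguments.\<close>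

lemma U3_free_family:
  fixes \<mu> :: "'b \<Rightarrow> 'k::field_char_0"
  obtains f :: "'k U3 \<Rightarrow> 'b \<Rightarrow> 'k" where "\<And>b. functional (\<lambda>a. f a b)" "\<And>a b. f (U3_der a) b = \<mu> b * f a b"
    "\<And>k b. f ((left_gen ^^ k) U3_gen) b = g k b" "\<And>k j b. f ((left_gen ^^ k) (quad j)) b = h k j b"
proof -
  have ex: "\<exists>l. functional l \<and> (\<forall>a. l (U3_der a) = \<mu> b * l a) \<and> (\<forall>k. l ((left_gen ^^ k) U3_gen) = g k b) \<and>
      (\<forall>k j. l ((left_gen ^^ k) (quad j)) = h k j b)" for b
    by (rule U3_free[of "\<mu> b" "\<lambda>k. g k b" "\<lambda>k j. h k j b"]) blast
  define l where "l b = (SOME l. functional l \<and> (\<forall>a. l (U3_der a) = \<mu> b * l a) \<and> (\<forall>k. l ((left_gen ^^ k) U3_gen) = g k b) \<and>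
      (\<forall>k j. l ((left_gen ^^ k) (quad j)) = h k j b))" for b
  have "functional (l b)" "l b (U3_der a) = \<mu> b * l b a" "l b ((left_gen ^^ k) U3_gen) = g k b"
    "l b ((left_gen ^^ k) (quad j)) = h k j b" for a b k j
    using someI_ex[OF ex[of b]] unfolding l_def by blast+
  then show ?thesis by (intro that[of "\<lambda>a b. l b a"]) simp_all
qed

lemma cochain2D:
  assumes "cochain2 \<psi>"
  shows "functional (\<lambda>a. \<psi> a b x)" "functional (\<lambda>b. \<psi> a b x)" "\<psi> (U3_der a) b x = - x * \<psi> a b x"
    "\<psi> a (U3_der b) x = x * \<psi> a b x" "polyfun (\<psi> a b)"
  using assms by (simp_all add: cochain2_def)

lemma cochain3D:
  assumes "cochain3 \<phi>"
  shows "functional (\<lambda>a. \<phi> a b c x y)" "functional (\<lambda>b. \<phi> a b c x y)" "functional (\<lambda>c. \<phi> a b c x y)"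
    "\<phi> (U3_der a) b c x y = - x * \<phi> a b c x y" "\<phi> a (U3_der b) c x y = - y * \<phi> a b c x y"
    "\<phi> a b (U3_der c) x y = (x + y) * \<phi> a b c x y" "polyfun2 (\<phi> a b c)"
  using assms by (simp_all add: cochain3_def)

definition cocycle3 :: "('k::field_char_0 U3 \<Rightarrow> 'k U3 \<Rightarrow> 'k U3 \<Rightarrow> 'k \<Rightarrow> 'k \<Rightarrow> 'k) \<Rightarrow> bool" where
  "cocycle3 \<phi> \<longleftrightarrow> cochain3 \<phi> \<and> (\<forall>a b c d x y z. diff3 \<phi> a b c d x y z = 0)"

lemma cocycle3_eq:
  assumes "cocycle3 \<phi>"
  shows "\<phi> a (lprod_at y b c) d x (y + z) = \<phi> (lprod_at x a b) c d (x + y) z + \<phi> a b (lprod_at z c d) x y"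
proof -
  have "diff3 \<phi> a b c d x y z = 0" using assms by (simp add: cocycle3_def)
  then show ?thesis by (simp add: diff3_def algebra_simps)
qed

lemma polyfun2_lprod:
  assumes "\<And>u. polyfun2 (g u)" "\<And>x y. functional (\<lambda>u. g u x y)"
  shows "polyfun2 (\<lambda>x y. g (lprod_at x a b) x y)" and "polyfun2 (\<lambda>x y. g (lprod_at y a b) x y)"
  unfolding functional_lprod_at[OF assms(2)]
  by (intro polyfun2_sum polyfun2_mult polyfun2_power polyfun2_fst polyfun2_snd assms(1))+

lemma polyfun_lprod:
  assumes "\<And>u. polyfun (g u)" "\<And>x. functional (\<lambda>u. g u x)"
  shows "polyfun (\<lambda>x. g (lprod_at x a b) x)"
  unfolding functional_lprod_at[OF assms(2)]
  by (intro polyfun_sum polyfun_mult polyfun_power polyfun_id assms(1))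

lemma cocycle3_diff2:
  assumes "cochain2 \<psi>"
  shows "cocycle3 (diff2 \<psi>)"
proof -
  note D = cochain2D[OF assms]
  have "cochain3 (diff2 \<psi>)"
    unfolding cochain3_def
  proof (intro conjI allI)
    fix a b c and x y :: 'a
    show "functional (\<lambda>a. diff2 \<psi> a b c x y)"
      unfolding diff2_def by (intro functional_diff functional_lprod_left D)
    show "functional (\<lambda>b. diff2 \<psi> a b c x y)"
      unfolding diff2_def
      using functional_lprod_left[OF D(2)] functional_lprod_right[OF D(1)] by (intro functional_diff)
    show "functional (\<lambda>c. diff2 \<psi> a b c x y)"
      unfolding diff2_def
      using functional_lprod_right[OF D(2)] D(2) by (intro functional_diff)
    show "diff2 \<psi> (U3_der a) b c x y = - x * diff2 \<psi> a b c x y"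
      by (simp add: diff2_def D lprod_at_der_left functional_simps[OF D(1)] algebra_simps)
    show "diff2 \<psi> a (U3_der b) c x y = - y * diff2 \<psi> a b c x y"
      by (simp add: diff2_def D lprod_at_der_left lprod_at_der_right functional_simps[OF D(1)]
          functional_simps[OF D(2)] algebra_simps)
    show "diff2 \<psi> a b (U3_der c) x y = (x + y) * diff2 \<psi> a b c x y"
      by (simp add: diff2_def D lprod_at_der_right functional_simps[OF D(2)] algebra_simps)
    have 1: "polyfun2 (\<lambda>x y. \<psi> a u x)" for u
      by (rule polyfun_compose2[OF D(5) polyfun2_fst])
    have 2: "polyfun2 (\<lambda>x y. \<psi> u c (x + y))" for u
      by (rule polyfun_compose2[OF D(5)]) (intro polyfun2_add polyfun2_fst polyfun2_snd)
    show "polyfun2 (diff2 \<psi> a b c)"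
      unfolding diff2_def[abs_def]
      using polyfun2_lprod(2)[of "\<lambda>u x y. \<psi> a u x", OF 1 D(2)]
        polyfun2_lprod(1)[of "\<lambda>u x y. \<psi> u c (x + y)", OF 2 D(1)]
      by (intro polyfun2_diff)
  qed
  moreover have "diff3 (diff2 \<psi>) a b c d x y z = 0" for a b c d x y z
    by (simp add: diff3_def diff2_def lprod_at_assoc algebra_simps)
  ultimately show ?thesis by (simp add: cocycle3_def)
qed

lemma cocycle3_add:
  assumes "cocycle3 \<phi>" "cocycle3 \<chi>"
  shows "cocycle3 (\<lambda>a b c x y. \<phi> a b c x y + r * \<chi> a b c x y)"
proof -
  have c: "cochain3 \<phi>" "cochain3 \<chi>" using assms by (simp_all add: cocycle3_def)
  note D = cochain3D[OF c(1)] and E = cochain3D[OF c(2)]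
  have "cochain3 (\<lambda>a b c x y. \<phi> a b c x y + r * \<chi> a b c x y)"
    unfolding cochain3_def
    by (intro conjI allI functional_add functional_mult polyfun2_add polyfun2_mult polyfun2_const D E)
      (simp_all add: D E algebra_simps)
  moreover have "diff3 (\<lambda>a b c x y. \<phi> a b c x y + r * \<chi> a b c x y) a b c d x y z =
      diff3 \<phi> a b c d x y z + r * diff3 \<chi> a b c d x y z" for a b c d x y z
    by (simp add: diff3_def algebra_simps)
  ultimately show ?thesis using assms by (simp add: cocycle3_def)
qed

text \<open>In this form all terms with \<open>La\<close> in the first argument drop out of the cocycle identity at
  \<open>(a, v, v, v)\<close>, so that for \<open>a = e\<^sub>j\<close> it relates \<open>e\<^sub>j\<close> to \<open>e\<^sub>j\<^sub>+\<^sub>1\<close> only, and for \<open>a = v\<close> it relates \<open>v\<close> to \<open>e\<^sub>0\<close> only.\<close>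

definition left_normal :: "('k::field_char_0 U3 \<Rightarrow> 'k U3 \<Rightarrow> 'k U3 \<Rightarrow> 'k \<Rightarrow> 'k \<Rightarrow> 'k) \<Rightarrow> bool" where
  "left_normal \<phi> \<longleftrightarrow> (\<forall>a b c x y. \<phi> (left_gen a) b c x y = 0) \<and> (\<forall>b c y. \<phi> U3_gen b c 0 y = 0)"

text \<open>Prescribe \<open>\<psi>(La, c) = \<phi>\<^sub>0\<^sub>,\<^sub>x(v, a, c)\<close> and \<open>\<psi> = 0\<close> for \<open>a = v\<close> and \<open>a = e\<^sub>j\<close>.  The cocycle
  identity for the arguments \<open>v, a, b, c\<close> with \<open>\<lambda>\<^sub>1 = 0\<close> then expresses \<open>\<phi>(La, b, c)\<close> through
  \<open>\<psi>\<close>.\<close>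

lemma left_normalize:
  fixes \<phi> :: "'k::field_char_0 U3 \<Rightarrow> _"
  assumes "cocycle3 \<phi>"
  obtains \<psi> where "cochain2 \<psi>" "left_normal (\<lambda>a b c x y. \<phi> a b c x y + diff2 \<psi> a b c x y)"
proof -
  note D = cochain3D[OF assms[unfolded cocycle3_def, THEN conjunct1]]
  obtain f :: "'k U3 \<Rightarrow> 'k U3 \<times> 'k \<Rightarrow> 'k" where f: "\<And>b. functional (\<lambda>a. f a b)"
    "\<And>a b. f (U3_der a) b = - snd b * f a b"
    "\<And>k b. f ((left_gen ^^ k) U3_gen) b =
      (case k of 0 \<Rightarrow> 0 | Suc k \<Rightarrow> \<phi> U3_gen ((left_gen ^^ k) U3_gen) (fst b) 0 (snd b))"
    "\<And>k j b. f ((left_gen ^^ k) (quad j)) b =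
      (case k of 0 \<Rightarrow> 0 | Suc k \<Rightarrow> \<phi> U3_gen ((left_gen ^^ k) (quad j)) (fst b) 0 (snd b))"
    by (rule U3_free_family[of "\<lambda>b. - snd b"]) (rule that)
  define \<psi> where "\<psi> a c x = f a (c, x)" for a c x
  have \<psi>: "functional (\<lambda>a. \<psi> a c x)" "\<psi> (U3_der a) c x = - x * \<psi> a c x"
    "\<psi> ((left_gen ^^ k) U3_gen) c x = (case k of 0 \<Rightarrow> 0 | Suc k \<Rightarrow> \<phi> U3_gen ((left_gen ^^ k) U3_gen) c 0 x)"
    "\<psi> ((left_gen ^^ k) (quad j)) c x = (case k of 0 \<Rightarrow> 0 | Suc k \<Rightarrow> \<phi> U3_gen ((left_gen ^^ k) (quad j)) c 0 x)"
    for a c x k j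
    using f by (simp_all add: \<psi>_def split: nat.split)
  note lin = functional_simps[OF \<psi>(1)]
  have L: "\<psi> (left_gen a) c x = \<phi> U3_gen a c 0 x" for a c x
  proof (rule U3_functional_eqI[of "\<lambda>a. \<psi> (left_gen a) c x" "- x" "\<lambda>a. \<phi> U3_gen a c 0 x"])
    show "functional (\<lambda>a. \<psi> (left_gen a) c x)" by (rule functional_left_gen[OF \<psi>(1)])
    show "\<psi> (left_gen ((left_gen ^^ k) U3_gen)) c x = \<phi> U3_gen ((left_gen ^^ k) U3_gen) c 0 x" for k
      using \<psi>(3)[of "Suc k"] by simp
    show "\<psi> (left_gen ((left_gen ^^ k) (quad j))) c x = \<phi> U3_gen ((left_gen ^^ k) (quad j)) c 0 x" for k j
      using \<psi>(4)[of "Suc k"] by simp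
  qed (simp_all add: left_gen_der \<psi> D)
  have gen: "\<psi> U3_gen c x = 0" for c x using \<psi>(3)[of 0] by simp
  have "cochain2 \<psi>"
    unfolding cochain2_def
  proof (intro conjI allI)
    fix a b and x :: 'k
    show "functional (\<lambda>a. \<psi> a b x)" by (rule \<psi>(1))
    show "functional (\<lambda>b. \<psi> a b x)"
    proof (induction a rule: U3_basis_induct_pred)
      case (2 a b)
      then show ?case unfolding lin by (rule functional_add)
    next
      case (3 r a)
      then show ?case unfolding lin by (rule functional_mult)
    next
      case (4 a)
      then show ?case unfolding \<psi> by (rule functional_mult)
    next
      case (5 k)
      then show ?case unfolding \<psi> by (cases k) (simp_all add: functional_0 D)
    next
      case (6 k j)
      then show ?case unfolding \<psi> by (cases k) (simp_all add: functional_0 D)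
    qed (simp add: lin functional_0)
    show "\<psi> (U3_der a) b x = - x * \<psi> a b x" by (rule \<psi>(2))
    show "\<psi> a (U3_der b) x = x * \<psi> a b x"
      by (rule U3_functional_eqI[of "\<lambda>a. \<psi> a (U3_der b) x" "- x" "\<lambda>a. x * \<psi> a b x"])
        (simp_all add: \<psi> D functional_mult split: nat.split)
    have p: "polyfun (\<phi> U3_gen b c 0)" for b c by (rule polyfun2_polyfun_snd[OF D(7)])
    show "polyfun (\<psi> a b)"
    proof (rule U3_polyfunI[of "\<lambda>a. \<psi> a b" "\<lambda>x. - x"])
      show "polyfun (\<psi> ((left_gen ^^ k) U3_gen) b)" for k
        using p polyfun_const[of 0] unfolding \<psi>(3)[abs_def] by (cases k) simp_all
      show "polyfun (\<psi> ((left_gen ^^ k) (quad j)) b)" for k j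
        using p polyfun_const[of 0] unfolding \<psi>(4)[abs_def] by (cases k) simp_all
    qed (simp_all add: \<psi> polyfun_uminus polyfun_id)
  qed
  moreover have "left_normal (\<lambda>a b c x y. \<phi> a b c x y + diff2 \<psi> a b c x y)"
    unfolding left_normal_def
  proof (intro conjI allI)
    fix a b c and x y :: 'k
    show "\<phi> (left_gen a) b c x y + diff2 \<psi> (left_gen a) b c x y = 0"
      using cocycle3_eq[OF assms, of U3_gen x a b c 0 y]
      by (simp add: diff2_def left_gen_lprod L flip: left_gen_lprod_at)
    show "\<phi> U3_gen b c 0 y + diff2 \<psi> U3_gen b c 0 y = 0"
      by (simp add: diff2_def gen L flip: left_gen_lprod_at)
  qed
  ultimately show ?thesis by (rule that)
qed

text \<open>The cocycle identity for the arguments \<open>a, v, v, v\<close>, where \<open>\<phi>(a, Lv, v)\<close> is eliminated by means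
  of the case \<open>y = 0\<close> of the same identity.\<close>

lemma cocycle3_gen_gen_gen:
  assumes "cocycle3 \<phi>"
  defines "K \<equiv> \<lambda>a x y z. \<phi> a U3_gen (left_gen U3_gen) x y + z * \<phi> a U3_gen U3_gen x y
      + z * (x + y + z) * \<phi> a U3_gen quad_gen x y"
  shows "\<phi> (lprod_at x a U3_gen) U3_gen U3_gen x (y + z) + K a x 0 (y + z) + y * \<phi> a U3_gen U3_gen x (y + z)
      - y * z * \<phi> a quad_gen U3_gen x (y + z) =
    \<phi> (lprod_at x a U3_gen) U3_gen U3_gen (x + y) z + K a x y z"
proof -
  note D = cochain3D[OF assms(1)[unfolded cocycle3_def, THEN conjunct1]]
  note lin = functional_simps[OF D(1)] functional_simps[OF D(2)] functional_simps[OF D(3)]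
  have K: "\<phi> a U3_gen (lprod_at z U3_gen U3_gen) x y = K a x y z" for x y z
    unfolding lprod_at_gen_gen lin D K_def by (simp add: power2_eq_square algebra_simps)
  have "\<phi> a (left_gen U3_gen) U3_gen x (y + z) = \<phi> (lprod_at x a U3_gen) U3_gen U3_gen x (y + z) + K a x 0 (y + z)"
    using cocycle3_eq[OF assms(1), of a 0 U3_gen U3_gen U3_gen x "y + z"] by (simp add: K flip: left_gen_lprod_at)
  moreover have "\<phi> a (lprod_at y U3_gen U3_gen) U3_gen x (y + z) =
     \<phi> a (left_gen U3_gen) U3_gen x (y + z) + y * \<phi> a U3_gen U3_gen x (y + z) - y * z * \<phi> a quad_gen U3_gen x (y + z)"
    unfolding lprod_at_gen_gen lin D by (simp add: power2_eq_square algebra_simps)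
  ultimately show ?thesis
    using cocycle3_eq[OF assms(1), of a y U3_gen U3_gen U3_gen x z] by (simp add: K)
qed

section \<open>The obstruction\<close>

lemma coeff2_cong: "(\<And>x y. f x y = g x y) \<Longrightarrow> coeff2 i j f = coeff2 i j g"
  by (rule arg_cong[where f = "coeff2 i j"]) (intro ext)

lemma coeff2_fst_poly: "coeff2 i j (\<lambda>x y. poly p x) = (if j = 0 then coeff p i else 0)"
  using coeff2_eq[of "\<lambda>x y. poly p x" "[:p:]"] by (cases j) simp_all

lemma coeff2_snd_poly: "coeff2 i j (\<lambda>x y. poly p y) = (if i = 0 then coeff p j else 0)"
proof -
  have "poly (poly (map_poly (\<lambda>c. [:c:]) p) [:y:]) x = poly p y" for x y :: 'a
    by (induction p) (simp_all add: map_poly_pCons)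
  then show ?thesis
    using coeff2_eq[of "\<lambda>x y. poly p y" "map_poly (\<lambda>c. [:c:]) p"]
    by (cases i) (simp_all add: coeff_map_poly)
qed

lemma polyfun_poly: "polyfun (poly p)"
  unfolding polyfun_def by blast

lemma polyfun2_plus: "polyfun f \<Longrightarrow> polyfun2 (\<lambda>x y. f (x + y))"
  by (rule polyfun_compose2) (simp_all add: polyfun_intros)

lemma coeff2_plus_poly: "coeff2 i j (\<lambda>x y. poly p (x + y)) = of_nat ((i + j) choose i) * coeff p (i + j)"
proof (induction p arbitrary: i j)
  case 0
  then show ?case using coeff2_fst_poly[of i j "0 :: 'a poly"] by simp
next
  case (pCons a p)
  let ?f = "\<lambda>x y. poly p (x + y)"
  have f: "polyfun2 ?f" by (rule polyfun2_plus[OF polyfun_poly])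
  have "coeff2 i j (\<lambda>x y. poly (pCons a p) (x + y)) = coeff2 i j (\<lambda>x y. a + (x * ?f x y + y * ?f x y))"
    by (rule coeff2_cong) (simp add: algebra_simps)
  also have "\<dots> = coeff2 i j (\<lambda>x y. a) + (coeff2 i j (\<lambda>x y. x * ?f x y) + coeff2 i j (\<lambda>x y. y * ?f x y))"
    by (simp add: coeff2_add polyfun_intros f)
  also have "coeff2 i j (\<lambda>x y. a) = (if i = 0 \<and> j = 0 then a else 0)"
    using coeff2_fst_poly[of i j "[:a:]"] by (cases i) simp_all
  finally show ?case
    unfolding coeff2_mult_fst[OF f] coeff2_mult_snd[OF f] pCons.IH
    by (cases i; cases j) (simp_all add: algebra_simps)
qed

lemma coeff2_0_left:
  assumes "polyfun2 f" "\<And>y. f 0 y = poly p y"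
  shows "coeff2 0 j f = coeff p j"
proof -
  obtain g where g: "polyfun2 g" "\<And>x y. f x y = f 0 y + x * g x y"
    by (rule polyfun2_split_fst[OF assms(1)]) (rule that)
  have "coeff2 0 j f = coeff2 0 j (\<lambda>x y. poly p y + x * g x y)"
    by (rule coeff2_cong) (subst g(2), simp add: assms(2))
  also have "\<dots> = coeff p j"
    using polyfun_compose2[OF polyfun_poly polyfun2_snd, of p]
    by (simp add: coeff2_add polyfun_intros g(1) coeff2_snd_poly coeff2_mult_fst)
  finally show ?thesis .
qed

definition obstruction :: "('k::field_char_0 U3 \<Rightarrow> 'k U3 \<Rightarrow> 'k U3 \<Rightarrow> 'k \<Rightarrow> 'k \<Rightarrow> 'k) \<Rightarrow> 'k" where
  "obstruction \<phi> = coeff2 2 1 (\<phi> U3_gen U3_gen U3_gen) - coeff2 1 2 (\<phi> U3_gen U3_gen U3_gen)"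

lemma obstruction_add:
  assumes "cochain3 \<phi>" "cochain3 \<chi>"
  shows "obstruction (\<lambda>a b c x y. \<phi> a b c x y + r * \<chi> a b c x y) = obstruction \<phi> + r * obstruction \<chi>"
proof -
  note D = cochain3D(7)[OF assms(1)] cochain3D(7)[OF assms(2)]
  have "coeff2 i j (\<lambda>x y. \<phi> a b c x y + r * \<chi> a b c x y) = coeff2 i j (\<phi> a b c) + r * coeff2 i j (\<chi> a b c)"
    for i j a b c
    using coeff2_add[OF D(1) polyfun2_mult[OF polyfun2_const D(2)]] coeff2_scale[OF D(2)] by simp
  then show ?thesis by (simp add: obstruction_def algebra_simps)
qed

text \<open>Only five values of \<open>\<psi>\<close> enter the coboundary at \<open>(v, v, v)\<close>, and their contributions to the
  two coefficients agree.\<close>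

lemma obstruction_diff2:
  assumes "cochain2 \<psi>"
  shows "obstruction (diff2 \<psi>) = 0"
proof -
  note D = cochain2D[OF assms]
  note lin = functional_simps[OF D(1)] functional_simps[OF D(2)]
  have "\<exists>p. \<forall>x. \<psi> a b x = poly p x" for a b
    using D(5)[of a b] by (simp add: polyfun_def)
  then have "\<exists>p. \<forall>a b x. \<psi> a b x = poly (p a b) x"
    by (intro choice allI)
  then obtain p where p: "\<And>a b x. \<psi> a b x = poly (p a b) x" by blast
  define q q' b c c' where "q = p (left_gen U3_gen) U3_gen" and "q' = p U3_gen (left_gen U3_gen)"
    and "b = p U3_gen U3_gen" and "c = p quad_gen U3_gen" and "c' = p U3_gen quad_gen"
  then have q: "\<psi> (left_gen U3_gen) U3_gen x = poly q x" and q': "\<psi> U3_gen (left_gen U3_gen) x = poly q' x"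
    and b: "\<psi> U3_gen U3_gen x = poly b x" and c: "\<psi> quad_gen U3_gen x = poly c x"
    and c': "\<psi> U3_gen quad_gen x = poly c' x" for x
    by (simp_all add: p)
  define f where "f = (\<lambda>x y. (poly q' x + (y * poly b x + (y * (x * poly c' x) + y * (y * poly c' x)))) +
      (- 1) * (poly q (x + y) + (x * poly b (x + y) + (- 1) * (x * (y * poly c (x + y))))))"
  have "diff2 \<psi> U3_gen U3_gen U3_gen x y = f x y" for x y
    unfolding diff2_def lprod_at_gen_gen lin D
    by (simp add: f_def q q' b c c' power2_eq_square algebra_simps)
  then have eq: "diff2 \<psi> U3_gen U3_gen U3_gen = f" by (intro ext)
  note P = polyfun_compose2[OF polyfun_poly polyfun2_fst] polyfun2_plus[OF polyfun_poly]
  have "coeff2 2 1 f - coeff2 1 2 f = 0"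
    unfolding f_def
    by (simp only: coeff2_add coeff2_scale coeff2_mult_fst coeff2_mult_snd polyfun2_add polyfun2_mult
        polyfun2_fst polyfun2_snd polyfun2_const P coeff2_fst_poly coeff2_plus_poly)
      (simp add: eval_nat_numeral coeff2_mult_fst coeff2_mult_snd coeff2_fst_poly coeff2_plus_poly polyfun_intros P)
  then show ?thesis unfolding obstruction_def eq .
qed

lemma square_form_add:
  assumes "square_form x c f" "square_form x d g"
  shows "square_form x (c + d) (\<lambda>y. f y + g y)"
  unfolding square_form_def
proof
  fix y
  have f: "f y = f 0 + y * c + y * (x + y) * ((f 1 + f (- 1) - 2 * f 0) / 2)"
    using assms(1) unfolding square_form_def by (rule spec)
  have g: "g y = g 0 + y * d + y * (x + y) * ((g 1 + g (- 1) - 2 * g 0) / 2)"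
    using assms(2) unfolding square_form_def by (rule spec)
  show "f y + g y = f 0 + g 0 + y * (c + d) +
      y * (x + y) * ((f 1 + g 1 + (f (- 1) + g (- 1)) - 2 * (f 0 + g 0)) / 2)"
    by (subst f, subst g) (simp add: field_simps)
qed

lemma square_form_mult:
  assumes "square_form x c f"
  shows "square_form x (r * c) (\<lambda>y. r * f y)"
  unfolding square_form_def
proof
  fix y
  have f: "f y = f 0 + y * c + y * (x + y) * ((f 1 + f (- 1) - 2 * f 0) / 2)"
    using assms(1) unfolding square_form_def by (rule spec)
  show "r * f y = r * f 0 + y * (r * c) + y * (x + y) * ((r * f 1 + r * f (- 1) - 2 * (r * f 0)) / 2)"
    by (subst f) (simp add: field_simps)
qed

lemma square_form_0: "square_form x 0 (\<lambda>y. 0)"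
  by (simp add: square_form_def)

lemma square_form_cong:
  assumes "c = d" "\<And>y. f y = g y" "square_form x c f"
  shows "square_form x d g"
proof -
  have "f = g" using assms(2) by (intro ext)
  then show ?thesis using assms(1,3) by simp
qed

section \<open>The potential on the generator\<close>

lemma polyfun_case_nat:
  "polyfun f \<Longrightarrow> (\<And>i. polyfun (g i)) \<Longrightarrow> polyfun (\<lambda>x. case k of 0 \<Rightarrow> f x | Suc i \<Rightarrow> g i x)"
  by (cases k) simp_all

text \<open>The condition on \<open>\<alpha>\<close> holds identically on \<open>L\<^sup>ka\<close> for \<open>k \<ge> 2\<close>, where everything is
  zero.  On \<open>v\<close> and \<open>e\<^sub>j\<close> it is an instance of the functional equations, which dictate the values
  of \<open>\<alpha>\<close>, and the values on \<open>Lv\<close> and \<open>Le\<^sub>j\<close> are chosen to provide the correction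
  terms there; with these values the condition on \<open>Lv\<close> and \<open>Le\<^sub>j\<close> holds as well.\<close>

lemma left_normal_potential:
  fixes \<phi> :: "'k::field_char_0 U3 \<Rightarrow> _"
  assumes "cocycle3 \<phi>" "left_normal \<phi>" "obstruction \<phi> = 0"
  obtains \<alpha> where "\<And>x. functional (\<lambda>a. \<alpha> a x)" "\<And>a x. \<alpha> (U3_der a) x = - x * \<alpha> a x" "\<And>a. polyfun (\<alpha> a)"
    "\<And>a x. square_form x (\<alpha> a x) (\<lambda>y. \<phi> a U3_gen U3_gen x y + \<alpha> (lprod_at x a U3_gen) (x + y))"
proof -
  note D = cochain3D[OF assms(1)[unfolded cocycle3_def, THEN conjunct1]]
  note lin = functional_simps[OF D(1)] functional_simps[OF D(2)] functional_simps[OF D(3)]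
  have left: "\<phi> (left_gen a) b c x y = 0" "\<phi> U3_gen b c 0 y = 0" for a b c x y
    using assms(2) by (simp_all add: left_normal_def)
  let ?v = "U3_gen :: 'k U3"

  \<comment> \<open>U j is the divided difference in y of the value of phi at (e_j, v, v) for first parameter 0.\<close>
  define U where "U j = (SOME u. polyfun u \<and> (\<forall>y. \<phi> (quad j) ?v ?v 0 y = \<phi> (quad j) ?v ?v 0 0 + y * u y))" for j
  have U: "polyfun (U j)" "\<phi> (quad j) ?v ?v 0 y = \<phi> (quad j) ?v ?v 0 0 + y * U j y" for j y
  proof -
    have "\<exists>u. polyfun u \<and> (\<forall>y. \<phi> (quad j) ?v ?v 0 y = \<phi> (quad j) ?v ?v 0 0 + y * u y)"
      by (rule polyfun_split[OF polyfun2_polyfun_snd[OF D(7)[of "quad j" ?v ?v], of 0]]) blast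
    from someI_ex[OF this] show "polyfun (U j)" "\<phi> (quad j) ?v ?v 0 y = \<phi> (quad j) ?v ?v 0 0 + y * U j y"
      unfolding U_def by blast+
  qed

  have quad_step: "square_form x (- U j x)
      (\<lambda>y. \<phi> (quad (Suc j)) ?v ?v x y - x * U j (x + y) - y * U (Suc j) (x + y) - U j 0 * (x + y))" for j x
  proof (rule square_form_quad_Suc[OF D(7) D(7) D(7) D(7) D(7) _ U U])
    fix x y z
    show "x * \<phi> (quad j) ?v ?v (x + y) z + y * \<phi> (quad (Suc j)) ?v ?v (x + y) z =
      - (y * z) * \<phi> (quad j) quad_gen ?v x (y + z) + (x + y) * \<phi> (quad j) ?v ?v x (y + z)
      + (\<phi> (quad j) ?v (left_gen ?v) x 0 + (y + z) * \<phi> (quad j) ?v ?v x 0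
          + (y + z) * (x + y + z) * \<phi> (quad j) ?v quad_gen x 0)
      - (\<phi> (quad j) ?v (left_gen ?v) x y + z * \<phi> (quad j) ?v ?v x y
          + z * (x + y + z) * \<phi> (quad j) ?v quad_gen x y)"
      using cocycle3_gen_gen_gen[OF assms(1), of x "quad j" y z]
      unfolding lprod_at_quad_gen lin D left by (simp add: algebra_simps del: quad.simps)
  qed

  obtain \<pi> where \<pi>: "polyfun2 \<pi>" "\<And>x y. \<phi> ?v ?v ?v x y = \<phi> ?v ?v ?v 0 y + x * \<pi> x y"
    by (rule polyfun2_split_fst[OF D(7)]) (rule that)
  obtain Q where Q: "polyfun2 Q" "\<And>x y. \<phi> ?v quad_gen ?v x y = \<phi> ?v quad_gen ?v 0 y + x * Q x y"
    by (rule polyfun2_split_fst[OF D(7)]) (rule that)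
  obtain k0 where k0: "polyfun2 k0" "\<And>x y. \<phi> ?v ?v (left_gen ?v) x y = \<phi> ?v ?v (left_gen ?v) 0 y + x * k0 x y"
    by (rule polyfun2_split_fst[OF D(7)]) (rule that)
  obtain k2 where k2: "polyfun2 k2" "\<And>x y. \<phi> ?v ?v quad_gen x y = \<phi> ?v ?v quad_gen 0 y + x * k2 x y"
    by (rule polyfun2_split_fst[OF D(7)]) (rule that)
  have v: "\<phi> ?v ?v ?v x y = x * \<pi> x y" "\<phi> ?v quad_gen ?v x y = x * Q x y"
    "\<phi> ?v ?v (left_gen ?v) x y = x * k0 x y" "\<phi> ?v ?v quad_gen x y = x * k2 x y" for x y
    using \<pi>(2) Q(2) k0(2) k2(2) unfolding left by simp_all
  define w0 where "w0 = \<pi> 0 0"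
  obtain w1 where w1: "polyfun w1" "\<And>y. \<pi> 0 y = w0 + y * w1 y"
    using polyfun_split[OF polyfun2_polyfun_snd[OF \<pi>(1), of 0]] unfolding w0_def by blast
  obtain w2 where w2: "polyfun w2" "\<And>y. w1 y = w1 0 + y * w2 y"
    by (rule polyfun_split[OF w1(1)]) (rule that)
  have "polyfun (\<lambda>s. s * w1 s)" by (intro polyfun_mult polyfun_id w1(1))
  from polyfun2_plus[OF this] have p2: "polyfun2 (\<lambda>x y. \<pi> x y - w0 - (x + y) * w1 (x + y))"
    by (intro polyfun2_diff polyfun2_const \<pi>(1))
  obtain \<omega> where \<omega>: "polyfun2 \<omega>" "\<And>x y. \<pi> x y - w0 - (x + y) * w1 (x + y) =
      (\<pi> 0 y - w0 - (0 + y) * w1 (0 + y)) + x * \<omega> x y"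
    by (rule polyfun2_split_fst[OF p2]) (rule that)
  have \<omega>': "\<pi> x y = w0 + (x + y) * w1 (x + y) + x * \<omega> x y" for x y
    using \<omega>(2)[of x y] w1(2)[of y] by (simp add: algebra_simps)
  obtain W where W: "polyfun W" "\<And>y. \<omega> 0 y = \<omega> 0 0 + y * W y"
    by (rule polyfun_split[OF polyfun2_polyfun_snd[OF \<omega>(1), of 0]]) (rule that)

  have obstruction: "w2 0 + W 0 = 0"
  proof -
    obtain p where p: "\<And>x. w2 x = poly p x" using w2(1) unfolding polyfun_def by blast
    obtain r where r: "\<And>x. W x = poly r x" using W(1) unfolding polyfun_def by blast
    define g where "g = [:w0, w1 0:] + pCons 0 (pCons 0 p)"
    have \<pi>g: "\<pi> x y = poly g (x + y) + x * \<omega> x y" for x y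
    proof -
      have "w1 (x + y) = w1 0 + (x + y) * poly p (x + y)" using w2(2)[of "x + y"] unfolding p .
      then show ?thesis unfolding \<omega>'[of x y] g_def by (simp add: algebra_simps)
    qed
    have c: "coeff2 i j \<pi> = coeff2 i j (\<lambda>x y. poly g (x + y)) + coeff2 i j (\<lambda>x y. x * \<omega> x y)" for i j
    proof -
      have "coeff2 i j \<pi> = coeff2 i j (\<lambda>x y. poly g (x + y) + x * \<omega> x y)"
        by (rule coeff2_cong) (rule \<pi>g)
      also have "\<dots> = coeff2 i j (\<lambda>x y. poly g (x + y)) + coeff2 i j (\<lambda>x y. x * \<omega> x y)"
        by (rule coeff2_add[OF polyfun2_plus[OF polyfun_poly] polyfun2_mult[OF polyfun2_fst \<omega>(1)]])
      finally show ?thesis .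
    qed
    have W0: "W 0 = coeff r 0" using r[of 0] by (simp add: poly_0_coeff_0)
    have w20: "w2 0 = coeff p 0" using p[of 0] by (simp add: poly_0_coeff_0)
    have "\<omega> 0 y = poly ([:\<omega> 0 0:] + pCons 0 r) y" for y
      using W(2)[of y] unfolding r by simp
    from coeff2_0_left[OF \<omega>(1) this, of 1] have \<omega>01: "coeff2 0 1 \<omega> = W 0"
      by (simp add: W0)
    have c11: "coeff2 1 1 \<pi> = 2 * w2 0 + W 0"
      unfolding c coeff2_plus_poly coeff2_mult_fst[OF \<omega>(1)] using \<omega>01
      by (simp add: w20 g_def numeral_2_eq_2)
    have c02: "coeff2 0 2 \<pi> = w2 0"
      unfolding c coeff2_plus_poly coeff2_mult_fst[OF \<omega>(1)]
      by (simp add: w20 g_def numeral_2_eq_2)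
    have "coeff2 i j (\<phi> ?v ?v ?v) = coeff2 i j (\<lambda>x y. x * \<pi> x y)" for i j
      by (rule coeff2_cong) (rule v(1))
    then have "obstruction \<phi> = coeff2 1 1 \<pi> - coeff2 0 2 \<pi>"
      unfolding obstruction_def by (simp add: coeff2_mult_fst[OF \<pi>(1)] numeral_2_eq_2)
    then show ?thesis using assms(3) unfolding c11 c02 by simp
  qed

  have eq: "(x + y) * \<pi> (x + y) z - y * \<phi> (quad 0) ?v ?v (x + y) z = - (y * z) * Q x (y + z) + (x + y) * \<pi> x (y + z)
      + (k0 x 0 + (y + z) * \<pi> x 0 + (y + z) * (x + y + z) * k2 x 0)
      - (k0 x y + z * \<pi> x y + z * (x + y + z) * k2 x y)" for x y z
  proof (rule polyfun_split_unique[where x = x and f = "\<lambda>x. (x + y) * \<pi> (x + y) z - y * \<phi> (quad 0) ?v ?v (x + y) z"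
        and g = "\<lambda>x. - (y * z) * Q x (y + z) + (x + y) * \<pi> x (y + z)
      + (k0 x 0 + (y + z) * \<pi> x 0 + (y + z) * (x + y + z) * k2 x 0)
      - (k0 x y + z * \<pi> x y + z * (x + y + z) * k2 x y)"])
    have s: "polyfun (\<lambda>x. f (x + y) z)" if "polyfun2 f" for f :: "'k \<Rightarrow> 'k \<Rightarrow> 'k"
      using polyfun2_compose[OF that _ polyfun_const, of "\<lambda>x. x + y" z] by (simp add: polyfun_intros)
    show "polyfun (\<lambda>x. (x + y) * \<pi> (x + y) z - y * \<phi> (quad 0) ?v ?v (x + y) z)"
      by (intro polyfun_diff polyfun_mult polyfun_add polyfun_id polyfun_const s \<pi>(1) D(7))
    show "polyfun (\<lambda>x. - (y * z) * Q x (y + z) + (x + y) * \<pi> x (y + z)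
      + (k0 x 0 + (y + z) * \<pi> x 0 + (y + z) * (x + y + z) * k2 x 0)
      - (k0 x y + z * \<pi> x y + z * (x + y + z) * k2 x y))"
      by (intro polyfun_diff polyfun_mult polyfun_add polyfun_id polyfun_const
          polyfun2_polyfun_fst[OF \<pi>(1)] polyfun2_polyfun_fst[OF Q(1)] polyfun2_polyfun_fst[OF k0(1)]
          polyfun2_polyfun_fst[OF k2(1)])
    fix x
    show "x * ((x + y) * \<pi> (x + y) z - y * \<phi> (quad 0) ?v ?v (x + y) z) =
      x * (- (y * z) * Q x (y + z) + (x + y) * \<pi> x (y + z)
      + (k0 x 0 + (y + z) * \<pi> x 0 + (y + z) * (x + y + z) * k2 x 0)
      - (k0 x y + z * \<pi> x y + z * (x + y + z) * k2 x y))"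
      using cocycle3_gen_gen_gen[OF assms(1), of x ?v y z]
      unfolding lprod_at_gen_gen lin D left v by (simp add: power2_eq_square algebra_simps)
  qed
  note square_form_v = square_form_gen[OF \<pi>(1) D(7) Q(1) k0(1) k2(1) eq U w1(1) w2(1) w1(2) w2(2) \<omega>(1) \<omega>' W obstruction]

  \<comment> \<open>The values on v and e_j are the linear coefficients in the functional equations; those on L v and L e_j
    are the remaining terms, homogeneous in x + y.\<close>
  obtain \<alpha> :: "'k U3 \<Rightarrow> 'k \<Rightarrow> 'k" where \<alpha>: "\<And>x. functional (\<lambda>a. \<alpha> a x)" "\<And>a x. \<alpha> (U3_der a) x = - x * \<alpha> a x"
    and \<alpha>_gen: "\<And>k x. \<alpha> ((left_gen ^^ k) U3_gen) x = (case k of 0 \<Rightarrow> - x * x * W x - x * w1 x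
        | Suc k \<Rightarrow> (case k of 0 \<Rightarrow> - w1 0 * (x * x) | _ \<Rightarrow> 0))"
    and \<alpha>_quad: "\<And>k j x. \<alpha> ((left_gen ^^ k) (quad j)) x =
        (case k of 0 \<Rightarrow> (case j of 0 \<Rightarrow> - x * W x | Suc i \<Rightarrow> - U i x)
        | Suc k \<Rightarrow> (case k of 0 \<Rightarrow> (case j of 0 \<Rightarrow> 0 | Suc i \<Rightarrow> - U i 0 * x) | _ \<Rightarrow> 0))"
    by (rule U3_free_family[of "\<lambda>x. - x"]) (rule that)
  note \<alpha>lin = functional_simps[OF \<alpha>(1)]
  have gen0: "\<alpha> ?v x = - x * x * W x - x * w1 x" and gen1: "\<alpha> (left_gen ?v) x = - w1 0 * (x * x)" for x
    using \<alpha>_gen[of 0] \<alpha>_gen[of "Suc 0"] by simp_all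
  have quad0: "\<alpha> (quad j) x = (case j of 0 \<Rightarrow> - x * W x | Suc i \<Rightarrow> - U i x)"
    and quad1: "\<alpha> (left_gen (quad j)) x = (case j of 0 \<Rightarrow> 0 | Suc i \<Rightarrow> - U i 0 * x)" for j x
    using \<alpha>_quad[of 0] \<alpha>_quad[of "Suc 0"] by (simp_all del: quad.simps)
  have quad_gen0: "\<alpha> quad_gen x = - x * W x" and quad_gen1: "\<alpha> (left_gen quad_gen) x = 0" for x
    using quad0[of 0 x] quad1[of 0 x] by simp_all
  have LL: "\<alpha> (left_gen (left_gen a)) x = 0" for a x
  proof (rule U3_functional_eqI[of "\<lambda>a. \<alpha> (left_gen (left_gen a)) x" "- x" "\<lambda>a. 0"])
    show "functional (\<lambda>a. \<alpha> (left_gen (left_gen a)) x)"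
      by (rule functional_left_gen[OF functional_left_gen[OF \<alpha>(1)]])
    show "\<alpha> (left_gen (left_gen ((left_gen ^^ k) U3_gen))) x = 0" for k
      using \<alpha>_gen[of "Suc (Suc k)"] by simp
    show "\<alpha> (left_gen (left_gen ((left_gen ^^ k) (quad j)))) x = 0" for k j
      using \<alpha>_quad[of "Suc (Suc k)"] by (simp del: quad.simps)
  qed (simp_all add: left_gen_der \<alpha> functional_0)

  let ?square_form = "\<lambda>a. \<forall>x. square_form x (\<alpha> a x) (\<lambda>y. \<phi> a U3_gen U3_gen x y + \<alpha> (lprod_at x a U3_gen) (x + y))"
  have square_form_LL: "?square_form (left_gen (left_gen a))" for a
    by (simp add: left left_gen_lprod LL square_form_0)
  have square_form_gen0: "?square_form ?v"
  proof
    fix x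
    show "square_form x (\<alpha> ?v x) (\<lambda>y. \<phi> ?v ?v ?v x y + \<alpha> (lprod_at x ?v ?v) (x + y))"
    proof (rule square_form_cong[OF _ _ square_form_v(2)[of x]])
      show "- x * x * W x - x * w1 x = \<alpha> ?v x" by (simp add: gen0)
      show "x * (\<pi> x y - (x + y) * (x + y) * W (x + y) - (x + y) * w1 (x + y) + y * ((x + y) * W (x + y)))
          - w1 0 * ((x + y) * (x + y)) = \<phi> ?v ?v ?v x y + \<alpha> (lprod_at x ?v ?v) (x + y)" for y
        unfolding lprod_at_gen_gen \<alpha>lin \<alpha> gen0 gen1 quad_gen0 v
        by (simp add: power2_eq_square algebra_simps)
    qed
  qed
  have square_form_quad0: "?square_form (quad j)" for j
  proof
    fix x
    show "square_form x (\<alpha> (quad j) x) (\<lambda>y. \<phi> (quad j) ?v ?v x y + \<alpha> (lprod_at x (quad j) ?v) (x + y))"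
    proof (cases j)
      case 0
      show ?thesis
        unfolding 0 lprod_at_quad_gen \<alpha>lin \<alpha> quad0 quad1
        by (rule square_form_cong[OF _ _ square_form_v(1)[of x]]) (simp_all add: algebra_simps)
    next
      case (Suc i)
      show ?thesis
        unfolding Suc lprod_at_quad_gen \<alpha>lin \<alpha> quad0 quad1
        by (rule square_form_cong[OF _ _ quad_step[of x i]]) (simp_all add: algebra_simps del: quad.simps)
    qed
  qed
  have square_form_gen1: "?square_form (left_gen ?v)"
  proof
    fix x
    show "square_form x (\<alpha> (left_gen ?v) x) (\<lambda>y. \<phi> (left_gen ?v) ?v ?v x y + \<alpha> (lprod_at x (left_gen ?v) ?v) (x + y))"
    proof (rule square_formI)
      fix y
      show "\<phi> (left_gen ?v) ?v ?v x y + \<alpha> (lprod_at x (left_gen ?v) ?v) (x + y) =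
          - w1 0 * (x * x * x) + y * \<alpha> (left_gen ?v) x + y * (x + y) * (- x * w1 0)"
        unfolding left_gen_lprod lprod_at_gen_gen left_gen_add left_gen_scale left_gen_der \<alpha>lin \<alpha> LL gen1 quad_gen1 left
        by (simp add: algebra_simps)
    qed
  qed
  have square_form_quad1: "?square_form (left_gen (quad j))" for j
  proof
    fix x
    show "square_form x (\<alpha> (left_gen (quad j)) x)
        (\<lambda>y. \<phi> (left_gen (quad j)) ?v ?v x y + \<alpha> (lprod_at x (left_gen (quad j)) ?v) (x + y))"
    proof (rule square_formI)
      define c where "c j = (case j of 0 \<Rightarrow> 0 | Suc i \<Rightarrow> - U i 0)" for j
      have c: "\<alpha> (left_gen (quad j)) x = c j * x" for j x
        unfolding quad1 c_def by (simp split: nat.split)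
      fix y
      show "\<phi> (left_gen (quad j)) ?v ?v x y + \<alpha> (lprod_at x (left_gen (quad j)) ?v) (x + y) =
          \<alpha> (left_gen (quad j)) 1 * (x * x) + y * \<alpha> (left_gen (quad j)) x + y * (x + y) * \<alpha> (left_gen (quad (Suc j))) 1"
        unfolding left_gen_lprod lprod_at_quad_gen left_gen_add left_gen_diff left_gen_scale left_gen_der \<alpha>lin \<alpha> LL c left
        by (simp add: algebra_simps)
    qed
  qed
  have "?square_form a" for a
  proof (induction a rule: U3_basis_induct_pred)
    case 1
    show ?case by (simp add: \<alpha>lin lin square_form_0)
  next
    case (2 a b)
    show ?case
    proof
      fix x
      show "square_form x (\<alpha> (a + b) x) (\<lambda>y. \<phi> (a + b) ?v ?v x y + \<alpha> (lprod_at x (a + b) ?v) (x + y))"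
        by (rule square_form_cong[OF _ _ square_form_add[OF 2(1)[rule_format, of x] 2(2)[rule_format, of x]]])
          (simp_all add: \<alpha>lin lin lprod_at_add_left)
    qed
  next
    case (3 r a)
    show ?case
    proof
      fix x
      show "square_form x (\<alpha> (U3_scale r a) x) (\<lambda>y. \<phi> (U3_scale r a) ?v ?v x y + \<alpha> (lprod_at x (U3_scale r a) ?v) (x + y))"
        by (rule square_form_cong[OF _ _ square_form_mult[OF 3[rule_format, of x], of r]])
          (simp_all add: \<alpha>lin lin lprod_at_scale_left algebra_simps)
    qed
  next
    case (4 a)
    show ?case
    proof
      fix x
      show "square_form x (\<alpha> (U3_der a) x) (\<lambda>y. \<phi> (U3_der a) ?v ?v x y + \<alpha> (lprod_at x (U3_der a) ?v) (x + y))"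
        by (rule square_form_cong[OF _ _ square_form_mult[OF 4[rule_format, of x], of "- x"]])
          (simp_all add: \<alpha>lin lin \<alpha> D lprod_at_der_left algebra_simps)
    qed
  next
    case (5 k)
    consider "k = 0" | "k = Suc 0" | l where "k = Suc (Suc l)" by (cases k; cases "k - 1") auto
    then show ?case
    proof cases
      case 3
      then show ?thesis using square_form_LL[of "(left_gen ^^ l) ?v"] by simp
    qed (use square_form_gen0 square_form_gen1 in simp_all)
  next
    case (6 k j)
    consider "k = 0" | "k = Suc 0" | l where "k = Suc (Suc l)" by (cases k; cases "k - 1") auto
    then show ?case
    proof cases
      case 3
      then show ?thesis using square_form_LL[of "(left_gen ^^ l) (quad j)"] by simp
    qed (use square_form_quad0[of j] square_form_quad1[of j] in simp_all)
  qed
  moreover have "polyfun (\<alpha> a)" for a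
  proof (rule U3_polyfunI[of \<alpha> "\<lambda>x. - x"])
    show "polyfun (\<alpha> ((left_gen ^^ k) ?v))" for k
      unfolding \<alpha>_gen[abs_def]
      by (intro polyfun_case_nat polyfun_diff polyfun_mult polyfun_uminus polyfun_id polyfun_const w1(1) W(1))
    show "polyfun (\<alpha> ((left_gen ^^ k) (quad j)))" for k j
      unfolding \<alpha>_quad[abs_def]
      by (intro polyfun_case_nat polyfun_mult polyfun_uminus polyfun_id polyfun_const U(1) W(1))
  qed (simp_all add: \<alpha> polyfun_intros)
  ultimately show ?thesis by (intro that[of \<alpha>]) (simp_all add: \<alpha>)
qed

section \<open>Extension of the potential\<close>

text \<open>The properties of \<open>\<psi>(\<cdot>, c)\<close> for a 2-cochain \<open>\<psi>\<close> and fixed \<open>c\<close>.  They are inherited by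
  \<open>a \<mapsto> G(a\<^sub>xb)\<close>, which is what makes the recursion below produce cochains.\<close>

definition sesqui :: "('k::field_char_0 U3 \<Rightarrow> 'k \<Rightarrow> 'k) \<Rightarrow> bool" where
  "sesqui G \<longleftrightarrow> (\<forall>x. functional (\<lambda>a. G a x)) \<and> (\<forall>a x. G (U3_der a) x = - x * G a x) \<and> (\<forall>a. polyfun (G a))"

lemma sesquiD:
  assumes "sesqui G"
  shows "functional (\<lambda>a. G a x)" "G (U3_der a) x = - x * G a x" "polyfun (G a)"
  using assms by (simp_all add: sesqui_def)

lemma sesquiI:
  assumes "\<And>x. functional (\<lambda>a. G a x)" "\<And>a x. G (U3_der a) x = - x * G a x" "\<And>a. polyfun (G a)"
  shows "sesqui G"
  using assms by (simp add: sesqui_def)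

lemma sesqui_add: "sesqui G \<Longrightarrow> sesqui H \<Longrightarrow> sesqui (\<lambda>a x. G a x + H a x)"
  by (rule sesquiI) (simp_all add: functional_add polyfun_add sesquiD algebra_simps)

lemma sesqui_diff: "sesqui G \<Longrightarrow> sesqui H \<Longrightarrow> sesqui (\<lambda>a x. G a x - H a x)"
  by (rule sesquiI) (simp_all add: functional_diff polyfun_diff sesquiD algebra_simps)

lemma sesqui_mult: "polyfun p \<Longrightarrow> sesqui G \<Longrightarrow> sesqui (\<lambda>a x. p x * G a x)"
  by (rule sesquiI) (simp_all add: functional_mult polyfun_mult sesquiD algebra_simps)

lemma sesqui_0: "sesqui (\<lambda>a x. 0)"
  by (rule sesquiI) (simp_all add: functional_0 polyfun_const)

lemma sesqui_lprod:
  assumes "sesqui G"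
  shows "sesqui (\<lambda>a x. G (lprod_at x a b) (x + s))"
proof (rule sesquiI)
  note lin = functional_simps[OF sesquiD(1)[OF assms]]
  show "functional (\<lambda>a. G (lprod_at x a b) (x + s))" for x
    by (rule functional_lprod_left[OF sesquiD(1)[OF assms]])
  show "G (lprod_at x (U3_der a) b) (x + s) = - x * G (lprod_at x a b) (x + s)" for a x
    by (simp add: lprod_at_der_left lin)
  have "polyfun (\<lambda>x. G u (x + s))" for u
    by (rule polyfun_compose[OF sesquiD(3)[OF assms]]) (intro polyfun_add polyfun_id polyfun_const)
  then show "polyfun (\<lambda>x. G (lprod_at x a b) (x + s))" for a
    by (rule polyfun_lprod[of "\<lambda>u x. G u (x + s)"]) (rule sesquiD(1)[OF assms])
qed

lemma sesqui_cochain3: "cochain3 \<phi> \<Longrightarrow> sesqui (\<lambda>a x. \<phi> a b c x s)"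
  by (rule sesquiI) (simp_all add: cochain3D polyfun2_polyfun_fst)

text \<open>The values of \<open>\<psi>(a, L\<^sup>kc)\<close> forced by \<open>\<psi>\<^sub>x(a, Lc) = \<phi>\<^sub>x\<^sub>,\<^sub>0(a, v, c) + \<psi>\<^sub>x(a\<^sub>xv, c)\<close>.  The
  summand \<open>0\<close> keeps the shape of \<open>sesqui_lprod\<close>.\<close>

primrec left_extend where
  "left_extend \<phi> c G 0 = G"
| "left_extend \<phi> c G (Suc k) =
    (\<lambda>a x. \<phi> a U3_gen ((left_gen ^^ k) c) x 0 + left_extend \<phi> c G k (lprod_at x a U3_gen) (x + 0))"

text \<open>The values of \<open>\<psi>(a, e\<^sub>j)\<close> forced by \<open>e\<^sub>j\<^sub>+\<^sub>1 = v\<^sub>1e\<^sub>j - v\<^sub>0e\<^sub>j\<close>, starting from \<open>G = \<psi>(\<cdot>, e\<^sub>0)\<close>.\<close>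

primrec quad_extend where
  "quad_extend \<phi> G 0 = G"
| "quad_extend \<phi> G (Suc j) =
    (\<lambda>a x. \<phi> a U3_gen (quad j) x 1 + quad_extend \<phi> G j (lprod_at x a U3_gen) (x + 1)
      - (\<phi> a U3_gen (quad j) x 0 + quad_extend \<phi> G j (lprod_at x a U3_gen) (x + 0)))"

lemma sesqui_left_extend: "cochain3 \<phi> \<Longrightarrow> sesqui G \<Longrightarrow> sesqui (left_extend \<phi> c G k)"
proof (induction k)
  case (Suc k)
  show ?case unfolding left_extend.simps
    by (rule sesqui_add[OF sesqui_cochain3[OF Suc.prems(1)] sesqui_lprod[OF Suc.IH[OF Suc.prems]]])
qed simp

lemma sesqui_quad_extend: "cochain3 \<phi> \<Longrightarrow> sesqui G \<Longrightarrow> sesqui (quad_extend \<phi> G j)"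
proof (induction j)
  case (Suc j)
  note * = sesqui_add[OF sesqui_cochain3[OF Suc.prems(1)] sesqui_lprod[OF Suc.IH[OF Suc.prems]]]
  show ?case unfolding quad_extend.simps by (rule sesqui_diff[OF * *])
qed simp

text \<open>By freeness the values on the basis in the second argument may be prescribed.  They are those that
  \<open>\<phi> = d\<psi>\<close> forces when the middle argument is \<open>v\<close>; in particular \<open>\<psi>(a, e)\<close> is the
  coefficient of \<open>y(x + y)\<close> in the condition on \<open>\<alpha>\<close>.\<close>

lemma potential_extends:
  fixes \<phi> :: "'k::field_char_0 U3 \<Rightarrow> _"
  assumes \<phi>: "cochain3 \<phi>" and \<alpha>: "sesqui \<alpha>"
  obtains \<psi> where "cochain2 \<psi>" "\<And>a x. \<psi> a U3_gen x = \<alpha> a x"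
    "\<And>a x. \<psi> a quad_gen x = ((\<phi> a U3_gen U3_gen x 1 + \<alpha> (lprod_at x a U3_gen) (x + 1))
        + (\<phi> a U3_gen U3_gen x (- 1) + \<alpha> (lprod_at x a U3_gen) (x + (- 1)))
        - 2 * (\<phi> a U3_gen U3_gen x 0 + \<alpha> (lprod_at x a U3_gen) (x + 0))) / 2"
    "\<And>a c x. \<psi> a (left_gen c) x = \<phi> a U3_gen c x 0 + \<psi> (lprod_at x a U3_gen) c x"
    "\<And>a j x. \<psi> a (quad (Suc j)) x = \<phi> a U3_gen (quad j) x 1 + \<psi> (lprod_at x a U3_gen) (quad j) (x + 1)
      - (\<phi> a U3_gen (quad j) x 0 + \<psi> (lprod_at x a U3_gen) (quad j) x)"
proof -
  let ?v = "U3_gen :: 'k U3"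
  define \<Theta> where "\<Theta> s = (\<lambda>a x. \<phi> a ?v ?v x s + \<alpha> (lprod_at x a ?v) (x + s))" for s
  define \<epsilon> where "\<epsilon> = (\<lambda>a x. (1 / 2) * ((\<Theta> 1 a x + \<Theta> (- 1) a x) - 2 * \<Theta> 0 a x))"
  have \<Theta>: "sesqui (\<Theta> s)" for s
    unfolding \<Theta>_def by (rule sesqui_add[OF sesqui_cochain3[OF \<phi>] sesqui_lprod[OF \<alpha>]])
  have \<epsilon>: "sesqui \<epsilon>"
    unfolding \<epsilon>_def
    by (rule sesqui_mult[OF polyfun_const sesqui_diff[OF sesqui_add[OF \<Theta> \<Theta>] sesqui_mult[OF polyfun_const \<Theta>]]])
  obtain f :: "'k U3 \<Rightarrow> 'k U3 \<times> 'k \<Rightarrow> 'k" where f: "\<And>b. functional (\<lambda>c. f c b)"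
    "\<And>c b. f (U3_der c) b = snd b * f c b"
    "\<And>k b. f ((left_gen ^^ k) U3_gen) b = left_extend \<phi> U3_gen \<alpha> k (fst b) (snd b)"
    "\<And>k j b. f ((left_gen ^^ k) (quad j)) b =
      left_extend \<phi> (quad j) (quad_extend \<phi> \<epsilon> j) k (fst b) (snd b)"
    by (rule U3_free_family[of "\<lambda>b. snd b"]) (rule that)
  define \<psi> where "\<psi> a c x = f c (a, x)" for a c x
  have \<psi>: "functional (\<lambda>c. \<psi> a c x)" "\<psi> a (U3_der c) x = x * \<psi> a c x"
    "\<psi> a ((left_gen ^^ k) U3_gen) x = left_extend \<phi> U3_gen \<alpha> k a x"
    "\<psi> a ((left_gen ^^ k) (quad j)) x = left_extend \<phi> (quad j) (quad_extend \<phi> \<epsilon> j) k a x" for a c x k j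
    using f by (simp_all add: \<psi>_def)
  note lin = functional_simps[OF \<psi>(1)]
  have sesqui: "sesqui (\<lambda>a x. \<psi> a c x)" for c
  proof (induction c rule: U3_basis_induct_pred)
    case 1
    then show ?case unfolding lin by (rule sesqui_0)
  next
    case (2 a b)
    then show ?case unfolding lin by (rule sesqui_add)
  next
    case (3 r a)
    then show ?case unfolding lin by (rule sesqui_mult[OF polyfun_const])
  next
    case (4 a)
    then show ?case unfolding \<psi>(2) by (rule sesqui_mult[OF polyfun_id])
  next
    case (5 k)
    show ?case unfolding \<psi>(3) by (rule sesqui_left_extend[OF \<phi> \<alpha>])
  next
    case (6 k j)
    show ?case unfolding \<psi>(4) by (rule sesqui_left_extend[OF \<phi> sesqui_quad_extend[OF \<phi> \<epsilon>]])
  qed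
  have c2: "cochain2 \<psi>"
    unfolding cochain2_def by (intro conjI allI sesquiD[OF sesqui] \<psi>(1,2))
  have q: "\<psi> a (quad j) x = quad_extend \<phi> \<epsilon> j a x" for a j x
    using \<psi>(4)[of a 0 j x] by simp
  have "\<psi> a U3_gen x = \<alpha> a x" for a x
    using \<psi>(3)[of a 0 x] by simp
  moreover have "\<psi> a quad_gen x = ((\<phi> a ?v ?v x 1 + \<alpha> (lprod_at x a ?v) (x + 1))
        + (\<phi> a ?v ?v x (- 1) + \<alpha> (lprod_at x a ?v) (x + (- 1)))
        - 2 * (\<phi> a ?v ?v x 0 + \<alpha> (lprod_at x a ?v) (x + 0))) / 2" for a x
    using q[of a 0 x] by (simp add: \<epsilon>_def \<Theta>_def)
  moreover have "\<psi> a (quad (Suc j)) x = \<phi> a ?v (quad j) x 1 + \<psi> (lprod_at x a ?v) (quad j) (x + 1)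
      - (\<phi> a ?v (quad j) x 0 + \<psi> (lprod_at x a ?v) (quad j) x)" for a j x
    unfolding q quad_extend.simps by simp
  moreover have "\<psi> a (left_gen c) x = \<phi> a ?v c x 0 + \<psi> (lprod_at x a ?v) c x" for a c x
  proof (rule U3_functional_eqI[of "\<lambda>c. \<psi> a (left_gen c) x" x "\<lambda>c. \<phi> a ?v c x 0 + \<psi> (lprod_at x a ?v) c x"])
    show "functional (\<lambda>c. \<psi> a (left_gen c) x)" by (rule functional_left_gen[OF \<psi>(1)])
    show "functional (\<lambda>c. \<phi> a ?v c x 0 + \<psi> (lprod_at x a ?v) c x)"
      by (intro functional_add cochain3D(3)[OF \<phi>] \<psi>(1))
    show "\<psi> a (left_gen ((left_gen ^^ k) ?v)) x = \<phi> a ?v ((left_gen ^^ k) ?v) x 0 +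
        \<psi> (lprod_at x a ?v) ((left_gen ^^ k) ?v) x" for k
      using \<psi>(3)[of a "Suc k" x] \<psi>(3)[of "lprod_at x a ?v" k x] by simp
    show "\<psi> a (left_gen ((left_gen ^^ k) (quad j))) x = \<phi> a ?v ((left_gen ^^ k) (quad j)) x 0 +
        \<psi> (lprod_at x a ?v) ((left_gen ^^ k) (quad j)) x" for k j
      using \<psi>(4)[of a "Suc k" j x] \<psi>(4)[of "lprod_at x a ?v" k j x] by simp
  qed (simp_all add: left_gen_der \<psi>(2) cochain3D(6)[OF \<phi>] algebra_simps)
  ultimately show ?thesis by (intro that[OF c2])
qed

text \<open>Antisymmetrise the cocycle identity at \<open>(a, v, v, c)\<close> in the second and third parameters.  The
  difference of \<open>v\<^sub>yv\<close> and \<open>v\<^sub>zv\<close>, with \<open>\<partial>\<close> acting as \<open>- (y + z)\<close>, is \<open>(y - z)v\<close>.\<close>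

lemma cocycle3_swap:
  assumes "cocycle3 \<delta>"
  shows "(y - z) * \<delta> a U3_gen c x (y + z) =
    (\<delta> (lprod_at x a U3_gen) U3_gen c (x + y) z + \<delta> a U3_gen (lprod_at z U3_gen c) x y)
    - (\<delta> (lprod_at x a U3_gen) U3_gen c (x + z) y + \<delta> a U3_gen (lprod_at y U3_gen c) x z)"
proof -
  note D = cochain3D[OF assms[unfolded cocycle3_def, THEN conjunct1]]
  note lin = functional_simps[OF D(2)]
  have *: "\<delta> a (lprod_at y U3_gen U3_gen) c x (y + z) = \<delta> a (left_gen U3_gen) c x (y + z)
      + y * \<delta> a U3_gen c x (y + z) - y * z * \<delta> a quad_gen c x (y + z)" for y z
    unfolding lprod_at_gen_gen lin D by (simp add: power2_eq_square algebra_simps)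
  have "(y - z) * \<delta> a U3_gen c x (y + z) =
      \<delta> a (lprod_at y U3_gen U3_gen) c x (y + z) - \<delta> a (lprod_at z U3_gen U3_gen) c x (z + y)"
    unfolding * by (simp add: algebra_simps)
  then show ?thesis unfolding cocycle3_eq[OF assms] .
qed

text \<open>The case \<open>z = 0\<close> of \<open>cocycle3_swap\<close> shows that vanishing of \<open>\<delta>(\<cdot>, v, c)\<close> carries over from \<open>c\<close>
  to \<open>Lc\<close>.  The case \<open>z = 1\<close> with \<open>c = v\<close> and \<open>c = e\<^sub>j\<close> gives it for \<open>e\<^sub>0\<close> and \<open>e\<^sub>j\<^sub>+\<^sub>1\<close>,
  since the value at \<open>y = 1\<close> is zero.  Hence \<open>\<delta>(\<cdot>, v, \<cdot>) = 0\<close>, and the elements \<open>b\<close> with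
  \<open>\<delta>(\<cdot>, b, \<cdot>) = 0\<close> form a subalgebra by the cocycle identity.\<close>

lemma cocycle3_vanishes:
  fixes \<delta> :: "'k::field_char_0 U3 \<Rightarrow> _"
  assumes "cocycle3 \<delta>" and zero: "\<And>a c x. \<delta> a U3_gen c x 0 = 0"
    and gen: "\<And>a x y. \<delta> a U3_gen U3_gen x y = 0" and quad: "\<And>a j x. \<delta> a U3_gen (quad j) x 1 = 0"
  shows "\<delta> a b c x y = 0"
proof -
  note D = cochain3D[OF assms(1)[unfolded cocycle3_def, THEN conjunct1]]
  note lin = functional_simps[OF D(3)]
  let ?v = "U3_gen :: 'k U3"
  have left: "\<delta> a ?v (left_gen c) x y = 0" if "\<And>a x y. \<delta> a ?v c x y = 0" for a c x y
    using cocycle3_swap[OF assms(1), of y 0 a c x] that zero by (simp flip: left_gen_lprod_at)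
  have quads: "\<delta> a ?v (quad j) x y = 0" for a j x y
  proof (induction j arbitrary: a x y)
    case 0
    show ?case
    \<comment> \<open>The common factor x + y + 1 can be cancelled away from its zero.\<close>
    proof (rule polyfun_eqI_except[where f = "\<lambda>y. \<delta> a ?v (quad 0) x y" and g = "\<lambda>y. 0" and c = "- x - 1"])
      fix y assume y: "y \<noteq> - x - 1"
      have "x + y + 1 \<noteq> 0"
      proof
        assume 0: "x + y + 1 = 0"
        have "y = (x + y + 1) - x - 1" by simp
        then show False using y unfolding 0 by simp
      qed
      moreover have "\<delta> a ?v quad_gen x 1 = 0" using quad[of a 0 x] by simp
      moreover have "\<delta> a ?v (lprod_at z ?v ?v) x w = z * (x + w + z) * \<delta> a ?v quad_gen x w" for z w
        unfolding lprod_at_gen_gen lin D gen left[OF gen] by (simp add: power2_eq_square algebra_simps)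
      ultimately have "(x + y + 1) * \<delta> a ?v quad_gen x y = 0" "x + y + 1 \<noteq> 0"
        using cocycle3_swap[OF assms(1), of y 1 a ?v x] by (simp_all add: gen)
      then show "\<delta> a ?v (quad 0) x y = 0" by simp
    qed (use polyfun2_polyfun_snd[OF D(7)] in \<open>simp_all add: polyfun_const\<close>)
  next
    case (Suc j)
    have "\<delta> a ?v (lprod_at z ?v (quad j)) x w = z * \<delta> a ?v (quad (Suc j)) x w" for z w
      unfolding lprod_at_gen_quad lin left[OF Suc.IH] by simp
    then show ?case
      using cocycle3_swap[OF assms(1), of y 1 a "quad j" x] quad[of a "Suc j" x]
      by (simp add: Suc.IH del: quad.simps)
  qed
  have powers: "\<delta> a ?v ((left_gen ^^ k) c) x y = 0" if "\<And>a x y. \<delta> a ?v c x y = 0" for k c a x y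
  proof (induction k arbitrary: a x y)
    case (Suc k)
    from left[OF Suc.IH] show ?case by simp
  qed (simp add: that)
  have v: "\<forall>a x y. \<delta> a ?v c x y = 0" for c
  proof (induction c rule: U3_basis_induct_pred)
    case (5 k)
    show ?case using powers[OF gen] by blast
  next
    case (6 k j)
    show ?case using powers[OF quads] by blast
  qed (simp_all add: lin D)
  note lin2 = functional_simps[OF D(2)]
  have "b \<in> {b. \<forall>a c x y. \<delta> a b c x y = 0}"
  proof (rule U3_at_induct)
    show "U3.subspace {b. \<forall>a c x y. \<delta> a b c x y = 0}"
      unfolding U3.subspace_def by (simp add: lin2)
    show "?v \<in> {b. \<forall>a c x y. \<delta> a b c x y = 0}" using v by simp
  next
    fix b assume "b \<in> {b. \<forall>a c x y. \<delta> a b c x y = 0}"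
    then show "U3_der b \<in> {b. \<forall>a c x y. \<delta> a b c x y = 0}" by (simp add: D)
  next
    fix b b' z
    assume "b \<in> {b. \<forall>a c x y. \<delta> a b c x y = 0}" "b' \<in> {b. \<forall>a c x y. \<delta> a b c x y = 0}"
    moreover have "\<delta> a (lprod_at z b b') c x y = \<delta> (lprod_at x a b) b' c (x + z) (y - z) +
        \<delta> a b (lprod_at (y - z) b' c) x z" for a c x y
      using cocycle3_eq[OF assms(1), of a z b b' c x "y - z"] by simp
    ultimately show "lprod_at z b b' \<in> {b. \<forall>a c x y. \<delta> a b c x y = 0}" by simp
  qed
  then show ?thesis by simp
qed

text \<open>The difference of \<open>\<phi>\<close> and the coboundary of the extension vanishes by construction when the
  middle argument is \<open>v\<close> and the last one is \<open>v\<close>, or \<open>e\<^sub>j\<close> at \<open>y = 1\<close>, or arbitrary at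
  \<open>y = 0\<close>.\<close>

lemma cocycle3_coboundary_of_potential:
  fixes \<phi> :: "'k::field_char_0 U3 \<Rightarrow> _"
  assumes \<phi>: "cocycle3 \<phi>" and \<alpha>: "sesqui \<alpha>"
    and square_form: "\<And>a x. square_form x (\<alpha> a x) (\<lambda>y. \<phi> a U3_gen U3_gen x y + \<alpha> (lprod_at x a U3_gen) (x + y))"
  obtains \<psi> where "cochain2 \<psi>" "\<phi> = diff2 \<psi>"
proof -
  let ?v = "U3_gen :: 'k U3"
  have \<phi>3: "cochain3 \<phi>" using \<phi> by (simp add: cocycle3_def)
  obtain \<psi> where \<psi>: "cochain2 \<psi>" and gen: "\<And>a x. \<psi> a ?v x = \<alpha> a x"
    and quad: "\<And>a x. \<psi> a quad_gen x = ((\<phi> a ?v ?v x 1 + \<alpha> (lprod_at x a ?v) (x + 1))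
        + (\<phi> a ?v ?v x (- 1) + \<alpha> (lprod_at x a ?v) (x + (- 1)))
        - 2 * (\<phi> a ?v ?v x 0 + \<alpha> (lprod_at x a ?v) (x + 0))) / 2"
    and left: "\<And>a c x. \<psi> a (left_gen c) x = \<phi> a ?v c x 0 + \<psi> (lprod_at x a ?v) c x"
    and quad_Suc: "\<And>a j x. \<psi> a (quad (Suc j)) x = \<phi> a ?v (quad j) x 1 + \<psi> (lprod_at x a ?v) (quad j) (x + 1)
      - (\<phi> a ?v (quad j) x 0 + \<psi> (lprod_at x a ?v) (quad j) x)"
    by (rule potential_extends[OF \<phi>3 \<alpha>]) (rule that)
  note D = cochain2D[OF \<psi>]
  note lin = functional_simps[OF D(2)]
  define \<delta> where "\<delta> = (\<lambda>a b c x y. \<phi> a b c x y + (- 1) * diff2 \<psi> a b c x y)"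
  have \<delta>_eq: "\<delta> a b c x y = \<phi> a b c x y - \<psi> a (lprod_at y b c) x + \<psi> (lprod_at x a b) c (x + y)" for a b c x y
    by (simp add: \<delta>_def diff2_def)
  have "cocycle3 \<delta>"
    unfolding \<delta>_def by (rule cocycle3_add[OF \<phi> cocycle3_diff2[OF \<psi>]])
  moreover have "\<delta> a ?v c x 0 = 0" for a c x
    by (simp add: \<delta>_eq left flip: left_gen_lprod_at)
  moreover have "\<delta> a ?v ?v x y = 0" for a x y
  proof -
    have "\<phi> a ?v ?v x y + \<alpha> (lprod_at x a ?v) (x + y) = \<phi> a ?v ?v x 0 + \<alpha> (lprod_at x a ?v) (x + 0)
        + y * \<alpha> a x + y * (x + y) * \<psi> a quad_gen x"
      unfolding quad using square_form[of x a] unfolding square_form_def by (rule spec)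
    moreover have "\<psi> a (lprod_at y ?v ?v) x = \<phi> a ?v ?v x 0 + \<alpha> (lprod_at x a ?v) x
        + y * \<alpha> a x + y * (x + y) * \<psi> a quad_gen x"
      unfolding lprod_at_gen_gen lin D left gen by (simp add: power2_eq_square algebra_simps)
    moreover have "\<delta> a ?v ?v x y =
        (\<phi> a ?v ?v x y + \<alpha> (lprod_at x a ?v) (x + y)) - \<psi> a (lprod_at y ?v ?v) x"
      by (simp add: \<delta>_eq gen)
    ultimately show ?thesis by simp
  qed
  moreover have "\<delta> a ?v (quad j) x 1 = 0" for a j x
    unfolding \<delta>_eq lprod_at_gen_quad lin left quad_Suc by simp
  ultimately have "\<delta> a b c x y = 0" for a b c x y by (rule cocycle3_vanishes)
  then have "\<phi> a b c x y = diff2 \<psi> a b c x y" for a b c x y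
    unfolding \<delta>_def by (simp add: eq_neg_iff_add_eq_0)
  then have "\<phi> = diff2 \<psi>" by (intro ext)
  with \<psi> show ?thesis by (rule that)
qed

theorem unobstructed_coboundary:
  fixes \<phi> :: "'k::field_char_0 U3 \<Rightarrow> _"
  assumes "cocycle3 \<phi>" "obstruction \<phi> = 0"
  obtains \<psi> where "cochain2 \<psi>" "\<phi> = diff2 \<psi>"
proof -
  obtain \<psi>0 where \<psi>0: "cochain2 \<psi>0" and left: "left_normal (\<lambda>a b c x y. \<phi> a b c x y + diff2 \<psi>0 a b c x y)"
    by (rule left_normalize[OF assms(1)]) (rule that)
  define \<phi>' where "\<phi>' = (\<lambda>a b c x y. \<phi> a b c x y + 1 * diff2 \<psi>0 a b c x y)"
  have \<phi>': "cocycle3 \<phi>'" unfolding \<phi>'_def by (rule cocycle3_add[OF assms(1) cocycle3_diff2[OF \<psi>0]])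
  have left': "left_normal \<phi>'" using left by (simp add: \<phi>'_def)
  have c3: "cochain3 \<phi>" "cochain3 (diff2 \<psi>0)"
    using assms(1) cocycle3_diff2[OF \<psi>0] by (simp_all add: cocycle3_def)
  have obstr: "obstruction \<phi>' = 0"
    unfolding \<phi>'_def obstruction_add[OF c3] by (simp add: assms(2) obstruction_diff2[OF \<psi>0])
  obtain \<alpha> where \<alpha>: "\<And>x. functional (\<lambda>a. \<alpha> a x)" "\<And>a x. \<alpha> (U3_der a) x = - x * \<alpha> a x" "\<And>a. polyfun (\<alpha> a)"
    and square_form: "\<And>a x. square_form x (\<alpha> a x) (\<lambda>y. \<phi>' a U3_gen U3_gen x y + \<alpha> (lprod_at x a U3_gen) (x + y))"
    by (rule left_normal_potential[OF \<phi>' left' obstr]) (rule that)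
  obtain \<psi>1 where \<psi>1: "cochain2 \<psi>1" "\<phi>' = diff2 \<psi>1"
    by (rule cocycle3_coboundary_of_potential[OF \<phi>' sesquiI[OF \<alpha>] square_form]) (rule that)
  define \<psi> where "\<psi> = (\<lambda>a b x. \<psi>1 a b x - \<psi>0 a b x)"
  note D1 = cochain2D[OF \<psi>1(1)] and D0 = cochain2D[OF \<psi>0]
  have "cochain2 \<psi>"
    unfolding cochain2_def \<psi>_def
    by (intro conjI allI functional_diff polyfun_diff D0 D1) (simp_all add: D0 D1 algebra_simps)
  moreover have "\<phi> a b c x y = diff2 \<psi> a b c x y" for a b c x y
  proof -
    have "\<phi>' a b c x y = diff2 \<psi>1 a b c x y" using \<psi>1(2) by simp
    then show ?thesis by (simp add: \<phi>'_def diff2_def \<psi>_def algebra_simps)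
  qed
  then have "\<phi> = diff2 \<psi>" by (intro ext)
  ultimately show ?thesis by (rule that)
qed

section \<open>A cocycle with nonzero obstruction\<close>

text \<open>The symbol at \<open>\<lambda> = l\<close> and \<open>x = u\<close>, as a polynomial in the weight \<open>t\<close>.\<close>

definition kernel_at :: "'k::field_char_0 \<Rightarrow> 'k U3 \<Rightarrow> 'k \<Rightarrow> 'k poly" where
  "kernel_at l a u = poly (symbol l a) [:u:]"

lemma kernel_linear:
  "kernel_at l (a + b) u = kernel_at l a u + kernel_at l b u"
  "kernel_at l (U3_scale r a) u = Polynomial.smult r (kernel_at l a u)"
  "kernel_at l (U3_der a) u = Polynomial.smult (- l) (kernel_at l a u)"
  "kernel_at l 0 u = 0"
proof -
  show "kernel_at l (a + b) u = kernel_at l a u + kernel_at l b u"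
    "kernel_at l (U3_der a) u = Polynomial.smult (- l) (kernel_at l a u)"
    and *: "kernel_at l (U3_scale r a) u = Polynomial.smult r (kernel_at l a u)" for r a
    by (simp_all add: kernel_at_def symbol_linear)
  show "kernel_at l 0 u = 0" using *[of 0 0] by simp
qed

lemma kernel_lprod: "kernel_at l (lprod_at x a b) u = kernel_at x a u * kernel_at (l - x) b (u + x)"
  using symbol_lprod_at[of x "l - x" a b] by (simp add: kernel_at_def poly_pcompose add.commute)

lemma kernel_gen: "kernel_at l U3_gen u = [:u, l:]"
  by (simp add: kernel_at_def symbol_gen)

lemma kernel_left_gen: "kernel_at l (left_gen a) u = Polynomial.smult u (kernel_at l a u)"
  by (simp add: kernel_at_def symbol_left_gen)

lemma kernel_left_gen_power: "kernel_at l ((left_gen ^^ k) a) u = Polynomial.smult (u ^ k) (kernel_at l a u)"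
  by (induction k) (simp_all add: kernel_left_gen)

lemma kernel_quad: "kernel_at l (quad j) u = [:0, 1:] ^ Suc j - [:0, 1:] ^ Suc (Suc j)"
  by (simp add: kernel_at_def symbol_quad del: power_Suc quad.simps)

lemma U3_at_induct_pred:
  assumes "P 0" "\<And>a b. P a \<Longrightarrow> P b \<Longrightarrow> P (a + b)" "\<And>r a. P a \<Longrightarrow> P (U3_scale r a)"
    and "\<And>a. P a \<Longrightarrow> P (U3_der a)" "P U3_gen" "\<And>a b x. P a \<Longrightarrow> P b \<Longrightarrow> P (lprod_at x a b)"
  shows "P a"
proof -
  have "U3.subspace {a. P a}" unfolding U3.subspace_def using assms(1-3) by blast
  then have "a \<in> {a. P a}" by (rule U3_at_induct) (use assms(4-6) in auto)
  then show ?thesis by simp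
qed

text \<open>Weights 0 and 1 are intertwined by multiplication by \<open>x\<close>: this is the identity
  \<open>(u + l)u = u(u + l)\<close> for the generator, and it is multiplicative along products.\<close>

lemma kernel_ends:
  fixes u l :: "'k::field_char_0"
  shows "(u + l) * poly (kernel_at l a u) 0 = u * poly (kernel_at l a u) 1"
proof (induction a arbitrary: u l rule: U3_at_induct_pred)
  case (3 r a)
  have "(u + l) * (r * poly (kernel_at l a u) 0) = r * ((u + l) * poly (kernel_at l a u) 0)"
    by (simp only: mult.left_commute)
  also have "\<dots> = u * (r * poly (kernel_at l a u) 1)"
    unfolding 3 by (simp only: mult.left_commute)
  finally show ?case by (simp add: kernel_linear)
next
  case (4 a)
  have "(u + l) * (- l * poly (kernel_at l a u) 0) = - l * ((u + l) * poly (kernel_at l a u) 0)"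
    by (simp only: mult.left_commute)
  also have "\<dots> = u * (- l * poly (kernel_at l a u) 1)"
    unfolding 4 by (simp only: mult.left_commute)
  finally show ?case by (simp add: kernel_linear)
next
  case (6 a b x)
  have "(u + l) * poly (kernel_at l (lprod_at x a b) u) 0 =
      poly (kernel_at x a u) 0 * (((u + x) + (l - x)) * poly (kernel_at (l - x) b (u + x)) 0)"
    by (simp add: kernel_lprod)
  also have "\<dots> = ((u + x) * poly (kernel_at x a u) 0) * poly (kernel_at (l - x) b (u + x)) 1"
    unfolding 6(2) by simp
  also have "\<dots> = u * poly (kernel_at l (lprod_at x a b) u) 1"
    unfolding 6(1) by (simp add: kernel_lprod)
  finally show ?case .
qed (simp_all add: kernel_gen kernel_linear algebra_simps)

text \<open>For the generator these are the zeros of \<open>u\<close> at \<open>u = 0\<close> and of \<open>u + l\<close> at \<open>l = - u\<close>.  A product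
  inherits the first from its left factor and the second from its right one.\<close>

lemma kernel_zeros:
  fixes u l :: "'k::field_char_0"
  shows "poly (kernel_at l a 0) 0 = 0" "poly (kernel_at (- u) a u) 1 = 0"
proof -
  show "poly (kernel_at l a 0) 0 = 0"
    by (induction a arbitrary: l rule: U3_at_induct_pred) (simp_all add: kernel_gen kernel_linear kernel_lprod)
  show "poly (kernel_at (- u) a u) 1 = 0"
  proof (induction a arbitrary: u rule: U3_at_induct_pred)
    case (6 a b x)
    show ?case using 6(2)[of "u + x"] by (simp add: kernel_lprod)
  qed (simp_all add: kernel_gen kernel_linear)
qed

text \<open>The coefficient of \<open>x\<close> in the symbol at weight 0.  As the constant coefficient is zero, it is
  multiplicative against the value of the symbol of the right factor.\<close>

definition lin_coeff :: "'k::field_char_0 U3 \<Rightarrow> 'k \<Rightarrow> 'k" where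
  "lin_coeff a x = poly (coeff (symbol x a) 1) 0"

definition slope0 :: "'k::field_char_0 U3 \<Rightarrow> 'k \<Rightarrow> 'k \<Rightarrow> 'k" where
  "slope0 b x y = poly (pderiv (kernel_at y b x)) 0"

definition slope1 :: "'k::field_char_0 U3 \<Rightarrow> 'k \<Rightarrow> 'k" where
  "slope1 c s = poly (pderiv (kernel_at (- s) c s)) 1"

lemma lin_coeff_lprod: "lin_coeff (lprod_at x a b) (x + y) = lin_coeff a x * poly (kernel_at y b x) 0"
proof -
  have c0: "coeff p 0 = poly p 0" for p :: "'a poly poly" by (simp add: poly_0_coeff_0)
  have "poly (poly (symbol x a) 0) 0 = 0" using kernel_zeros(1)[of x a] by (simp add: kernel_at_def)
  then show ?thesis
    unfolding lin_coeff_def symbol_lprod_at coeff_mult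
    by (simp add: c0 poly_pcompose kernel_at_def)
qed

lemma slope0_lprod:
  "slope0 (lprod_at y b c) x (y + z) = slope0 b x y * poly (kernel_at z c (x + y)) 0
    + poly (kernel_at y b x) 0 * slope0 c (x + y) z"
  by (simp add: slope0_def kernel_lprod pderiv_mult algebra_simps)

lemma slope1_lprod: "slope1 (lprod_at z c d) s = poly (kernel_at z c s) 1 * slope1 d (s + z)"
  using kernel_zeros(2)[of "s + z" d] by (simp add: slope1_def kernel_lprod pderiv_mult)

lemma lin_coeff_sesqui: "sesqui lin_coeff"
proof (rule sesquiI)
  show f: "functional (\<lambda>a. lin_coeff a x)" for x :: 'a
    by (rule functionalI) (simp_all add: lin_coeff_def symbol_linear)
  show d: "lin_coeff (U3_der a) x = - x * lin_coeff a x" for a and x :: 'a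
    by (simp add: lin_coeff_def symbol_linear)
  have L: "lin_coeff (left_gen a) x = 0" for a and x :: 'a
  proof -
    have "poly (poly (symbol x a) 0) 0 = 0" using kernel_zeros(1)[of x a] by (simp add: kernel_at_def)
    then show ?thesis by (simp add: lin_coeff_def symbol_left_gen poly_0_coeff_0)
  qed
  have gen: "lin_coeff U3_gen = (\<lambda>x :: 'a. 1)"
    by (intro ext) (simp add: lin_coeff_def symbol_gen)
  have quad: "lin_coeff (quad j) = (\<lambda>x :: 'a. 0)" for j
    by (intro ext) (simp add: lin_coeff_def symbol_quad del: power_Suc quad.simps)
  have Suc: "lin_coeff ((left_gen ^^ Suc k) a) = (\<lambda>x :: 'a. 0)" for k a
    by (intro ext) (simp add: L)
  show "polyfun (lin_coeff a)" for a :: "'a U3"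
  proof (rule U3_polyfunI[of lin_coeff "\<lambda>x. - x"])
    show "polyfun (lin_coeff ((left_gen ^^ k) U3_gen) :: 'a \<Rightarrow> 'a)" for k
      by (cases k) (simp_all only: gen Suc funpow_0 polyfun_const)
    show "polyfun (lin_coeff ((left_gen ^^ k) (quad j)) :: 'a \<Rightarrow> 'a)" for k j
      by (cases k) (simp_all only: quad Suc funpow_0 polyfun_const)
  qed (simp_all add: f d polyfun_uminus polyfun_id)
qed

lemma slope0_linear: "functional (\<lambda>b. slope0 b x y)" "slope0 (U3_der b) x y = - y * slope0 b x y"
  by (rule functionalI) (simp_all add: slope0_def kernel_linear pderiv_add pderiv_smult pderiv_minus)

lemma slope1_linear: "functional (\<lambda>c. slope1 c s)" "slope1 (U3_der c) s = s * slope1 c s"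
  by (rule functionalI) (simp_all add: slope1_def kernel_linear pderiv_add pderiv_smult pderiv_minus)

lemma slope0_left_gen_power: "slope0 ((left_gen ^^ k) b) x y = x ^ k * slope0 b x y"
  by (simp add: slope0_def kernel_left_gen_power pderiv_smult)

lemma slope1_left_gen_power: "slope1 ((left_gen ^^ k) c) s = s ^ k * slope1 c s"
  by (simp add: slope1_def kernel_left_gen_power pderiv_smult)

lemma slope_gen: "slope0 U3_gen x y = y" "slope1 U3_gen s = - s"
  by (simp_all add: slope0_def slope1_def kernel_gen pderiv_pCons)

lemma polyfun2_slope0: "polyfun2 (slope0 b)"
proof (induction b rule: U3_basis_induct_pred)
  case 1
  show ?case using polyfun2_const[of 0] unfolding functional_simps(5)[OF slope0_linear(1), abs_def] .
next
  case (2 a b)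
  have "slope0 (a + b) = (\<lambda>x y. slope0 a x y + slope0 b x y)"
    by (intro ext) (simp add: functional_simps[OF slope0_linear(1)])
  then show ?case using polyfun2_add[OF 2] by simp
next
  case (3 r a)
  have "slope0 (U3_scale r a) = (\<lambda>x y. r * slope0 a x y)"
    by (intro ext) (simp add: functional_simps[OF slope0_linear(1)])
  then show ?case using polyfun2_mult[OF polyfun2_const 3] by simp
next
  case (4 a)
  have "slope0 (U3_der a) = (\<lambda>x y. - y * slope0 a x y)"
    by (intro ext) (simp add: slope0_linear)
  then show ?case using polyfun2_mult[OF polyfun2_uminus[OF polyfun2_snd] 4] by simp
next
  case (5 k)
  have "slope0 ((left_gen ^^ k) U3_gen) = (\<lambda>x y :: 'a. x ^ k * y)"
    by (intro ext) (simp add: slope0_left_gen_power slope_gen)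
  then show ?case using polyfun2_mult[OF polyfun2_power[OF polyfun2_fst] polyfun2_snd] by simp
next
  case (6 k j)
  have "slope0 ((left_gen ^^ k) (quad j)) = (\<lambda>x y :: 'a. x ^ k * slope0 (quad j) 0 0)"
    unfolding slope0_left_gen_power by (intro ext) (simp add: slope0_def kernel_quad del: power_Suc quad.simps)
  then show ?case using polyfun2_mult[OF polyfun2_power[OF polyfun2_fst] polyfun2_const] by simp
qed

lemma polyfun_slope1: "polyfun (slope1 c)"
proof (rule U3_polyfunI[of slope1 "\<lambda>s. s"])
  fix k j
  have "slope1 ((left_gen ^^ k) U3_gen) = (\<lambda>s :: 'a. s ^ k * - s)"
    by (intro ext) (simp add: slope1_left_gen_power slope_gen)
  then show "polyfun (slope1 ((left_gen ^^ k) U3_gen) :: 'a \<Rightarrow> 'a)"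
    using polyfun_mult[OF polyfun_power[OF polyfun_id] polyfun_uminus[OF polyfun_id]] by simp
  have "slope1 ((left_gen ^^ k) (quad j)) = (\<lambda>s :: 'a. s ^ k * slope1 (quad j) 0)"
    unfolding slope1_left_gen_power by (intro ext) (simp add: slope1_def kernel_quad del: power_Suc quad.simps)
  then show "polyfun (slope1 ((left_gen ^^ k) (quad j)) :: 'a \<Rightarrow> 'a)"
    using polyfun_mult[OF polyfun_power[OF polyfun_id] polyfun_const] by simp
qed (rule slope1_linear polyfun_id)+

text \<open>The product of three functionals, one for each argument.  In the differential the product rule for
  \<open>slope0\<close> produces a term for each neighbour: one cancels against \<open>lin_coeff_lprod\<close>, the other
  against \<open>slope1_lprod\<close> by \<open>kernel_ends\<close>, for which the factor \<open>x + y\<close> is needed.\<close>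

definition slope_cocycle :: "'k::field_char_0 U3 \<Rightarrow> 'k U3 \<Rightarrow> 'k U3 \<Rightarrow> 'k \<Rightarrow> 'k \<Rightarrow> 'k" where
  "slope_cocycle a b c x y = lin_coeff a x * (slope0 b x y * ((x + y) * slope1 c (x + y)))"

lemma slope_cocycle: "cocycle3 (slope_cocycle :: 'k::field_char_0 U3 \<Rightarrow> _)"
  unfolding cocycle3_def
proof (intro conjI allI)
  note f = sesquiD[OF lin_coeff_sesqui]
  show "cochain3 (slope_cocycle :: 'k U3 \<Rightarrow> _)"
    unfolding cochain3_def
  proof (intro conjI allI)
    fix a b c and x y :: 'k
    show "functional (\<lambda>a. slope_cocycle a b c x y)" "functional (\<lambda>b. slope_cocycle a b c x y)"
      "functional (\<lambda>c. slope_cocycle a b c x y)"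
      by (rule functionalI; simp add: slope_cocycle_def functional_simps[OF f(1)] functional_simps[OF slope0_linear(1)]
          functional_simps[OF slope1_linear(1)] algebra_simps)+
    show "slope_cocycle (U3_der a) b c x y = - x * slope_cocycle a b c x y"
      "slope_cocycle a (U3_der b) c x y = - y * slope_cocycle a b c x y"
      "slope_cocycle a b (U3_der c) x y = (x + y) * slope_cocycle a b c x y"
      by (simp_all add: slope_cocycle_def f slope0_linear slope1_linear)
    have "polyfun (\<lambda>s. s * slope1 c s)" by (rule polyfun_mult[OF polyfun_id polyfun_slope1])
    then show "polyfun2 (slope_cocycle a b c)"
      unfolding slope_cocycle_def[abs_def]
      by (intro polyfun2_mult polyfun_compose2[OF f(3) polyfun2_fst] polyfun2_slope0 polyfun2_plus)
  qed
  fix a b c d :: "'k U3" and x y z :: 'k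
  have "diff3 slope_cocycle a b c d x y z = lin_coeff a x * slope0 b x y * slope1 d (x + y + z) *
      (((x + y) + z) * poly (kernel_at z c (x + y)) 0 - (x + y) * poly (kernel_at z c (x + y)) 1)"
    unfolding diff3_def slope_cocycle_def lin_coeff_lprod slope0_lprod slope1_lprod
    by (simp add: add.assoc[symmetric]) (simp add: algebra_simps)
  then show "diff3 slope_cocycle a b c d x y z = 0" by (simp add: kernel_ends)
qed

lemma obstruction_slope_cocycle: "obstruction (slope_cocycle :: 'k::field_char_0 U3 \<Rightarrow> _) = 1"
proof -
  \<comment> \<open>The value is - y (x + y)^2, whose coefficients of x^2 y and x y^2 are - 1 and - 2.\<close>
  have gen: "slope_cocycle U3_gen U3_gen U3_gen x y =
      poly (poly [:0, [:0, 0, - 1:], [:0, - 2:], [:- 1:]:] [:y:]) x" for x y :: 'k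
    by (simp add: slope_cocycle_def slope_gen lin_coeff_def symbol_gen algebra_simps)
  show ?thesis
    unfolding obstruction_def coeff2_eq[OF gen] by (simp add: eval_nat_numeral)
qed

section \<open>The dimension\<close>

text \<open>A coset of the kernel of a functional is a level set of that functional, so the quotient is
  identified with the field.\<close>

lemma quotient_space_dim_1:
  fixes scale :: "'k::field \<Rightarrow> 'v::ab_group_add \<Rightarrow> 'v" and \<omega> :: "'v \<Rightarrow> 'k"
  assumes "vector_space scale"
    and Z: "\<And>z w r. z \<in> Z \<Longrightarrow> w \<in> Z \<Longrightarrow> z + scale r w \<in> Z"
    and \<omega>: "\<And>z w r. z \<in> Z \<Longrightarrow> w \<in> Z \<Longrightarrow> \<omega> (z + scale r w) = \<omega> z + r * \<omega> w"
    and B: "B = {z \<in> Z. \<omega> z = 0}"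
    and e: "e \<in> Z" "\<omega> e = 1"
  defines "Q \<equiv> quotient_space scale Z B"
  shows "vectorspace class_ring Q" "vectorspace.fin_dim class_ring Q" "vectorspace.dim class_ring Q = 1"
proof -
  interpret v: vector_space scale by (rule assms(1))
  have Z0: "0 \<in> Z" using Z[OF e(1) e(1), of "- 1"] by simp
  have \<omega>0: "\<omega> 0 = 0" using \<omega>[OF e(1) e(1), of "- 1"] by simp
  have Zadd: "z + w \<in> Z" and \<omega>add: "\<omega> (z + w) = \<omega> z + \<omega> w" if "z \<in> Z" "w \<in> Z" for z w
    using Z[OF that, of 1] \<omega>[OF that, of 1] by simp_all
  have Zscale: "scale r z \<in> Z" and \<omega>scale: "\<omega> (scale r z) = r * \<omega> z" if "z \<in> Z" for z r
    using Z[OF Z0 that, of r] \<omega>[OF Z0 that, of r] by (simp_all add: \<omega>0)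
  have Zminus: "- z \<in> Z" and \<omega>minus: "\<omega> (- z) = - \<omega> z" if "z \<in> Z" for z
    using Zscale[OF that, of "- 1"] \<omega>scale[OF that, of "- 1"] by simp_all
  have B0: "0 \<in> B" by (simp add: B Z0 \<omega>0)
  have coset: "z +o B = {w \<in> Z. \<omega> w = \<omega> z}" if z: "z \<in> Z" for z
  proof (intro equalityI subsetI)
    fix w assume "w \<in> z +o B"
    then obtain b where "b \<in> B" "w = z + b" by (auto simp: elt_set_plus_def)
    then show "w \<in> {w \<in> Z. \<omega> w = \<omega> z}" using z by (auto simp: B Zadd \<omega>add)
  next
    fix w assume w: "w \<in> {w \<in> Z. \<omega> w = \<omega> z}"
    then have "w + - z \<in> B" using z Zadd[of w "- z"] \<omega>add[of w "- z"] by (simp add: B Zminus \<omega>minus)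
    moreover have "w = z + (w + - z)" by simp
    ultimately show "w \<in> z +o B" unfolding elt_set_plus_def by blast
  qed
  have coset_eq: "z +o B = w +o B \<longleftrightarrow> \<omega> z = \<omega> w" if "z \<in> Z" "w \<in> Z" for z w
    unfolding coset[OF that(1)] coset[OF that(2)] using that by auto
  have carrier: "carrier Q = (\<lambda>z. z +o B) ` Z" and zero: "\<zero>\<^bsub>Q\<^esub> = 0 +o B"
    by (simp_all add: Q_def quotient_space_def)
  have add: "(z +o B) \<oplus>\<^bsub>Q\<^esub> (w +o B) = (z + w) +o B" if "z \<in> Z" "w \<in> Z" for z w
  proof -
    have "(z +o B) + (w +o B) = (z + w) +o B"
    proof (intro equalityI subsetI)
      fix u assume "u \<in> (z +o B) + (w +o B)"
      then obtain p q where "p \<in> z +o B" "q \<in> w +o B" "u = p + q" by (auto simp: set_plus_def)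
      then show "u \<in> (z + w) +o B" using that by (simp add: coset Zadd \<omega>add)
    next
      fix u assume "u \<in> (z + w) +o B"
      then obtain b where "b \<in> B" "u = (z + 0) + (w + b)" by (auto simp: elt_set_plus_def add.assoc)
      then show "u \<in> (z +o B) + (w +o B)" using B0 by (auto simp: set_plus_def elt_set_plus_def)
    qed
    then show ?thesis by (simp add: Q_def quotient_space_def)
  qed
  have smult: "r \<odot>\<^bsub>Q\<^esub> (z +o B) = scale r z +o B" if "z \<in> Z" for r z
  proof -
    have "scale r ` (z +o B) + B = scale r z +o B"
    proof (intro equalityI subsetI)
      fix u assume "u \<in> scale r ` (z +o B) + B"
      then obtain p b where "p \<in> z +o B" "b \<in> B" and u: "u = scale r p + b" by (auto simp: set_plus_def)
      then have p: "p \<in> Z" "\<omega> p = \<omega> z" and b: "b \<in> Z" "\<omega> b = 0"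
        using coset[OF that] by (simp_all add: B)
      show "u \<in> scale r z +o B"
        unfolding u coset[OF Zscale[OF that]]
        by (simp add: p b that Zadd Zscale \<omega>add \<omega>scale)
    next
      fix u assume "u \<in> scale r z +o B"
      then obtain b where b: "b \<in> B" "u = scale r (z + 0) + b" by (auto simp: elt_set_plus_def)
      have "z + 0 \<in> z +o B" using B0 by (rule set_plus_intro2)
      then show "u \<in> scale r ` (z +o B) + B"
        unfolding b(2) by (intro set_plus_intro imageI b(1))
    qed
    then show ?thesis by (simp add: Q_def quotient_space_def)
  qed
  have ab: "abelian_group Q"
  proof (rule abelian_groupI)
    fix X Y W assume "X \<in> carrier Q" "Y \<in> carrier Q" "W \<in> carrier Q"
    then obtain z w u where *: "z \<in> Z" "w \<in> Z" "u \<in> Z" "X = z +o B" "Y = w +o B" "W = u +o B"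
      unfolding carrier by blast
    show "X \<oplus>\<^bsub>Q\<^esub> Y \<oplus>\<^bsub>Q\<^esub> W = X \<oplus>\<^bsub>Q\<^esub> (Y \<oplus>\<^bsub>Q\<^esub> W)" using * by (simp add: add Zadd add.assoc)
  next
    fix X Y assume "X \<in> carrier Q" "Y \<in> carrier Q"
    then obtain z w where *: "z \<in> Z" "w \<in> Z" "X = z +o B" "Y = w +o B" unfolding carrier by blast
    show "X \<oplus>\<^bsub>Q\<^esub> Y = Y \<oplus>\<^bsub>Q\<^esub> X" using * by (simp add: add add.commute)
    show "X \<oplus>\<^bsub>Q\<^esub> Y \<in> carrier Q" using * by (simp add: add carrier Zadd)
  next
    show "\<zero>\<^bsub>Q\<^esub> \<in> carrier Q" unfolding carrier zero using Z0 by (rule imageI)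
  next
    fix X assume "X \<in> carrier Q"
    then obtain z where *: "z \<in> Z" "X = z +o B" unfolding carrier by blast
    show "\<zero>\<^bsub>Q\<^esub> \<oplus>\<^bsub>Q\<^esub> X = X" unfolding zero *(2) add[OF Z0 *(1)] by simp
    have "(- z) +o B \<in> carrier Q" unfolding carrier using Zminus[OF *(1)] by (rule imageI)
    moreover have "(- z) +o B \<oplus>\<^bsub>Q\<^esub> X = \<zero>\<^bsub>Q\<^esub>" using * by (simp add: add zero Zminus)
    ultimately show "\<exists>Y\<in>carrier Q. Y \<oplus>\<^bsub>Q\<^esub> X = \<zero>\<^bsub>Q\<^esub>" by blast
  qed
  have mod: "Module.module (class_ring :: 'k ring) Q"
  proof (rule moduleI[OF _ ab])
    show "cring (class_ring :: 'k ring)" by (rule class_cring.is_cring)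
  next
    fix r q :: 'k and X Y assume "X \<in> carrier Q" "Y \<in> carrier Q"
    then obtain z w where *: "z \<in> Z" "w \<in> Z" "X = z +o B" "Y = w +o B" unfolding carrier by blast
    show "r \<odot>\<^bsub>Q\<^esub> (X \<oplus>\<^bsub>Q\<^esub> Y) = r \<odot>\<^bsub>Q\<^esub> X \<oplus>\<^bsub>Q\<^esub> r \<odot>\<^bsub>Q\<^esub> Y"
      using * by (simp add: add smult Zadd Zscale v.scale_right_distrib)
  next
    fix r q :: 'k and X assume "X \<in> carrier Q"
    then obtain z where *: "z \<in> Z" "X = z +o B" unfolding carrier by blast
    show "r \<odot>\<^bsub>Q\<^esub> X \<in> carrier Q" using * by (simp add: smult carrier Zscale)
    show "(r \<oplus>\<^bsub>class_ring\<^esub> q) \<odot>\<^bsub>Q\<^esub> X = r \<odot>\<^bsub>Q\<^esub> X \<oplus>\<^bsub>Q\<^esub> q \<odot>\<^bsub>Q\<^esub> X"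
      using * by (simp add: add smult Zscale v.scale_left_distrib)
    show "(r \<otimes>\<^bsub>class_ring\<^esub> q) \<odot>\<^bsub>Q\<^esub> X = r \<odot>\<^bsub>Q\<^esub> (q \<odot>\<^bsub>Q\<^esub> X)"
      using * by (simp add: smult Zscale)
    show "\<one>\<^bsub>class_ring\<^esub> \<odot>\<^bsub>Q\<^esub> X = X" using * by (simp add: smult)
  qed
  show vs: "vectorspace class_ring Q"
    by (rule vectorspace.intro[OF mod class_field.field_axioms])
  interpret q: vectorspace "class_ring :: 'k ring" Q by (rule vs)
  let ?e = "e +o B"
  have eQ: "?e \<in> carrier Q" unfolding carrier using e(1) by (rule imageI)
  have gen: "q.gen_set {?e}"
  proof
    have sub: "submodule class_ring (q.span {?e}) Q" by (rule q.span_is_submodule) (use eQ in simp)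
    then show "q.span {?e} \<subseteq> carrier Q" by (rule submodule.subset)
    show "carrier Q \<subseteq> q.span {?e}"
    proof
      fix X assume "X \<in> carrier Q"
      then obtain z where z: "z \<in> Z" "X = z +o B" unfolding carrier by blast
      have "X = \<omega> z \<odot>\<^bsub>Q\<^esub> ?e"
        using z e by (simp add: smult coset_eq Zscale \<omega>scale)
      moreover have "?e \<in> q.span {?e}" using q.in_own_span[of "{?e}"] eQ by simp
      ultimately show "X \<in> q.span {?e}" using submodule.smult_closed[OF sub] by simp
    qed
  qed
  show "q.fin_dim" unfolding q.fin_dim_def using gen eQ by (intro exI[of _ "{?e}"]) simp
  have "?e \<noteq> \<zero>\<^bsub>Q\<^esub>" unfolding zero coset_eq[OF e(1) Z0] by (simp add: e(2) \<omega>0)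
  then show "q.dim = 1" by (rule q.dim1I[OF gen _ eQ])
qed

lemma vector_space_cochain_scale: "vector_space (cochain_scale :: 'k::field_char_0 \<Rightarrow> ('a list \<Rightarrow> 'k mpoly) \<Rightarrow> _)"
proof
  fix r q :: 'k and \<phi> \<psi> :: "'a list \<Rightarrow> 'k mpoly"
  show "cochain_scale r (\<phi> + \<psi>) = cochain_scale r \<phi> + cochain_scale r \<psi>"
    by (intro ext) (simp add: cochain_scale_def distrib_left)
  show "cochain_scale (r + q) \<phi> = cochain_scale r \<phi> + cochain_scale q \<phi>"
    by (intro ext) (simp add: cochain_scale_def const_def single_add distrib_right)
  show "cochain_scale r (cochain_scale q \<phi>) = cochain_scale (r * q) \<phi>"
    by (intro ext) (simp add: cochain_scale_def const_def mult_single flip: mult.assoc)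
  show "cochain_scale 1 \<phi> = \<phi>"
    by (intro ext) (simp add: cochain_scale_def const_def)
qed

text \<open>A family of polynomials whose values form a cochain is a cochain; this transports the vector space
  operations and the differential from functions back to polynomials.\<close>

lemma cochains_3I:
  fixes \<Phi> :: "'k::field_char_0 U3 list \<Rightarrow> 'k mpoly"
  assumes "cochain3 \<phi>" "\<And>as. length as \<noteq> 3 \<Longrightarrow> \<Phi> as = 0"
    and "\<And>v a b c. mpoly_eval v (\<Phi> [a, b, c]) = \<phi> a b c (v 0) (v 1)"
  shows "\<Phi> \<in> U3.cochains 3" "eval3 \<Phi> = \<phi>"
proof -
  obtain \<Psi> where \<Psi>: "\<Psi> \<in> U3.cochains 3" "eval3 \<Psi> = \<phi>" by (rule realize_cochain3[OF assms(1)])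
  have "\<Phi> as = \<Psi> as" for as
  proof (cases "length as = 3")
    case True
    then obtain a b c where as: "as = [a, b, c]" by (rule length_3E)
    show ?thesis by (rule mpoly_eqI) (simp add: as assms(3) mpoly_eval_cochain3[OF \<Psi>(1)] \<Psi>(2))
  qed (simp add: assms(2) cochains_zero[OF \<Psi>(1)])
  then have "\<Phi> = \<Psi>" by (intro ext)
  then show "\<Phi> \<in> U3.cochains 3" "eval3 \<Phi> = \<phi>" using \<Psi> by simp_all
qed

lemma cocycle3_eval3: "\<Phi> \<in> U3.cocycles 3 \<longleftrightarrow> \<Phi> \<in> U3.cochains 3 \<and> cocycle3 (eval3 \<Phi>)"
  unfolding cocycles_3_iff cocycle3_def using cochain3_eval3 by blast

lemma cocycles_3_combination:
  assumes "\<Phi> \<in> U3.cocycles 3" "\<Psi> \<in> U3.cocycles 3"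
  shows "\<Phi> + cochain_scale r \<Psi> \<in> U3.cocycles 3"
    and "obstruction (eval3 (\<Phi> + cochain_scale r \<Psi>)) = obstruction (eval3 \<Phi>) + r * obstruction (eval3 \<Psi>)"
proof -
  have c: "\<Phi> \<in> U3.cochains 3" "\<Psi> \<in> U3.cochains 3" and z: "cocycle3 (eval3 \<Phi>)" "cocycle3 (eval3 \<Psi>)"
    using assms by (simp_all add: cocycle3_eval3)
  let ?\<chi> = "\<lambda>a b c x y. eval3 \<Phi> a b c x y + r * eval3 \<Psi> a b c x y"
  have \<chi>: "cocycle3 ?\<chi>" by (rule cocycle3_add[OF z])
  then have \<chi>3: "cochain3 ?\<chi>" by (simp add: cocycle3_def)
  have eval: "mpoly_eval v ((\<Phi> + cochain_scale r \<Psi>) [a, b, c]) = ?\<chi> a b c (v 0) (v 1)" for v a b c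
    by (simp add: cochain_scale_def mpoly_eval_simps mpoly_eval_cochain3[OF c(1)] mpoly_eval_cochain3[OF c(2)])
  have "(\<Phi> + cochain_scale r \<Psi>) as = 0" if "length as \<noteq> 3" for as
    using that by (simp add: cochain_scale_def cochains_zero[OF c(1)] cochains_zero[OF c(2)])
  note * = cochains_3I[where \<Phi> = "\<Phi> + cochain_scale r \<Psi>", OF \<chi>3 this eval]
  have "cocycle3 (eval3 (\<Phi> + cochain_scale r \<Psi>))"
    using \<chi> arg_cong[OF *(2), of cocycle3] by blast
  with *(1) show "\<Phi> + cochain_scale r \<Psi> \<in> U3.cocycles 3" by (simp add: cocycle3_eval3)
  have "cochain3 (eval3 \<Phi>)" "cochain3 (eval3 \<Psi>)" using z by (simp_all add: cocycle3_def)
  then have "obstruction ?\<chi> = obstruction (eval3 \<Phi>) + r * obstruction (eval3 \<Psi>)"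
    by (rule obstruction_add)
  then show "obstruction (eval3 (\<Phi> + cochain_scale r \<Psi>)) = obstruction (eval3 \<Phi>) + r * obstruction (eval3 \<Psi>)"
    using arg_cong[OF *(2), of obstruction] by (rule trans[rotated])
qed

text \<open>The two halves of the computation: coboundaries have no obstruction, and cocycles without
  obstruction are coboundaries.\<close>

lemma coboundaries_3_eq:
  "U3.coboundaries 3 = {\<Phi> \<in> U3.cocycles 3. obstruction (eval3 \<Phi>) = 0}"
proof (intro equalityI subsetI)
  fix \<Phi> :: "'a U3 list \<Rightarrow> 'a mpoly"
  assume "\<Phi> \<in> U3.coboundaries 3"
  then obtain \<Psi> where \<Psi>: "\<Psi> \<in> U3.cochains 2" "\<Phi> = U3.hochschild_d 2 \<Psi>"
    unfolding coboundaries_3_iff by blast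
  have \<psi>: "cochain2 (eval2 \<Psi>)" by (rule cochain2_eval2[OF \<Psi>(1)])
  have d: "cocycle3 (diff2 (eval2 \<Psi>))" by (rule cocycle3_diff2[OF \<psi>])
  have "\<Phi> \<in> U3.cochains 3"
  proof (rule cochains_3I(1))
    show "cochain3 (diff2 (eval2 \<Psi>))" using d by (simp add: cocycle3_def)
    show "\<Phi> as = 0" if "length as \<noteq> 3" for as using that by (simp add: \<Psi>(2) U3.hochschild_d_def)
    show "mpoly_eval v (\<Phi> [a, b, c]) = diff2 (eval2 \<Psi>) a b c (v 0) (v 1)" for v a b c
      unfolding \<Psi>(2) by (rule mpoly_eval_hochschild_d_2[OF \<Psi>(1)])
  qed
  moreover have "eval3 \<Phi> = diff2 (eval2 \<Psi>)" unfolding \<Psi>(2) by (rule eval3_coboundary[OF \<Psi>(1)])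
  ultimately show "\<Phi> \<in> {\<Phi> \<in> U3.cocycles 3. obstruction (eval3 \<Phi>) = 0}"
    using d obstruction_diff2[OF \<psi>] by (simp add: cocycle3_eval3)
next
  fix \<Phi> :: "'a U3 list \<Rightarrow> 'a mpoly"
  assume "\<Phi> \<in> {\<Phi> \<in> U3.cocycles 3. obstruction (eval3 \<Phi>) = 0}"
  then have \<Phi>: "\<Phi> \<in> U3.cochains 3" "cocycle3 (eval3 \<Phi>)" "obstruction (eval3 \<Phi>) = 0"
    by (simp_all add: cocycle3_eval3)
  obtain \<psi> where "cochain2 \<psi>" "eval3 \<Phi> = diff2 \<psi>"
    by (rule unobstructed_coboundary[OF \<Phi>(2,3)]) (rule that)
  then show "\<Phi> \<in> U3.coboundaries 3" by (rule coboundaryI[OF \<Phi>(1)])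
qed

theorem proposition4p10:
  "vectorspace (class_ring :: 'k::field_char_0 ring) (U3.cohomology 3) \<and>
   vectorspace.fin_dim (class_ring :: 'k ring) (U3.cohomology 3) \<and>
   vectorspace.dim (class_ring :: 'k ring) (U3.cohomology 3) = 1"
proof -
  have "cochain3 (slope_cocycle :: 'k U3 \<Rightarrow> _)" by (rule slope_cocycle[unfolded cocycle3_def, THEN conjunct1])
  then obtain E :: "'k U3 list \<Rightarrow> 'k mpoly" where E: "E \<in> U3.cochains 3" "eval3 E = slope_cocycle"
    by (rule realize_cochain3) (rule that)
  have Z: "E \<in> U3.cocycles 3" using E by (simp add: cocycle3_eval3 slope_cocycle)
  have \<omega>: "obstruction (eval3 E) = 1" unfolding E(2) by (rule obstruction_slope_cocycle)
  show ?thesis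
    unfolding U3.cohomology_def
    using quotient_space_dim_1[where \<omega> = "\<lambda>\<Phi>. obstruction (eval3 \<Phi>)", OF vector_space_cochain_scale cocycles_3_combination(1)
        cocycles_3_combination(2) coboundaries_3_eq Z \<omega>]
    by blast
qed

end
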